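(* (i) The limit $f(2,2)=\lim_{n\to\infty} f(2,2,n)/n$ exists, and $f(2,2)\in[\sqrt{7}-2,\ \tfrac{2}{3}]$. (ii) Assume the Caccetta–Häggkvist Conjecture holds. Then for every integer $\ell\ge 2$ the limit $f(2,\ell)=\lim_{n\to\infty} f(2,\ell,n)/n$ exists and equals $\frac{\ell}{\ell+1}$. (iii) For every integer $k\ge 3$ the limit $f(k)=\lim_{n\to\infty} f(k,n)/n$ exists and equals $\frac{1}{2}$.
   Context: A tournament is an orientation of a complete graph. An arborescence is an oriented tree with a designated root such that every vertex of the tree is reachable from the root by a directed path in the tree; its depth is the length (number of edges) of a longest directed path in it. An edge-colored arborescence is path-monochromatic if every directed path in it is monochromatic. A $k$-edge coloring of a digraph is an arbitrary assignment of one of $k$ colors to each edge. For positive integers $k,\ell$ and a tournament $T$, $f_T(k,\ell)$ denotes the largest integer $m$ such that every $k$-edge coloring of $T$ contains a path-monochromatic arborescence (as a subgraph of $T$) of depth at most $\ell$ with at least $m$ vertices; $f_T(k)$ is defined in the same way without any restriction on the depth. $f(k,\ell,n)$ (resp. $f(k,n)$) denotes the minimum of $f_T(k,\ell)$ (resp. $f_T(k)$) over all tournaments $T$ on $n$ vertices, and $f(k,\ell)=\lim_{n\to\infty}f(k,\ell,n)/n$, $f(k)=\lim_{n\to\infty}f(k,n)/n$ when these limits exist. The Caccetta–Häggkvist Conjecture states: if an $n$-vertex digraph has minimum out-degree at least $r\ge 1$, then it contains a directed cycle of length at most $\lceil n/r\rceil$. *)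

theory Defs
  imports Complex_Main "Graph_Theory.Digraph_Component"
begin

definition oriented_graph :: "'a pair_pre_digraph \<Rightarrow> bool" where
  "oriented_graph G \<longleftrightarrow>
     pair_digraph G \<and> (\<forall>u v. (u, v) \<in> parcs G \<longrightarrow> (v, u) \<notin> parcs G)"

definition tournament :: "'a pair_pre_digraph \<Rightarrow> bool" where
  "tournament T \<longleftrightarrow> oriented_graph T \<and>
     (\<forall>u\<in>pverts T. \<forall>v\<in>pverts T. u \<noteq> v \<longrightarrow> (u, v) \<in> parcs T \<or> (v, u) \<in> parcs T)"

text \<open>
  The library predicate \<^const>\<open>tree\<close> only excludes directed cycles, so it does not express that
  the underlying undirected graph is a tree. In the symmetric digraph
  \<^term>\<open>mk_symmetric G\<close> the cycles of length 2 are the arcs traversed back and forth; the cycles of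
  length at least 3 are the cycles of the underlying undirected graph.
\<close>

definition oriented_tree :: "'a pair_pre_digraph \<Rightarrow> bool" where
  "oriented_tree G \<longleftrightarrow> oriented_graph G \<and> Digraph_Component.connected (with_proj G) \<and>
     (\<nexists>p. pre_digraph.cycle (with_proj (mk_symmetric (with_proj G))) p \<and> 3 \<le> length p)"

definition arborescence :: "'a pair_pre_digraph \<Rightarrow> 'a \<Rightarrow> bool" where
  "arborescence A r \<longleftrightarrow> oriented_tree A \<and> r \<in> pverts A \<and>
     (\<forall>v\<in>pverts A. r \<rightarrow>\<^sup>*\<^bsub>with_proj A\<^esub> v)"

definition arb_depth :: "'a pair_pre_digraph \<Rightarrow> nat" where
  "arb_depth A = Max {length p | u p v. pre_digraph.apath (with_proj A) u p v}"

definition edge_coloring :: "nat \<Rightarrow> 'a pair_pre_digraph \<Rightarrow> ('a \<times> 'a \<Rightarrow> nat) \<Rightarrow> bool" where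
  "edge_coloring k G c \<longleftrightarrow> c ` parcs G \<subseteq> {..<k}"

definition path_monochromatic :: "('a \<times> 'a \<Rightarrow> nat) \<Rightarrow> 'a pair_pre_digraph \<Rightarrow> bool" where
  "path_monochromatic c A \<longleftrightarrow>
     (\<forall>u p v. pre_digraph.apath (with_proj A) u p v \<longrightarrow>
        (\<forall>e\<in>set p. \<forall>e'\<in>set p. c e = c e'))"

definition f_tour_depth :: "'a pair_pre_digraph \<Rightarrow> nat \<Rightarrow> nat \<Rightarrow> nat" where
  "f_tour_depth T k l = (GREATEST m. \<forall>c. edge_coloring k T c \<longrightarrow>
     (\<exists>A r. subgraph (with_proj A) (with_proj T) \<and> arborescence A r \<and> path_monochromatic c A \<and>
        arb_depth A \<le> l \<and> m \<le> card (pverts A)))"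

definition f_tour :: "'a pair_pre_digraph \<Rightarrow> nat \<Rightarrow> nat" where
  "f_tour T k = (GREATEST m. \<forall>c. edge_coloring k T c \<longrightarrow>
     (\<exists>A r. subgraph (with_proj A) (with_proj T) \<and> arborescence A r \<and> path_monochromatic c A \<and>
        m \<le> card (pverts A)))"

text \<open>
  Vertices are taken from \<^typ>\<open>nat\<close>, which realises every finite tournament and every finite
  digraph up to isomorphism.
\<close>

definition f_depth :: "nat \<Rightarrow> nat \<Rightarrow> nat \<Rightarrow> nat" where
  "f_depth k l n =
     Min {f_tour_depth T k l | T :: nat pair_pre_digraph. tournament T \<and> card (pverts T) = n}"

definition f_all :: "nat \<Rightarrow> nat \<Rightarrow> nat" where
  "f_all k n =
     Min {f_tour T k | T :: nat pair_pre_digraph. tournament T \<and> card (pverts T) = n}"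

text \<open>
  The null digraph has to be excluded: it satisfies the out-degree condition vacuously and would
  refute the conjecture.
\<close>

definition caccetta_haggkvist_conjecture :: bool where
  "caccetta_haggkvist_conjecture \<longleftrightarrow>
     (\<forall>(G :: nat pair_pre_digraph) (r :: nat).
        pair_digraph G \<and> pverts G \<noteq> {} \<and> 1 \<le> r \<and>
        (\<forall>v\<in>pverts G. r \<le> out_degree (with_proj G) v) \<longrightarrow>
        (\<exists>p. pre_digraph.cycle (with_proj G) p \<and>
             int (length p) \<le> \<lceil>real (card (pverts G)) / real r\<rceil>))"

end

(* Lower bounds with two colours: call (v, x) bad if no monochromatic path of length at most l leads
   from v to x. A directed cycle of bad pairs of length at most l+1 spans a subtournament in which,
   by Sands, Sauer and Woodrow, some vertex reaches its bad successor after all. So there is no such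
   cycle, and the Caccetta-Haggkvist conjecture (for l = 2, Shen's theorem on triangles)
   yields a vertex in few bad pairs.

   Reaching is weaker than lying in an arborescence, since two colours may need the same inner
   vertex. For l = 2 this is no problem, the inner vertices being out-neighbours of the root. For
   larger l a pair counts as good if it has many internally disjoint monochromatic links; a random
   bipartition of the vertices then serves both colours. A pair that is not good has a
   bounded hitting set for its links, and a random sample of boundedly many vertices
   avoids all those hitting sets while inheriting the degrees.

   The extremal examples are iterated lexicographic powers: of a directed triangle whose arcs have
   three different colours, and of a directed (l+2)-cycle in red whose chords are blue and
   descending. Their vertices are numbers, compared at the lowest differing digit in base m.
   From the digit a+1 one cannot get to the digit a in l monochromatic steps. *)
theory Submission
  imports Defs "HOL-Library.FuncSet" "HOL-Library.Disjoint_Sets"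
begin

section \<open>Walks, Sands-Sauer-Woodrow, and Shen's triangle theorem\<close>

text \<open>Both halves meet at one number. If every vertex is bad with more than the fraction
  1/(l+1) of the vertices, the conjecture yields a cycle of at most l+1 bad pairs. In a
  lexicographic power on m digits the missed fraction x satisfies x = 1/m + x/m: the part of one
  digit is missed outright, and the vertex's own part repeats the situation. Hence x = 1/(m-1),
  which is 1/(l+1) for m = l+2 and 1/2 for the triangle. For l = 2 without the conjecture, Shen's 3
  - sqrt 7 stands in for 1/3; as the bounds then differ, the limit is obtained by comparing
  different n through blow-ups. The sample is there because the conjecture does not control where
  its cycle runs: in the tournament itself the cycle could pass through the hitting set of one of
  its own pairs, and then Sands, Sauer and Woodrow would contradict nothing. In a sample of fixed
  size from a large tournament, sets of bounded size are rarely met.\<close>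

lemma relpow_subset_mono:
  fixes A B :: "('a \<times> 'a) set"
  shows "A \<subseteq> B \<Longrightarrow> A ^^ j \<subseteq> B ^^ j"
  by (induction j) auto

text \<open>Cut the walk at its last visit to \<open>v\<close>: after the next arc it uses no arc
  out of \<open>v\<close>.\<close>

lemma rtrancl_leave_source:
  assumes "(v, x) \<in> E\<^sup>*" "v \<noteq> x"
  shows "\<exists>y. (v, y) \<in> E \<and> (y, x) \<in> (E - {v} \<times> UNIV)\<^sup>*"
  using assms
proof (induction rule: rtrancl_induct)
  case (step y z)
  show ?case
  proof (cases "v = y")
    case False
    then obtain w where "(v, w) \<in> E" "(w, y) \<in> (E - {v} \<times> UNIV)\<^sup>*"
      using step.IH by blast
    moreover have "(y, z) \<in> E - {v} \<times> UNIV" using step.hyps False by auto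
    ultimately show ?thesis by (meson rtrancl.rtrancl_into_rtrancl)
  qed (use step in auto)
qed simp

text \<open>A shortest walk leaves each source at most once. This turns a bound on the number of
  inner vertices into a bound on the depth.\<close>

lemma rtrancl_imp_relpow_card_sources:
  assumes "finite Q" "(v, x) \<in> (E \<inter> Q \<times> UNIV)\<^sup>*"
  shows "\<exists>j\<le>card Q. (v, x) \<in> (E \<inter> Q \<times> UNIV) ^^ j"
  using assms
proof (induction Q arbitrary: v rule: finite_psubset_induct)
  case (psubset Q)
  show ?case
  proof (cases "v = x")
    case True
    then show ?thesis by (intro exI[of _ 0]) simp
  next
    case False
    obtain y where y: "(v, y) \<in> E \<inter> Q \<times> UNIV"
      "(y, x) \<in> (E \<inter> Q \<times> UNIV - {v} \<times> UNIV)\<^sup>*"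
      using rtrancl_leave_source[OF psubset.prems False] by blast
    have eq: "E \<inter> Q \<times> UNIV - {v} \<times> UNIV = E \<inter> (Q - {v}) \<times> UNIV" by auto
    have vQ: "v \<in> Q" using y by auto
    with y eq obtain j where j: "j \<le> card (Q - {v})" "(y, x) \<in> (E \<inter> (Q - {v}) \<times> UNIV) ^^ j"
      using psubset.IH[of "Q - {v}" y] by auto
    have "(y, x) \<in> (E \<inter> Q \<times> UNIV) ^^ j"
      using j(2) relpow_subset_mono[of "E \<inter> (Q - {v}) \<times> UNIV" "E \<inter> Q \<times> UNIV" j] by blast
    with y have "(v, x) \<in> (E \<inter> Q \<times> UNIV) ^^ Suc j" by (meson relpow_Suc_I2)
    moreover have "Suc j \<le> card Q" using j(1) vQ psubset.hyps
      by (metis Suc_le_mono card_Suc_Diff1)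
    ultimately show ?thesis by blast
  qed
qed

text \<open>In a minimal counterexample every \<open>x\<close> has a vertex \<open>f x\<close> that
  reaches all of \<open>S\<close> except \<open>x\<close>, so the arc between them goes from
  \<open>x\<close> to \<open>f x\<close>. Its colour cannot change along the orbit of
  \<open>f\<close>, and the orbit closes up, so \<open>f x\<close> reaches \<open>x\<close> after
  all.\<close>

theorem sands_sauer_woodrow:
  assumes "finite S" "S \<noteq> {}"
    and "\<And>x y. x \<in> S \<Longrightarrow> y \<in> S \<Longrightarrow> x \<noteq> y \<Longrightarrow> (x, y) \<in> R \<union> B \<or> (y, x) \<in> R \<union> B"
  shows "\<exists>v\<in>S. \<forall>x\<in>S. (v, x) \<in> (R \<inter> S \<times> S)\<^sup>* \<or> (v, x) \<in> (B \<inter> S \<times> S)\<^sup>*"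
  using assms
proof (induction S rule: finite_psubset_induct)
  case (psubset S)
  define reach where "reach v x \<longleftrightarrow> (v, x) \<in> (R \<inter> S \<times> S)\<^sup>* \<or> (v, x) \<in> (B \<inter> S \<times> S)\<^sup>*" for v x
  show ?case
  proof (rule ccontr)
    assume "\<not> ?thesis"
    then have no: "\<not> (\<forall>x\<in>S. reach v x)" if "v \<in> S" for v using that reach_def by blast
    have "\<exists>w\<in>S. \<forall>y\<in>S. reach w y \<longleftrightarrow> y \<noteq> x" if "x \<in> S" for x
    proof -
      have ne: "S - {x} \<noteq> {}"
        using no[OF that] that by (auto simp: reach_def)
      obtain w where w: "w \<in> S - {x}"
        "\<forall>y\<in>S - {x}. (w, y) \<in> (R \<inter> (S - {x}) \<times> (S - {x}))\<^sup>* \<or> (w, y) \<in> (B \<inter> (S - {x}) \<times> (S - {x}))\<^sup>*"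
        proof -
        have "\<exists>v\<in>S - {x}. \<forall>y\<in>S - {x}. (v, y) \<in> (R \<inter> (S - {x}) \<times> (S - {x}))\<^sup>*
            \<or> (v, y) \<in> (B \<inter> (S - {x}) \<times> (S - {x}))\<^sup>*"
          using \<open>x \<in> S\<close> ne by (intro psubset.IH psubset.prems(2)) auto
        then show ?thesis using that by blast
      qed
      have "(R \<inter> (S - {x}) \<times> (S - {x}))\<^sup>* \<subseteq> (R \<inter> S \<times> S)\<^sup>*"
        "(B \<inter> (S - {x}) \<times> (S - {x}))\<^sup>* \<subseteq> (B \<inter> S \<times> S)\<^sup>*"
        by (intro rtrancl_mono; blast)+
      then have "\<forall>y\<in>S - {x}. reach w y" using w unfolding reach_def by blast
      with no[of w] w show ?thesis by blast
    qed
    then obtain f where f: "\<And>x. x \<in> S \<Longrightarrow> f x \<in> S"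
      "\<And>x y. x \<in> S \<Longrightarrow> y \<in> S \<Longrightarrow> reach (f x) y \<longleftrightarrow> y \<noteq> x" by metis
    have arc: "(x, f x) \<in> R \<inter> S \<times> S \<or> (x, f x) \<in> B \<inter> S \<times> S" if x: "x \<in> S" for x
    proof -
      have "f x \<noteq> x" using f(2)[OF x x] by (auto simp: reach_def)
      moreover have "(f x, x) \<notin> R \<union> B" using f[OF x] f(2)[OF x x] x by (auto simp: reach_def)
      ultimately show ?thesis using psubset.prems(2)[OF x f(1)[OF x]] x f(1)[OF x] by auto
    qed
    \<comment> \<open>The vertex \<open>f (f x)\<close> reaches \<open>x\<close>. If it does so in
      the colour of the arc from \<open>x\<close> to \<open>f x\<close>, that arc prolongs the walk
      to \<open>f x\<close>; if in the colour of the next arc, that arc put in front gives a walk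
      from \<open>f x\<close> to \<open>x\<close>. The choice of \<open>f\<close> excludes
      both.\<close>
    have change: False
      if x: "x \<in> S" and C: "C = R \<and> C' = B \<or> C = B \<and> C' = R"
        and c: "(x, f x) \<in> C \<inter> S \<times> S" "(f x, f (f x)) \<in> C' \<inter> S \<times> S" for x C C'
    proof -
      have fx: "f x \<in> S" "f (f x) \<in> S" using f(1) x by auto
      have nofx: "\<not> reach (f x) x" "\<not> reach (f (f x)) (f x)" using f(2) x fx by auto
      have "reach (f (f x)) x"
        using f(2)[OF fx(1) x] f(2)[OF x x] by (auto simp: reach_def)
      then have "(f (f x), x) \<in> (C \<inter> S \<times> S)\<^sup>* \<or> (f (f x), x) \<in> (C' \<inter> S \<times> S)\<^sup>*"
        using C by (auto simp: reach_def)
      then show False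
      proof
        assume "(f (f x), x) \<in> (C \<inter> S \<times> S)\<^sup>*"
        with c(1) have "(f (f x), f x) \<in> (C \<inter> S \<times> S)\<^sup>*" by (meson rtrancl.rtrancl_into_rtrancl)
        with nofx C show False by (auto simp: reach_def)
      next
        assume "(f (f x), x) \<in> (C' \<inter> S \<times> S)\<^sup>*"
        with c(2) have "(f x, x) \<in> (C' \<inter> S \<times> S)\<^sup>*" by (meson converse_rtrancl_into_rtrancl)
        with nofx C show False by (auto simp: reach_def)
      qed
    qed
    obtain x where x: "x \<in> S" using psubset.prems by blast
    obtain C C' where C: "C = R \<and> C' = B \<or> C = B \<and> C' = R" "(x, f x) \<in> C \<inter> S \<times> S"
      using arc[OF x] by blast
    have orb: "(f ^^ k) x \<in> S \<and> ((f ^^ k) x, f ((f ^^ k) x)) \<in> C \<inter> S \<times> S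
        \<and> (f x, f ((f ^^ k) x)) \<in> (C \<inter> S \<times> S)\<^sup>*" for k
    proof (induction k)
      case (Suc k)
      let ?y = "(f ^^ k) x"
      have y: "?y \<in> S" "f ?y \<in> S" using Suc f(1) by auto
      have "(f ?y, f (f ?y)) \<in> C \<inter> S \<times> S"
        using arc[OF y(2)] change[OF y(1) C(1)] Suc C(1) by blast
      with Suc y show ?case by (auto intro: rtrancl.rtrancl_into_rtrancl)
    qed (use x C in auto)
    define Orb where "Orb = range (\<lambda>k. (f ^^ k) x)"
    have "Orb \<subseteq> S" using orb by (auto simp: Orb_def)
    \<comment> \<open>The vertex \<open>f x\<close> misses \<open>x\<close> alone, hence determines
      it. An injection of the finite orbit into itself is onto, so \<open>x\<close> has a
      predecessor on its own orbit.\<close>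
    have "inj_on f S" using f by (intro inj_onI) metis
    then have "inj_on f Orb" using \<open>Orb \<subseteq> S\<close> inj_on_subset by blast
    moreover have "f ` Orb \<subseteq> Orb"
      by (auto simp: Orb_def) (metis funpow.simps(2) comp_apply rangeI)
    ultimately have "f ` Orb = Orb"
      using \<open>Orb \<subseteq> S\<close> psubset.hyps by (intro endo_inj_surj) (auto intro: finite_subset)
    moreover have "x \<in> Orb" unfolding Orb_def by (rule image_eqI[of _ _ 0]) auto
    ultimately have "x \<in> f ` Orb" by simp
    then obtain y where y: "y \<in> Orb" "x = f y" by blast
    then obtain k where "y = (f ^^ k) x" unfolding Orb_def by blast
    with y(2) have "f ((f ^^ k) x) = x" by metis
    with orb[of k] have "(f x, x) \<in> (C \<inter> S \<times> S)\<^sup>*" by metis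
    then have "reach (f x) x" using C(1) unfolding reach_def by blast
    with f(2)[OF x x] show False by blast
  qed
qed


section \<open>Directed triangles in dense oriented graphs\<close>

text \<open>Arcs, reversed arcs and a loop \<open>(d, d)\<close> are different pairs. The loop makes
  the inequality strict, and the contradiction in the triangle count rests on that
  strictness.\<close>

lemma card_orientation_less:
  assumes "finite D" "D \<noteq> {}" "F \<subseteq> D \<times> D" "\<And>u v. (u, v) \<in> F \<Longrightarrow> (v, u) \<notin> F"
  shows "2 * card F < card D * card D"
proof -
  have fin: "finite F" using assms finite_subset by blast
  obtain d where d: "d \<in> D" using assms by blast
  have "2 * card F = card F + card (F\<inverse>)" by simp
  also have "\<dots> = card (F \<union> F\<inverse>)" using fin assms(4) by (subst card_Un_disjoint) auto
  also have "\<dots> < card (D \<times> D)"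
    using assms d by (intro psubset_card_mono) auto
  finally show ?thesis by (simp add: card_cartesian_product)
qed

text \<open>Shen's argument: the constant is the root of \<open>c\<^sup>2 - 6 c + 2 = 0\<close>, where the
  double count of transitive triangles becomes contradictory.\<close>

theorem shen_directed_triangle:
  fixes V :: "'a set"
  assumes "finite V" "V \<noteq> {}" "E \<subseteq> V \<times> V" "\<And>u v. (u, v) \<in> E \<Longrightarrow> (v, u) \<notin> E"
    and "\<And>u. u \<in> V \<Longrightarrow> (3 - sqrt 7) * real (card V) \<le> real (card (E `` {u}))"
  shows "\<exists>u v w. (u, v) \<in> E \<and> (v, w) \<in> E \<and> (w, u) \<in> E"
  using assms
proof (induction V arbitrary: E rule: finite_psubset_induct)
  case (psubset V)
  define c :: real where "c = 3 - sqrt 7"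
  have s7: "sqrt 7 * sqrt 7 = (7::real)" "sqrt 7 < (3::real)" "2 < sqrt (7::real)"
    by (auto intro: real_less_lsqrt real_less_rsqrt)
  have "c * (3 - c / 2) = (9 - sqrt 7 * sqrt 7) / 2" by (simp add: c_def algebra_simps diff_divide_distrib)
  with s7 have c: "0 < c" "c < 1" "c * (3 - c / 2) = 1" by (auto simp: c_def)
  define n where "n = card V"
  have n: "0 < n" using psubset by (simp add: n_def card_gt_0_iff)
  define r where "r = nat \<lceil>c * real n\<rceil>"
  have r: "c * real n \<le> real r" "0 < r" using c n by (auto simp: r_def of_nat_ceiling)
  show ?case
  proof (rule ccontr)
    assume notri: "\<not> ?thesis"
    \<comment> \<open>Out-neighbourhoods are trimmed to exactly \<open>r\<close> vertices, so that
      sums over arcs can be evaluated. The in-neighbourhoods \<open>I v\<close> refer to the trimmed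
      digraph.\<close>
    have "\<exists>D\<subseteq>E `` {u}. card D = r" if "u \<in> V" for u
    proof -
      have "r \<le> card (E `` {u})"
        using psubset.prems(4)[OF that] unfolding r_def n_def c_def by (simp add: nat_le_iff ceiling_le_iff)
      then show ?thesis by (metis obtain_subset_with_card_n)
    qed
    then obtain D where D: "\<And>u. u \<in> V \<Longrightarrow> D u \<subseteq> E `` {u}" "\<And>u. u \<in> V \<Longrightarrow> card (D u) = r" by metis
    have DV: "D u \<subseteq> V" if "u \<in> V" for u using D(1)[OF that] psubset.prems(2) by blast
    have finD: "finite (D u)" if "u \<in> V" for u using DV[OF that] psubset.hyps finite_subset by blast
    have E: "(u, v) \<in> E" if "u \<in> V" "v \<in> D u" for u v using D that by blast
    have irr: "(u, u) \<notin> E" for u using psubset.prems(3) by blast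
    define I where "I v = {u \<in> V. v \<in> D u}" for v
    have finI: "finite (I v)" and IV: "I v \<subseteq> V" for v using psubset.hyps by (auto simp: I_def)
    define f where "f u v = card (D u \<inter> D v)" for u v
    \<comment> \<open>The sets \<open>D v\<close>, \<open>I v\<close>, \<open>I u - I v\<close> and,
      for a suitable \<open>w\<close> in \<open>D u \<inter> D v\<close>, also
      \<open>D w - D v\<close> are pairwise disjoint: any nontrivial overlap closes a directed
      triangle or a 2-cycle. The last set accounts for the term with \<open>f u v\<close>.\<close>
    have key: "real r + real (card (I v)) + real (card (I u - I v)) + (1 - c) * real (f u v) \<le> real n"
      if u: "u \<in> V" and v: "v \<in> D u" for u v
    proof -
      have vV: "v \<in> V" using DV u v by blast
      have cI: "card (I u \<union> I v) = card (I v) + card (I u - I v)"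
        using card_Un_disjoint[of "I v" "I u - I v"] finI by (simp add: Un_commute)
      have dis: "D v \<inter> (I u \<union> I v) = {}"
      proof -
        have False if x: "x \<in> D v" "x \<in> V" "u \<in> D x \<or> v \<in> D x" for x
          using x(3) E[OF vV x(1)] E[OF x(2)] E[OF u v] psubset.prems(3) notri by blast
        then show ?thesis unfolding I_def by blast
      qed
      show ?thesis
      proof (cases "D u \<inter> D v = {}")
        case True
        have "card (D v) + card (I u \<union> I v) = card (D v \<union> (I u \<union> I v))"
          using dis finD[OF vV] finI by (subst card_Un_disjoint) auto
        also have "\<dots> \<le> n" unfolding n_def
          using psubset.hyps DV[OF vV] IV by (intro card_mono) auto
        finally show ?thesis using cI D(2)[OF vV] True by (simp add: f_def)
      next
        case False
        define W where "W = D u \<inter> D v"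
        have W: "W \<subset> V" "W \<noteq> {}" using DV[OF u] False E[OF u, of u] irr[of u] u unfolding W_def by blast+
        \<comment> \<open>The smaller set \<open>W\<close> has no directed triangle either, so by
          induction some \<open>w\<close> has few out-neighbours inside it. The set
          \<open>D w\<close> meets \<open>D v\<close> only there and in
          \<open>D v - D u\<close>.\<close>
        have "\<exists>w\<in>W. real (card ((E \<inter> W \<times> W) `` {w})) < c * real (card W)"
        proof (rule ccontr)
          assume "\<not> ?thesis"
          then have "\<exists>u v w. (u, v) \<in> E \<inter> W \<times> W \<and> (v, w) \<in> E \<inter> W \<times> W \<and> (w, u) \<in> E \<inter> W \<times> W"
            using W psubset.prems(3) unfolding c_def
            by (intro psubset.IH) (auto simp: not_less)
          with notri show False by blast
        qed
        then obtain w where w: "w \<in> W" "real (card ((E \<inter> W \<times> W) `` {w})) < c * real (card W)" by blast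
        have wV: "w \<in> V" using w W by blast
        have "card (D w \<inter> D v) \<le> card ((E \<inter> W \<times> W) `` {w} \<union> (D v - D u))"
        proof (intro card_mono)
          have "(E \<inter> W \<times> W) `` {w} \<subseteq> V" using W by blast
          then show "finite ((E \<inter> W \<times> W) `` {w} \<union> (D v - D u))"
            using psubset.hyps finD[OF vV] finite_subset by blast
          show "D w \<inter> D v \<subseteq> (E \<inter> W \<times> W) `` {w} \<union> (D v - D u)"
            using E[OF wV] w(1) unfolding W_def by blast
        qed
        also have "\<dots> \<le> card ((E \<inter> W \<times> W) `` {w}) + card (D v - D u)" by (rule card_Un_le)
        also have "card (D v - D u) = r - card W"
          using card_Diff_subset_Int[of "D v" "D u"] finD[OF u] D(2)[OF vV] by (simp add: W_def Int_commute)
        finally have le: "card (D w \<inter> D v) \<le> card ((E \<inter> W \<times> W) `` {w}) + (r - card W)" .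
        have Wr: "card W \<le> r" using D(2)[OF vV] finD[OF vV] unfolding W_def by (metis card_mono inf_le2)
        have "card (D w - D v) = r - card (D w \<inter> D v)"
          using card_Diff_subset_Int[of "D w" "D v"] finD[OF wV] D(2)[OF wV] by simp
        then have X2: "(1 - c) * real (f u v) \<le> real (card (D w - D v))"
          using le w(2) Wr unfolding f_def W_def[symmetric] by (simp add: algebra_simps)
        have dis2: "(D w - D v) \<inter> (I u \<union> I v) = {}"
        proof -
          have "w \<in> D u" "w \<in> D v" using w(1) by (auto simp: W_def)
          then have False if x: "x \<in> D w" "x \<in> V" "u \<in> D x \<or> v \<in> D x" for x
            using x(3) E[OF wV x(1)] E[OF x(2)] E[OF u] E[OF vV] notri by blast
          then show ?thesis unfolding I_def by blast
        qed
        have "card (D v) + card (D w - D v) + card (I u \<union> I v) = card (D v \<union> (D w - D v)) + card (I u \<union> I v)"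
          using finD[OF vV] finD[OF wV] by (subst card_Un_disjoint[of "D v"]) auto
        also have "\<dots> = card ((D v \<union> (D w - D v)) \<union> (I u \<union> I v))"
          using dis dis2 finD[OF vV] finD[OF wV] finI by (subst card_Un_disjoint[of _ "I u \<union> I v"]) auto
        also have "\<dots> \<le> n" unfolding n_def
          using psubset.hyps DV[OF vV] DV[OF wV] IV by (intro card_mono) auto
        finally show ?thesis using cI D(2)[OF vV] X2 by linarith
      qed
    qed
    have swap: "(\<Sum>u\<in>V. \<Sum>v\<in>D u. g u v) = (\<Sum>v\<in>V. \<Sum>u\<in>I v. g u v)" for g :: "'a \<Rightarrow> 'a \<Rightarrow> real"
    proof -
      have "(\<Sum>u\<in>V. \<Sum>v\<in>D u. g u v) = (\<Sum>u\<in>V. \<Sum>v\<in>{v \<in> V. v \<in> D u}. g u v)"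
        using DV by (intro sum.cong) auto
      also have "\<dots> = (\<Sum>v\<in>V. \<Sum>u\<in>I v. g u v)"
        unfolding I_def using psubset.hyps by (intro sum.swap_restrict) auto
      finally show ?thesis .
    qed
    define t where "t = (\<Sum>u\<in>V. \<Sum>v\<in>D u. real (f u v))"
    have sumr: "(\<Sum>u\<in>V. \<Sum>v\<in>D u. k) = k * real n * real r" for k :: real
      using D(2) by (simp add: n_def)
    have sumI: "(\<Sum>v\<in>V. real (card (I v))) = real n * real r"
      using swap[of "\<lambda>u v. 1"] sumr[of 1] by simp
    \<comment> \<open>The squares of \<open>card (I v) - r\<close> are nonnegative, and the numbers
      \<open>card (I v)\<close> have mean \<open>r\<close>.\<close>
    have sumI2: "(\<Sum>u\<in>V. \<Sum>v\<in>D u. real (card (I v))) \<ge> real n * (real r)\<^sup>2"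
    proof -
      have "(\<Sum>u\<in>V. \<Sum>v\<in>D u. real (card (I v))) = (\<Sum>v\<in>V. (real (card (I v)))\<^sup>2)"
        unfolding swap by (simp add: power2_eq_square)
      also have "\<dots> \<ge> (\<Sum>v\<in>V. 2 * real r * real (card (I v)) - (real r)\<^sup>2)"
        using sum_squares_bound by (intro sum_mono) (smt (verit) zero_le_power2 power2_diff mult.commute mult.assoc)
      also have "(\<Sum>v\<in>V. 2 * real r * real (card (I v)) - (real r)\<^sup>2) = real n * (real r)\<^sup>2"
        using sumI by (simp add: sum_subtractf n_def flip: sum_distrib_left) (simp add: power2_eq_square)
      finally show ?thesis .
    qed
    \<comment> \<open>Double count of the paths x, u, v without an arc from x to v: an arc from x to
      u leaves \<open>r - f x u\<close> choices of v. Here \<open>t\<close> counts transitive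
      triangles.\<close>
    have sumq: "(\<Sum>u\<in>V. \<Sum>v\<in>D u. real (card (I u - I v))) = real n * (real r)\<^sup>2 - t"
    proof -
      have a: "real (card (I u - I v)) = (\<Sum>x\<in>I u. if v \<in> D x then 0 else 1)" for u v
      proof -
        have "I u - I v = {x \<in> I u. v \<notin> D x}" by (auto simp: I_def)
        then show ?thesis using finI by (simp add: sum.If_cases Int_def)
      qed
      have b: "(\<Sum>v\<in>D u. if v \<in> D x then 0 else 1) = real r - real (f x u)" if "u \<in> V" "x \<in> V" for u x
      proof -
        have "{v \<in> D u. v \<notin> D x} = D u - D x" by auto
        moreover have "real (card (D u - D x)) = real r - real (f x u)"
          using card_Diff_subset_Int[of "D u" "D x"] finD[OF that(1)] D(2)[OF that(1)] card_mono[of "D u" "D x \<inter> D u"]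
          by (simp add: f_def Int_commute of_nat_diff)
        ultimately show ?thesis using finD[OF that(1)] by (simp add: sum.If_cases Int_def)
      qed
      have "(\<Sum>u\<in>V. \<Sum>v\<in>D u. real (card (I u - I v))) = (\<Sum>u\<in>V. \<Sum>x\<in>I u. \<Sum>v\<in>D u. if v \<in> D x then 0 else 1)"
        unfolding a by (intro sum.cong refl sum.swap)
      also have "\<dots> = (\<Sum>u\<in>V. \<Sum>x\<in>I u. real r - real (f x u))"
        using b IV by (intro sum.cong refl) auto
      also have "\<dots> = (\<Sum>x\<in>V. \<Sum>u\<in>D x. real r - real (f x u))"
        using swap[of "\<lambda>x u. real r - real (f x u)"] by simp
      also have "\<dots> = real n * (real r)\<^sup>2 - t"
        unfolding sum_subtractf t_def using sumr[of "real r"] by (simp add: power2_eq_square)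
      finally show ?thesis .
    qed
    \<comment> \<open>The inner sum counts arcs between vertices of \<open>D u\<close>, which form
      an oriented graph on \<open>r\<close> vertices.\<close>
    have t: "2 * t < real n * (real r)\<^sup>2"
    proof -
      have "2 * (\<Sum>v\<in>D u. real (f u v)) < (real r)\<^sup>2" if u: "u \<in> V" for u
      proof -
        have "(\<Sum>v\<in>D u. f u v) = card (SIGMA v:D u. D u \<inter> D v)"
          unfolding f_def using finD[OF u] by (subst card_SigmaI) auto
        moreover have "2 * card (SIGMA v:D u. D u \<inter> D v) < card (D u) * card (D u)"
          using finD[OF u] D(2)[OF u] r(2) DV[OF u] E psubset.prems(3)
          by (intro card_orientation_less) (auto, blast)
        ultimately have "2 * (\<Sum>v\<in>D u. f u v) < r * r" using D(2)[OF u] by simp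
        then have "real (2 * (\<Sum>v\<in>D u. f u v)) < real (r * r)" by (simp only: of_nat_less_iff)
        then show ?thesis by (simp add: power2_eq_square)
      qed
      then have "(\<Sum>u\<in>V. 2 * (\<Sum>v\<in>D u. real (f u v))) < (\<Sum>u\<in>V. (real r)\<^sup>2)"
        using psubset by (intro sum_strict_mono) auto
      then show ?thesis unfolding t_def by (simp add: n_def sum_distrib_left)
    qed
    have "(\<Sum>u\<in>V. \<Sum>v\<in>D u. real r + real (card (I v)) + real (card (I u - I v)) + (1 - c) * real (f u v))
        \<le> (\<Sum>u\<in>V. \<Sum>v\<in>D u. real n)"
      using key by (intro sum_mono) auto
    then have "real r * real n * real r + (\<Sum>u\<in>V. \<Sum>v\<in>D u. real (card (I v))) + (real n * (real r)\<^sup>2 - t)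
        + (1 - c) * t \<le> real n * real n * real r"
      unfolding sum.distrib sumr sumq t_def sum_distrib_left by simp
    with sumI2 have "3 * (real n * (real r)\<^sup>2) - c * t \<le> real n * real n * real r"
      by (simp add: algebra_simps power2_eq_square)
    moreover have "c * t < c * (real n * (real r)\<^sup>2 / 2)" using t c by simp
    ultimately have "(real n * real r) * (real r * (3 - c / 2)) < (real n * real r) * real n"
      by (simp add: algebra_simps power2_eq_square)
    then have "real r * (3 - c / 2) < real n" using n r by (simp add: mult_less_cancel_left)
    moreover have "c * real n * (3 - c / 2) \<le> real r * (3 - c / 2)"
      using r c by (intro mult_right_mono) auto
    moreover have "c * real n * (3 - c / 2) = (c * (3 - c / 2)) * real n" by (simp only: ac_simps)
    ultimately show False using c(3) by simp
  qed
qed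

section \<open>Splitting and sampling\<close>

text \<open>The union of a largest disjoint subfamily meets every member, since a member missing it
  could be added.\<close>

lemma disjoint_subfamily_or_hitting_set:
  assumes "finite \<P>" "\<And>P. P \<in> \<P> \<Longrightarrow> finite P \<and> P \<noteq> {} \<and> card P \<le> q"
  shows "(\<exists>F\<subseteq>\<P>. disjoint F \<and> card F = M) \<or>
    (\<exists>H. finite H \<and> card H \<le> M * q \<and> H \<subseteq> \<Union>\<P> \<and> (\<forall>P\<in>\<P>. P \<inter> H \<noteq> {}))"
proof -
  let ?C = "{F. F \<subseteq> \<P> \<and> disjoint F}"
  have "finite ?C" using assms(1) by simp
  moreover have "{} \<in> ?C" by (simp add: disjoint_def)
  ultimately have "Max (card ` ?C) \<in> card ` ?C" by (intro Max_in) auto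
  then obtain F where "F \<in> ?C" "card F = Max (card ` ?C)" by auto
  with \<open>finite ?C\<close> have F: "F \<in> ?C" "\<And>F'. F' \<in> ?C \<Longrightarrow> card F' \<le> card F" by auto
  have finF: "finite F" using F assms(1) finite_subset by blast
  show ?thesis
  proof (cases "M \<le> card F")
    case True
    obtain F' where "F' \<subseteq> F" "card F' = M" using obtain_subset_with_card_n[OF True] by blast
    moreover from this have "F' \<subseteq> \<P>" "disjoint F'" using F(1) by (auto intro: pairwise_subset)
    ultimately show ?thesis by auto
  next
    case False
    have "card (\<Union>F) \<le> (\<Sum>P\<in>F. card P)" using card_Union_le_sum_card by blast
    also have "\<dots> \<le> card F * q" using F(1) assms(2) sum_bounded_above[of F card q] by auto
    also have "\<dots> \<le> M * q" using False by simp
    finally have "card (\<Union>F) \<le> M * q" .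
    moreover have "P \<inter> \<Union>F \<noteq> {}" if P: "P \<in> \<P>" for P
    proof
      assume e: "P \<inter> \<Union>F = {}"
      then have "P \<notin> F" using assms(2)[OF P] by blast
      moreover have "insert P F \<in> ?C" using e F(1) P unfolding disjoint_def by auto
      ultimately show False using F(2)[of "insert P F"] finF by simp
    qed
    moreover have "finite (\<Union>F)" "\<Union>F \<subseteq> \<Union>\<P>" using finF F(1) assms(2) by auto
    ultimately show ?thesis by blast
  qed
qed

text \<open>A uniformly random subset of \<open>V\<close> contains a given \<open>P\<close> with
  probability at least \<open>1 / 2 ^ l\<close>, and for disjoint sets these events are
  independent.\<close>

lemma card_subsets_containing_none:
  assumes "finite F" "finite V" "disjoint F" "\<And>P. P \<in> F \<Longrightarrow> P \<subseteq> V \<and> card P \<le> l"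
  shows "real (card {S \<in> Pow V. \<forall>P\<in>F. \<not> P \<subseteq> S}) \<le> 2 ^ card V * (1 - 1 / 2 ^ l) ^ card F"
  using assms
proof (induction F arbitrary: V rule: finite_induct)
  case empty
  then show ?case by (simp add: card_Pow flip: Pow_def)
next
  case (insert P F)
  let ?A = "{S \<in> Pow V. \<forall>Q\<in>insert P F. \<not> Q \<subseteq> S}" and ?B = "{S \<in> Pow (V - P). \<forall>Q\<in>F. \<not> Q \<subseteq> S}"
  have P: "P \<subseteq> V" "card P \<le> l" "finite P" using insert.prems by (auto intro: finite_subset)
  have dj: "Q \<inter> P = {}" "Q \<subseteq> V" if "Q \<in> F" for Q
    using insert.prems insert.hyps that unfolding disjoint_def by auto
  \<comment> \<open>Each \<open>S\<close> splits into its trace on \<open>P\<close>, which is not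
    all of \<open>P\<close>, and the rest. The other members miss \<open>P\<close>, so containing
    one of them depends on the rest alone.\<close>
  have "inj_on (\<lambda>S. (S \<inter> P, S - P)) ?A" by (intro inj_onI) auto
  moreover have "(\<lambda>S. (S \<inter> P, S - P)) ` ?A \<subseteq> (Pow P - {P}) \<times> ?B" using dj by auto
  moreover have "finite ((Pow P - {P}) \<times> ?B)" using P(3) insert.prems(1) by simp
  ultimately have "card ?A \<le> card ((Pow P - {P}) \<times> ?B)" by (intro card_inj_on_le)
  then have "real (card ?A) \<le> real (card (Pow P - {P}) * card ?B)"
    unfolding card_cartesian_product by (simp only: of_nat_le_iff)
  also have "\<dots> = real (card (Pow P - {P})) * real (card ?B)" by (rule of_nat_mult)
  also have "card (Pow P - {P}) = 2 ^ card P - 1" using P by (subst card_Diff_subset) (auto simp: card_Pow)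
  also have "real (card ?B) \<le> 2 ^ card (V - P) * (1 - 1 / 2 ^ l) ^ card F"
    using insert.prems insert.hyps dj by (intro insert.IH) (auto simp: disjoint_def)
  finally have le: "real (card ?A) \<le> real (2 ^ card P - 1) * (2 ^ card (V - P) * (1 - 1 / 2 ^ l) ^ card F)"
    by (simp add: mult_left_mono)
  have "card V = card P + card (V - P)"
    using P insert.prems by (metis card_Diff_subset card_mono le_add_diff_inverse)
  then have "real (2 ^ card P - 1) * 2 ^ card (V - P) = 2 ^ card V * (1 - 1 / 2 ^ card P)"
    by (simp add: power_add algebra_simps of_nat_diff)
  also have "\<dots> \<le> 2 ^ card V * (1 - 1 / 2 ^ l)"
    using P by (intro mult_left_mono) (auto simp: field_simps)
  finally have "real (2 ^ card P - 1) * 2 ^ card (V - P) * (1 - 1 / 2 ^ l) ^ card F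
      \<le> 2 ^ card V * (1 - 1 / 2 ^ l) * (1 - 1 / 2 ^ l) ^ card F"
    by (intro mult_right_mono) (auto simp: field_simps)
  with le insert.hyps show ?case by (simp add: algebra_simps)
qed

text \<open>Average over all \<open>S\<close>: for each \<open>x\<close> at most the fraction
  \<open>(1 - 1 / 2 ^ l) ^ M\<close> of them is bad. Complementation transfers this from
  \<open>S\<close> to \<open>V - S\<close>.\<close>

lemma exists_splitting_set:
  fixes F :: "'b \<Rightarrow> 'a set set" and red :: "'b \<Rightarrow> bool"
  assumes "finite V" "finite X"
    and F: "\<And>x. x \<in> X \<Longrightarrow> disjoint (F x) \<and> card (F x) = M \<and> (\<forall>P\<in>F x. P \<subseteq> V \<and> card P \<le> l)"
  shows "\<exists>S\<subseteq>V. real (card {x \<in> X. \<forall>P\<in>F x. \<not> P \<subseteq> (if red x then S else V - S)})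
    \<le> real (card X) * (1 - 1 / 2 ^ l) ^ M"
proof (rule ccontr)
  define bad where "bad x S \<longleftrightarrow> (\<forall>P\<in>F x. \<not> P \<subseteq> (if red x then S else V - S))" for x S
  let ?q = "(1 - 1 / 2 ^ l) ^ M :: real"
  assume "\<not> ?thesis"
  then have gt: "real (card X) * ?q < real (card {x \<in> X. bad x S})" if "S \<in> Pow V" for S
    using that by (auto simp: bad_def not_le)
  have le: "real (card {S \<in> Pow V. bad x S}) \<le> 2 ^ card V * ?q" if x: "x \<in> X" for x
  proof -
    have finF: "finite (F x)" using F[OF x] assms(1) by (meson finite_Pow_iff finite_subset subsetI PowI)
    have bound: "real (card {S \<in> Pow V. \<forall>P\<in>F x. \<not> P \<subseteq> S}) \<le> 2 ^ card V * ?q"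
      using card_subsets_containing_none[OF finF assms(1), of l] F[OF x] by auto
    show ?thesis
    proof (cases "red x")
      case True
      then show ?thesis using bound by (simp add: bad_def)
    next
      case False
      have "(\<lambda>S. V - S) ` {S \<in> Pow V. bad x S} \<subseteq> {S \<in> Pow V. \<forall>P\<in>F x. \<not> P \<subseteq> S}"
        using False by (auto simp: bad_def)
      moreover have "inj_on (\<lambda>S. V - S) {S \<in> Pow V. bad x S}" by (intro inj_onI) blast
      ultimately have "card {S \<in> Pow V. bad x S} \<le> card {S \<in> Pow V. \<forall>P\<in>F x. \<not> P \<subseteq> S}"
        using assms(1) by (intro card_inj_on_le) auto
      with bound show ?thesis by linarith
    qed
  qed
  have cs: "real (card {S \<in> Pow V. bad x S}) = (\<Sum>S\<in>Pow V. if bad x S then 1 else 0)" for x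
    using assms(1) by (simp add: sum.If_cases Int_def)
  have cx: "real (card {x \<in> X. bad x S}) = (\<Sum>x\<in>X. if bad x S then 1 else 0)" for S
    using assms(2) by (simp add: sum.If_cases Int_def)
  have "(\<Sum>S\<in>Pow V. real (card X) * ?q) < (\<Sum>S\<in>Pow V. real (card {x \<in> X. bad x S}))"
    using gt assms(1) by (intro sum_strict_mono) auto
  also have "\<dots> = (\<Sum>x\<in>X. real (card {S \<in> Pow V. bad x S}))"
    unfolding cs cx by (rule sum.swap)
  also have "\<dots> \<le> (\<Sum>x\<in>X. 2 ^ card V * ?q)" using le by (intro sum_mono)
  finally show False using assms(1) by (simp add: card_Pow)
qed

section \<open>Random samples of bounded size\<close>

text \<open>The factor per draw in a Chernoff bound for the lower tail:
  \<open>1 - \<eta> * b\<close> bounds the mean of a weight that is \<open>1 - \<eta>\<close> on a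
  hit, and the power of \<open>1 - \<eta>\<close> pays for the threshold \<open>a\<close>. To first
  order the product is \<open>1 - \<eta> * (b - a)\<close>, hence below 1 for small \<eta>.\<close>

lemma exp_decay_rate:
  fixes a b :: real
  assumes "0 < a" "a < b" "b < 1"
  obtains \<eta> \<kappa> where "0 < \<eta>" "\<eta> < 1" "0 < \<kappa>" "\<kappa> < 1" "(1 - \<eta> * b) * (1 - \<eta>) powr (- a) \<le> \<kappa>"
proof -
  \<comment> \<open>Half the distance from \<open>a / b\<close> to 1, so that
    \<open>a / (1 - e) < b\<close> and the exponent in \<open>k\<close> is negative.\<close>
  define e where "e = (1 - a / b) / 2"
  define k where "k = exp (- (e * (b - a / (1 - e))))"
  have e: "0 < e" "e < 1" "a / b < 1 - e" using assms by (auto simp: e_def field_simps)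
  then have lt: "a / (1 - e) < b" using assms by (simp add: field_simps)
  have "ln y \<ge> - ((1 - y) / y)" if "0 < y" for y :: real
    using ln_le_minus_one[of "1 / y"] that by (simp add: ln_div field_simps)
  from this[of "1 - e"] have "- ln (1 - e) \<le> e / (1 - e)" using e by simp
  then have "a * - ln (1 - e) \<le> a * (e / (1 - e))" using assms by (intro mult_left_mono) auto
  then have "(1 - e) powr (- a) \<le> exp (a * (e / (1 - e)))"
    using e by (simp add: powr_def)
  moreover have "1 - e * b \<le> exp (- (e * b))" using exp_ge_add_one_self[of "- (e * b)"] by simp
  ultimately have "(1 - e * b) * (1 - e) powr (- a) \<le> exp (- (e * b)) * exp (a * (e / (1 - e)))"
    by (intro mult_mono) auto
  also have "\<dots> = k" unfolding k_def by (simp add: algebra_simps flip: exp_add)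
  finally show ?thesis using e lt by (intro that[of e k]) (auto simp: k_def)
qed

text \<open>Exponential moments: where the number of hits is below \<open>a\<close>, the weight
  \<open>1 - \<eta>\<close> to that number is at least \<open>(1 - \<eta>) powr a\<close>, so the
  total weight bounds the number of such maps. With \<open>\<phi> i\<close> fixed, the total factors
  over the other \<open>s - 1\<close> coordinates.\<close>

lemma card_PiE_few_hits:
  fixes V :: "'a set" and U :: "'a \<Rightarrow> 'a set" and a b \<eta> :: real
  assumes "finite V" "i < s" "0 < \<eta>" "\<eta> < 1"
    and U: "\<And>v. v \<in> V \<Longrightarrow> U v \<subseteq> V \<and> b * card V \<le> card (U v)"
  shows "card {\<phi> \<in> {..<s} \<rightarrow>\<^sub>E V. card {j \<in> {..<s} - {i}. \<phi> j \<in> U (\<phi> i)} < a} * (1 - \<eta>) powr a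
    \<le> card V ^ s * (1 - \<eta> * b) ^ (s - 1)"
proof -
  define \<Phi> where "\<Phi> = {..<s} \<rightarrow>\<^sub>E V"
  define X where "X \<phi> = card {j \<in> {..<s} - {i}. \<phi> j \<in> U (\<phi> i)}" for \<phi> :: "nat \<Rightarrow> 'a"
  define w where "w v u = (if u \<in> U v then 1 - \<eta> else 1)" for v u
  have fin: "finite \<Phi>" unfolding \<Phi>_def using assms by (intro finite_PiE) auto
  have X: "(1 - \<eta>) ^ X \<phi> = (\<Prod>j\<in>{..<s} - {i}. w (\<phi> i) (\<phi> j))" for \<phi>
    unfolding w_def X_def by (simp add: prod.If_cases Int_def)
  have "card {\<phi> \<in> \<Phi>. X \<phi> < a} * (1 - \<eta>) powr a = (\<Sum>\<phi>\<in>{\<phi> \<in> \<Phi>. X \<phi> < a}. (1 - \<eta>) powr a)" by simp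
  also have "\<dots> \<le> (\<Sum>\<phi>\<in>{\<phi> \<in> \<Phi>. X \<phi> < a}. (1 - \<eta>) ^ X \<phi>)"
  proof (intro sum_mono)
    fix \<phi> assume "\<phi> \<in> {\<phi> \<in> \<Phi>. X \<phi> < a}"
    then have "(1 - \<eta>) powr a \<le> (1 - \<eta>) powr X \<phi>" using assms by (intro powr_mono') auto
    then show "(1 - \<eta>) powr a \<le> (1 - \<eta>) ^ X \<phi>" using assms by (simp add: powr_realpow)
  qed
  also have "\<dots> \<le> (\<Sum>\<phi>\<in>\<Phi>. (1 - \<eta>) ^ X \<phi>)" using fin assms by (intro sum_mono2) auto
  also have "\<dots> = (\<Sum>v\<in>V. \<Sum>\<phi>\<in>{\<phi> \<in> \<Phi>. \<phi> i = v}. (1 - \<eta>) ^ X \<phi>)"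
    using fin assms by (intro sum.group[symmetric]) (auto simp: \<Phi>_def)
  also have "\<dots> \<le> (\<Sum>v\<in>V. (card V * (1 - \<eta> * b)) ^ (s - 1))"
  proof (intro sum_mono)
    fix v assume v: "v \<in> V"
    have "{\<phi> \<in> \<Phi>. \<phi> i = v} = (\<Pi>\<^sub>E j\<in>{..<s}. if j = i then {v} else V)"
    proof (intro equalityI subsetI)
      fix \<phi> assume "\<phi> \<in> {\<phi> \<in> \<Phi>. \<phi> i = v}"
      then show "\<phi> \<in> (\<Pi>\<^sub>E j\<in>{..<s}. if j = i then {v} else V)" unfolding \<Phi>_def PiE_iff by simp
    next
      fix \<phi> assume \<phi>: "\<phi> \<in> (\<Pi>\<^sub>E j\<in>{..<s}. if j = i then {v} else V)"
      then have "\<phi> j \<in> (if j = i then {v} else V)" if "j < s" for j using that by (simp add: PiE_iff)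
      moreover from this[of i] have "\<phi> i = v" using assms(2) by simp
      ultimately have "\<phi> j \<in> V" if "j < s" for j using v that by (metis (full_types))
      with \<phi> \<open>\<phi> i = v\<close> show "\<phi> \<in> {\<phi> \<in> \<Phi>. \<phi> i = v}" unfolding \<Phi>_def PiE_iff by simp
    qed
    moreover have "(1 - \<eta>) ^ X \<phi> = (\<Prod>j\<in>{..<s}. if j = i then 1 else w v (\<phi> j))"
      if "\<phi> i = v" for \<phi>
      using that assms(2) by (simp add: X prod.remove[of "{..<s}" i])
    ultimately have "(\<Sum>\<phi>\<in>{\<phi> \<in> \<Phi>. \<phi> i = v}. (1 - \<eta>) ^ X \<phi>)
        = (\<Sum>\<phi>\<in>(\<Pi>\<^sub>E j\<in>{..<s}. if j = i then {v} else V). \<Prod>j\<in>{..<s}. if j = i then 1 else w v (\<phi> j))"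
      by (intro sum.cong) auto
    also have "\<dots> = (\<Prod>j\<in>{..<s}. \<Sum>u\<in>(if j = i then {v} else V). if j = i then 1 else w v u)"
      using assms by (intro prod_sum_PiE[symmetric]) auto
    also have "\<dots> = (\<Prod>j\<in>{..<s} - {i}. \<Sum>u\<in>V. w v u)"
      using assms by (simp add: prod.remove[of "{..<s}" i])
    also have "\<dots> = (\<Sum>u\<in>V. w v u) ^ (s - 1)" using assms by simp
    also have "\<dots> \<le> (card V * (1 - \<eta> * b)) ^ (s - 1)"
    proof (intro power_mono)
      have "U v \<subseteq> V" using U v by blast
      then have UV: "{x \<in> V. x \<in> U v} = U v" "{x \<in> V. x \<notin> U v} = V - U v" by auto
      have "card (V - U v) = real (card V) - card (U v)"
        using \<open>U v \<subseteq> V\<close> assms(1) by (metis card_Diff_subset card_mono finite_subset of_nat_diff)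
      then have "(\<Sum>u\<in>V. w v u) = card V - \<eta> * card (U v)"
        unfolding w_def using assms(1) by (simp add: sum.If_cases Int_def UV algebra_simps flip: Compl_eq)
      also have "\<dots> \<le> card V - \<eta> * (b * card V)" using U[OF v] assms(3) by (simp add: mult_left_mono)
      finally show "(\<Sum>u\<in>V. w v u) \<le> card V * (1 - \<eta> * b)" by (simp add: algebra_simps)
    qed (use assms in \<open>auto simp: w_def intro!: sum_nonneg\<close>)
    finally show "(\<Sum>\<phi>\<in>{\<phi> \<in> \<Phi>. \<phi> i = v}. (1 - \<eta>) ^ X \<phi>) \<le> (card V * (1 - \<eta> * b)) ^ (s - 1)" .
  qed
  also have "\<dots> = card V ^ s * (1 - \<eta> * b) ^ (s - 1)"
    using assms(2) by (cases s) (auto simp: power_mult_distrib)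
  finally show ?thesis unfolding \<Phi>_def X_def by simp
qed

lemma card_PiE_hit_third:
  assumes "finite V" "i < s" "j < s" "k < s" "i \<noteq> j" "k \<noteq> i" "k \<noteq> j"
    and H: "\<And>u v. u \<in> V \<Longrightarrow> v \<in> V \<Longrightarrow> H u v \<subseteq> V \<and> card (H u v) \<le> K"
  shows "card {\<phi> \<in> {..<s} \<rightarrow>\<^sub>E V. \<phi> k \<in> H (\<phi> i) (\<phi> j)} \<le> K * card V ^ (s - 1)"
proof -
  let ?B = "\<lambda>u v t. if t = i then {u} else if t = j then {v} else if t = k then H u v else V"
  have s: "{..<s} = insert i (insert j (insert k ({..<s} - {i, j, k})))" using assms by auto
  have "card ({..<s} - {i, j, k}) = s - 3" using assms by (subst card_Diff_subset) auto
  then have c: "card (PiE {..<s} (?B u v)) = card (H u v) * card V ^ (s - 3)" for u v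
    unfolding card_PiE[OF finite_lessThan] using assms by (subst s) (simp add: prod.insert_if)
  have "{\<phi> \<in> {..<s} \<rightarrow>\<^sub>E V. \<phi> k \<in> H (\<phi> i) (\<phi> j)} \<subseteq> (\<Union>(u, v)\<in>V \<times> V. PiE {..<s} (?B u v))"
  proof
    fix \<phi> assume \<phi>: "\<phi> \<in> {\<phi> \<in> {..<s} \<rightarrow>\<^sub>E V. \<phi> k \<in> H (\<phi> i) (\<phi> j)}"
    then have "\<phi> \<in> PiE {..<s} (?B (\<phi> i) (\<phi> j))" by (auto simp: PiE_iff)
    moreover have "(\<phi> i, \<phi> j) \<in> V \<times> V" using \<phi> assms by auto
    ultimately show "\<phi> \<in> (\<Union>(u, v)\<in>V \<times> V. PiE {..<s} (?B u v))" by blast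
  qed
  moreover have "finite (\<Union>(u, v)\<in>V \<times> V. PiE {..<s} (?B u v))"
  proof (intro finite_UN_I finite_cartesian_product assms(1), clarify)
    fix u v assume "u \<in> V" "v \<in> V"
    then have "finite (H u v)" using H assms(1) finite_subset by blast
    then show "finite (PiE {..<s} (?B u v))" using assms(1) by (intro finite_PiE) auto
  qed
  ultimately have "card {\<phi> \<in> {..<s} \<rightarrow>\<^sub>E V. \<phi> k \<in> H (\<phi> i) (\<phi> j)} \<le> card (\<Union>(u, v)\<in>V \<times> V. PiE {..<s} (?B u v))"
    by (rule card_mono[rotated])
  also have "\<dots> \<le> (\<Sum>(u, v)\<in>V \<times> V. card (PiE {..<s} (?B u v)))"
    using card_UN_le[of "V \<times> V" "\<lambda>(u, v). PiE {..<s} (?B u v)"] assms(1) by (simp add: case_prod_unfold)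
  also have "\<dots> \<le> (\<Sum>(u, v)\<in>V \<times> V. K * card V ^ (s - 3))"
    using H unfolding c by (intro sum_mono) auto
  also have "\<dots> = K * card V ^ (s - 1)"
  proof -
    have "s - 1 = Suc (Suc (s - 3))" using assms by auto
    then show ?thesis by (simp add: card_cartesian_product)
  qed
  finally show ?thesis .
qed

text \<open>The size \<open>s\<close> is fixed before \<open>V\<close>. By a union bound at most
  half of all maps have too few hits at some index, and for large \<open>V\<close> less than half
  run into some \<open>H\<close>. The map \<open>\<phi>\<close> need not be injective.\<close>

lemma exists_sample:
  fixes a b :: real and K :: nat
  assumes ab: "0 < a" "a < b" "b < 1"
  shows "\<exists>(s :: nat) n\<^sub>0. 0 < s \<and> (\<forall>(V :: 'a set) U H. finite V \<longrightarrow> n\<^sub>0 \<le> card V \<longrightarrow>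
    (\<forall>v\<in>V. U v \<subseteq> V \<and> b * card V \<le> card (U v)) \<longrightarrow>
    (\<forall>u\<in>V. \<forall>v\<in>V. H u v \<subseteq> V \<and> card (H u v) \<le> K) \<longrightarrow>
    (\<exists>\<phi>. (\<forall>i<s. \<phi> i \<in> V \<and> a * real s \<le> card {j \<in> {..<s} - {i}. \<phi> j \<in> U (\<phi> i)}) \<and>
      (\<forall>i<s. \<forall>j<s. \<forall>k<s. i \<noteq> j \<longrightarrow> k \<noteq> i \<longrightarrow> k \<noteq> j \<longrightarrow> \<phi> k \<notin> H (\<phi> i) (\<phi> j))))"
proof -
  obtain \<eta> \<kappa> where \<eta>: "0 < \<eta>" "\<eta> < 1" and \<kappa>: "0 < \<kappa>" "\<kappa> < 1"
    and decay: "(1 - \<eta> * b) * (1 - \<eta>) powr (- a) \<le> \<kappa>" using exp_decay_rate[OF ab] .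
  have "\<eta> * b < 1 * 1" using \<eta> ab by (intro mult_strict_mono) auto
  then have d: "0 < 1 - \<eta> * b" by simp
  have "(\<lambda>s. real s * \<kappa> ^ s) \<longlonglongrightarrow> 0" using \<kappa> by (intro powser_times_n_limit_0) auto
  \<comment> \<open>The factor \<open>1 - \<eta> * b\<close> makes up for the exponent
    \<open>s - 1\<close> in the tail bound; the 2 leaves half of the maps for avoiding the sets
    \<open>H\<close>.\<close>
  then have "\<forall>\<^sub>F s in sequentially. real s * \<kappa> ^ s < (1 - \<eta> * b) / 2"
    using d by (intro order_tendstoD(2)) auto
  then obtain N where "\<forall>s\<ge>N. real s * \<kappa> ^ s < (1 - \<eta> * b) / 2"
    unfolding eventually_sequentially by blast
  then have "real (Suc N) * \<kappa> ^ Suc N < (1 - \<eta> * b) / 2" by (meson le_SucI order_refl)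
  then obtain s where s: "real s * \<kappa> ^ s < (1 - \<eta> * b) / 2" "0 < s" by blast
  have "\<exists>\<phi>. (\<forall>i<s. \<phi> i \<in> V \<and> a * real s \<le> card {j \<in> {..<s} - {i}. \<phi> j \<in> U (\<phi> i)}) \<and>
      (\<forall>i<s. \<forall>j<s. \<forall>k<s. i \<noteq> j \<longrightarrow> k \<noteq> i \<longrightarrow> k \<noteq> j \<longrightarrow> \<phi> k \<notin> H (\<phi> i) (\<phi> j))"
    if V: "finite V" "2 * s ^ 3 * K + 1 \<le> card V"
      and U: "\<forall>v\<in>V. U v \<subseteq> V \<and> b * card V \<le> card (U v)"
      and H: "\<forall>u\<in>V. \<forall>v\<in>V. H u v \<subseteq> V \<and> card (H u v) \<le> K" for V :: "'a set" and U H
  proof -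
    define \<Phi> where "\<Phi> = {..<s} \<rightarrow>\<^sub>E V"
    define n where "n = card V"
    define B where "B i = {\<phi> \<in> \<Phi>. card {j \<in> {..<s} - {i}. \<phi> j \<in> U (\<phi> i)} < a * real s}" for i
    define T where "T = {(i, j, k). i < s \<and> j < s \<and> k < s \<and> i \<noteq> j \<and> k \<noteq> i \<and> k \<noteq> j}"
    define C where "C = (\<lambda>(i, j, k). {\<phi> \<in> \<Phi>. \<phi> k \<in> H (\<phi> i) (\<phi> j)})"
    have n: "0 < n" using V by (simp add: n_def)
    have fin: "finite \<Phi>" unfolding \<Phi>_def using V by (intro finite_PiE) auto
    have card: "card \<Phi> = n ^ s" unfolding \<Phi>_def n_def by (simp add: card_PiE)
    have B: "s * card (B i) < n ^ s / 2" if i: "i < s" for i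
    proof -
      have "card (B i) * (1 - \<eta>) powr (a * s) \<le> card V ^ s * (1 - \<eta> * b) ^ (s - 1)"
        unfolding B_def \<Phi>_def using U by (intro card_PiE_few_hits[OF V(1) i \<eta>]) auto
      then have "card (B i) * ((1 - \<eta>) powr (a * s) * (1 - \<eta>) powr (- a * s)) * (1 - \<eta> * b)
          \<le> card V ^ s * (1 - \<eta> * b) ^ (s - 1) * (1 - \<eta>) powr (- a * s) * (1 - \<eta> * b)"
        using d by (simp add: mult_right_mono mult.assoc[symmetric])
      also have "\<dots> = n ^ s * ((1 - \<eta> * b) * (1 - \<eta>) powr (- a)) ^ s"
      proof -
        have "((1 - \<eta>) powr (- a)) ^ s = (1 - \<eta>) powr (- a * s)"
          using \<eta> by (subst powr_realpow[symmetric]) (auto simp: powr_powr)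
        moreover have "(1 - \<eta> * b) ^ s = (1 - \<eta> * b) ^ (s - 1) * (1 - \<eta> * b)"
          using s(2) by (cases s) auto
        ultimately show ?thesis by (simp add: power_mult_distrib n_def)
      qed
      also have "\<dots> \<le> n ^ s * \<kappa> ^ s"
        using decay d by (intro mult_left_mono power_mono) auto
      finally have "card (B i) * (1 - \<eta> * b) \<le> n ^ s * \<kappa> ^ s"
        using \<eta> by (simp flip: powr_add)
      then have "s * (card (B i) * (1 - \<eta> * b)) \<le> s * (n ^ s * \<kappa> ^ s)" by (intro mult_left_mono) auto
      also have "\<dots> < n ^ s * ((1 - \<eta> * b) / 2)" using s n by simp
      finally have "(s * card (B i)) * (1 - \<eta> * b) < (n ^ s / 2) * (1 - \<eta> * b)" by (simp add: algebra_simps)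
      then show ?thesis using d by (simp add: mult_less_cancel_right)
    qed
    have finT: "finite T" and cT: "card T \<le> s ^ 3"
    proof -
      have sub: "T \<subseteq> {..<s} \<times> {..<s} \<times> {..<s}" by (auto simp: T_def)
      then show "finite T" by (rule finite_subset) auto
      have "card T \<le> card ({..<s} \<times> {..<s} \<times> {..<s})" using sub by (intro card_mono) auto
      then show "card T \<le> s ^ 3" by (simp add: card_cartesian_product power3_eq_cube mult.assoc)
    qed
    have "card (\<Union>t\<in>T. C t) \<le> (\<Sum>t\<in>T. card (C t))" using finT by (rule card_UN_le)
    also have "\<dots> \<le> (\<Sum>t\<in>T. K * n ^ (s - 1))"
    proof (intro sum_mono, clarify)
      fix i j k assume "(i, j, k) \<in> T"
      then show "card (C (i, j, k)) \<le> K * n ^ (s - 1)"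
        unfolding C_def T_def \<Phi>_def n_def using card_PiE_hit_third[OF V(1), of i s j k H K] H by auto
    qed
    also have "\<dots> \<le> s ^ 3 * (K * n ^ (s - 1))" using cT by simp
    finally have cC: "2 * card (\<Union>t\<in>T. C t) \<le> 2 * s ^ 3 * K * n ^ (s - 1)" by simp
    also have "\<dots> < n * n ^ (s - 1)" using V(2) n by (intro mult_strict_right_mono) (auto simp: n_def)
    also have "\<dots> = n ^ s" using s(2) by (cases s) auto
    finally have "card (\<Union>t\<in>T. C t) < n ^ s / 2"
      by (metis (no_types, lifting) less_divide_eq_numeral1(1) mult.commute of_nat_less_iff of_nat_mult of_nat_numeral of_nat_power)
    moreover have "card (\<Union>i<s. B i) \<le> n ^ s / 2"
    proof -
      have "card (\<Union>i<s. B i) \<le> (\<Sum>i<s. card (B i))" by (rule card_UN_le) simp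
      then have "real (card (\<Union>i<s. B i)) \<le> (\<Sum>i<s. real (card (B i)))" by (metis of_nat_le_iff of_nat_sum)
      also have "\<dots> \<le> (\<Sum>i<s. n ^ s / 2 / s)"
        using B s(2) by (intro sum_mono) (auto simp: field_simps intro: less_imp_le)
      also have "\<dots> = n ^ s / 2" using s(2) by simp
      finally show ?thesis .
    qed
    moreover have "card ((\<Union>i<s. B i) \<union> (\<Union>t\<in>T. C t)) \<le> card (\<Union>i<s. B i) + card (\<Union>t\<in>T. C t)"
      by (rule card_Un_le)
    ultimately have "real (card ((\<Union>i<s. B i) \<union> (\<Union>t\<in>T. C t))) < real (n ^ s)" by linarith
    then have "card ((\<Union>i<s. B i) \<union> (\<Union>t\<in>T. C t)) < card \<Phi>" by (simp only: card of_nat_less_iff)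
    moreover have "(\<Union>i<s. B i) \<union> (\<Union>t\<in>T. C t) \<subseteq> \<Phi>" by (auto simp: B_def C_def)
    ultimately obtain \<phi> where \<phi>: "\<phi> \<in> \<Phi>" "\<phi> \<notin> (\<Union>i<s. B i)" "\<phi> \<notin> (\<Union>t\<in>T. C t)"
      by (metis UnCI less_irrefl subset_antisym subsetI)
    show ?thesis
    proof (intro exI[of _ \<phi>] conjI allI impI)
      fix i assume "i < s"
      then show "\<phi> i \<in> V" "a * real s \<le> card {j \<in> {..<s} - {i}. \<phi> j \<in> U (\<phi> i)}"
        using \<phi>(1,2) by (auto simp: \<Phi>_def B_def not_less)
    next
      fix i j k assume "i < s" "j < s" "k < s" "i \<noteq> j" "k \<noteq> i" "k \<noteq> j"
      then have "(i, j, k) \<in> T" by (simp add: T_def)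
      then have "\<phi> \<notin> C (i, j, k)" using \<phi>(3) by blast
      then show "\<phi> k \<notin> H (\<phi> i) (\<phi> j)" using \<phi>(1) by (simp add: C_def)
    qed
  qed
  note main = this
  show ?thesis
    by (rule exI[of _ s], rule exI[of _ "2 * s ^ 3 * K + 1"], rule conjI, rule s(2),
        intro allI impI, rule main)
qed

section \<open>Path-monochromatic arborescences\<close>

lemma pcas_fst_nth:
  assumes "pcas u p v" "i < length p"
  shows "fst (p ! i) = (if i = 0 then u else snd (p ! (i - 1)))"
  using assms
proof (induction p arbitrary: u i)
  case (Cons e p)
  show ?case
  proof (cases i)
    case (Suc j)
    then have "fst (p ! j) = (if j = 0 then snd e else snd (p ! (j - 1)))"
      using Cons.prems by (intro Cons.IH) auto
    then show ?thesis using Suc by (cases j) auto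
  qed (use Cons.prems in auto)
qed simp

lemma pcas_snd_last: "snd (last p) = v" if "pcas u p v" "p \<noteq> []"
  using that by (induction p arbitrary: u) auto

lemma tl_pawalk_verts: "tl (pawalk_verts u p) = map snd p" if "pcas u p v"
  using that
proof (induction p arbitrary: u)
  case (Cons e p)
  have "pawalk_verts (snd e) p = snd e # tl (pawalk_verts (snd e) p)" using Cons.prems by (cases p) auto
  then show ?case using Cons by auto
qed simp

lemma cycle_with_proj_nth:
  assumes "pre_digraph.cycle (with_proj G) p"
  shows "p \<noteq> []" "distinct (map snd p)" "set p \<subseteq> parcs G"
    "\<And>i. i < length p \<Longrightarrow> snd (p ! i) = fst (p ! (Suc i mod length p))"
proof -
  obtain u where u: "pre_digraph.awalk (with_proj G) u p u"
    "distinct (tl (pre_digraph.awalk_verts (with_proj G) u p))" "p \<noteq> []"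
    using assms unfolding pre_digraph.cycle_def by blast
  then have cas: "pcas u p u" and "set p \<subseteq> parcs G"
    unfolding pre_digraph.awalk_def by (auto simp: cas_with_proj_eq)
  then show "p \<noteq> []" "distinct (map snd p)" "set p \<subseteq> parcs G"
    using u tl_pawalk_verts[OF cas] by (auto simp: awalk_verts_with_proj_eq)
  show "snd (p ! i) = fst (p ! (Suc i mod length p))" if i: "i < length p" for i
  proof (cases "Suc i = length p")
    case True
    have "0 < length p" using i by linarith
    then have "fst (p ! 0) = u" using pcas_fst_nth[OF cas] by simp
    moreover have "snd (last p) = u" using pcas_snd_last[OF cas] \<open>0 < length p\<close> by simp
    moreover have "last p = p ! i" using \<open>0 < length p\<close> True
      by (metis diff_Suc_1 last_conv_nth length_greater_0_conv)
    ultimately show ?thesis using True by simp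
  next
    case False
    then show ?thesis using pcas_fst_nth[OF cas, of "Suc i"] i by auto
  qed
qed

text \<open>On a cycle of the underlying graph both neighbours of a vertex of maximal height are its
  parent.\<close>

lemma no_long_cycle_if_parent:
  fixes h :: "'a \<Rightarrow> nat"
  assumes arcs: "\<And>u v. (u, v) \<in> parcs A \<Longrightarrow> u = par v \<and> h u < h v"
    and cyc: "pre_digraph.cycle (with_proj (mk_symmetric (with_proj A))) p"
  shows "length p < 3"
proof (rule ccontr)
  assume "\<not> length p < 3"
  define t where "t = length p"
  have t: "3 \<le> t" using \<open>\<not> length p < 3\<close> by (simp add: t_def)
  note p = cycle_with_proj_nth[OF cyc]
  have sym: "(u, v) \<in> parcs A \<or> (v, u) \<in> parcs A" if "(u, v) \<in> set p" for u v
    using p(3) that by (auto simp: parcs_mk_symmetric)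
  define a where "a i = snd (p ! (i mod t))" for i
  have fst: "fst (p ! (Suc i mod t)) = a i" for i
  proof -
    have "i mod length p < length p" using t unfolding t_def by (intro mod_less_divisor) linarith
    from p(4)[OF this] show ?thesis by (simp add: a_def t_def mod_Suc_eq)
  qed
  have edge: "(a i, a (Suc i)) \<in> parcs A \<or> (a (Suc i), a i) \<in> parcs A" for i
  proof (rule sym)
    have "p ! (Suc i mod t) = (a i, a (Suc i))" using fst[of i] by (simp add: a_def prod_eq_iff)
    then show "(a i, a (Suc i)) \<in> set p" using t by (metis t_def mod_less_divisor nth_mem less_le_trans zero_less_numeral)
  qed
  have "Max (h ` a ` {..<t}) \<in> h ` a ` {..<t}" using t by (intro Max_in) (auto simp: lessThan_empty_iff)
  then obtain m where m: "m < t" "h (a m) = Max (h ` a ` {..<t})" by auto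
  have am: "a (i mod t) = a i" for i by (simp add: a_def)
  have max: "h (a i) \<le> h (a m)" for i
  proof -
    have "h (a (i mod t)) \<le> Max (h ` a ` {..<t})" using t by (intro Max_ge) auto
    then show ?thesis using m am by simp
  qed
  \<comment> \<open>The index before \<open>m\<close> modulo \<open>t\<close>, written without
    subtracting from \<open>m\<close>. Both neighbours of \<open>a m\<close> turn out to be the same
    vertex, so the indices before and after \<open>m\<close> agree modulo \<open>t\<close>, which
    fails for \<open>t\<close> at least 3.\<close>
  define q where "q = m + (t - 1)"
  have "Suc q mod t = m mod t" using t by (simp add: q_def)
  then have "a (Suc q) = a m" by (simp add: a_def)
  then have "a q = par (a m)" using edge[of q] arcs max[of q] by (metis leD)
  have "a (Suc m) = par (a m)" using edge[of m] arcs max[of "Suc m"] by (metis leD)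
  have "map snd p ! (q mod t) = map snd p ! (Suc m mod t)"
  proof -
    have "k mod t < length p" for k using t unfolding t_def by (intro mod_less_divisor) linarith
    then show ?thesis using \<open>a q = par (a m)\<close> \<open>a (Suc m) = par (a m)\<close> by (simp add: a_def)
  qed
  moreover have "k mod t < length (map snd p)" for k
    using t unfolding t_def length_map by (intro mod_less_divisor) linarith
  ultimately have "q mod t = Suc m mod t"
    using nth_eq_iff_index_eq[OF p(2)] by blast
  moreover have "q mod t = (if m = 0 then t - 1 else m - 1)"
  proof (cases m)
    case (Suc k)
    then have "q = k + t" using t by (simp add: q_def)
    then show ?thesis using Suc m by simp
  qed (use t in \<open>simp add: q_def\<close>)
  moreover have "Suc m mod t = (if Suc m = t then 0 else Suc m)" using m by simp
  ultimately show False using t m by (auto split: if_splits)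
qed

definition colour_class :: "'a pair_pre_digraph \<Rightarrow> ('a \<times> 'a \<Rightarrow> nat) \<Rightarrow> nat \<Rightarrow> ('a \<times> 'a) set" where
  "colour_class T c i = {e \<in> parcs T. c e = i}"

text \<open>The height \<open>h\<close> grows along the arcs, which rules out cycles, makes every
  vertex descend from \<open>r\<close>, and bounds the depth. Paths run down the parent arcs, so
  equal colours on consecutive arcs suffice for monochromatic paths.\<close>

lemma arborescence_of_parent:
  fixes h :: "'a \<Rightarrow> nat"
  assumes T: "tournament T" and S: "S \<subseteq> pverts T" "r \<in> S"
    and par: "\<And>x. x \<in> S - {r} \<Longrightarrow> par x \<in> S \<and> h (par x) < h x \<and> h x \<le> l \<and> (par x, x) \<in> parcs T"
    and col: "\<And>x. x \<in> S - {r} \<Longrightarrow> par x \<noteq> r \<Longrightarrow> c (par x, x) = c (par (par x), par x)"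
  shows "\<exists>A. subgraph (with_proj A) (with_proj T) \<and> arborescence A r \<and> path_monochromatic c A \<and>
    arb_depth A \<le> l \<and> pverts A = S"
proof -
  define A where "A = \<lparr>pverts = S, parcs = (\<lambda>x. (par x, x)) ` (S - {r})\<rparr>"
  have pv: "pverts A = S" and pa: "(u, v) \<in> parcs A \<longleftrightarrow> v \<in> S - {r} \<and> u = par v" for u v
    by (auto simp: A_def)
  interpret T: pair_digraph T using T by (simp add: tournament_def oriented_graph_def)
  have finS: "finite S" using S T.pair_finite_verts finite_subset by blast
  have paT: "parcs A \<subseteq> parcs T" using par by (auto simp: A_def)
  interpret A: pair_digraph A
  proof
    show "finite (parcs A)" using paT T.pair_finite_arcs finite_subset by blast
    show "fst e \<in> pverts A" if "e \<in> parcs A" for e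
    proof -
      have "snd e \<in> S - {r}" "fst e = par (snd e)" using that pa[of "fst e" "snd e"] by auto
      then show ?thesis using par pv by metis
    qed
    show "snd e \<in> pverts A" if "e \<in> parcs A" for e using that by (auto simp: A_def)
    show "fst e \<noteq> snd e" if "e \<in> parcs A" for e using that T.pair_no_loops paT by blast
  qed (simp add: pv finS)
  have less: "u = par v \<and> h u < h v" if "(u, v) \<in> parcs A" for u v using that par[of v] pa[of u v] by auto
  have sub: "subgraph (with_proj A) (with_proj T)"
    unfolding subgraph_def using S(1) paT A.wf_digraph_axioms T.wf_digraph_axioms
    by (auto simp: pv compatible_def)
  have reach: "r \<rightarrow>\<^sup>*\<^bsub>with_proj A\<^esub> x" if "x \<in> S" for x
    using that
  proof (induction "h x" arbitrary: x rule: less_induct)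
    case less
    show ?case
    proof (cases "x = r")
      case True
      then show ?thesis using S(2) by (simp add: pv)
    next
      case False
      then have "r \<rightarrow>\<^sup>*\<^bsub>with_proj A\<^esub> par x" using less par by blast
      moreover have "(par x, x) \<in> parcs A" using pa False less.prems by blast
      ultimately show ?thesis by (rule A.reachable_adj_trans)
    qed
  qed
  have walk_len: "length p + h u \<le> h v" if "A.awalk u p v" for u p v
    using that
  proof (induction p arbitrary: u)
    case (Cons e p)
    then have "length p + h (snd e) \<le> h v" "(u, snd e) \<in> parcs A" by (auto simp: A.awalk_Cons_iff)
    with less[of u "snd e"] show ?case by (metis Suc_leI add_Suc add_Suc_right add_le_cancel_left le_trans length_Cons)
  qed (auto simp: A.awalk_def)
  \<comment> \<open>The bound \<open>h x \<le> l\<close> is given away from the root only, so a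
    nonempty walk has to be shown to end elsewhere.\<close>
  have into: "v \<in> S - {r}" if "A.awalk u p v" "p \<noteq> []" for u p v
    using that
  proof (induction p arbitrary: u)
    case (Cons e p)
    then show ?case
    proof (cases "p = []")
      case True
      then have "(fst e, snd e) \<in> parcs A" "v = snd e" using Cons.prems
        by (auto simp: A.awalk_Cons_iff A.awalk_Nil_iff)
      then show ?thesis using pa by blast
    qed (auto simp: A.awalk_Cons_iff)
  qed simp
  have end_le: "h v \<le> l" if "v \<in> S - {r}" for v using par[OF that] by blast
  have depth_le: "length p \<le> l" if "A.apath u p v" for u p v
  proof (cases "p = []")
    case False
    have w: "A.awalk u p v" using that by (simp add: A.apath_def)
    show ?thesis using walk_len[OF w] end_le[OF into[OF w False]] by linarith
  qed simp
  have depth: "arb_depth A \<le> l"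
  proof -
    have sub: "{length p | u p v. A.apath u p v} \<subseteq> {..l}" using depth_le by blast
    then have fin: "finite {length p | u p v. A.apath u p v}" by (rule finite_subset) simp
    have "A.apath r [] r" using S(2) by (simp add: A.apath_Nil_iff pv)
    then have "{length p | u p v. A.apath u p v} \<noteq> {}" by blast
    then show ?thesis unfolding arb_depth_def using Max_in[OF fin] sub by blast
  qed
  have pe: "snd e \<in> S - {r} \<and> fst e = par (snd e)" if "e \<in> parcs A" for e
    using pa[of "fst e" "snd e"] that by simp
  have mono_walk: "\<forall>e'\<in>set p. c e' = c e" if "A.awalk u (e # p) v" for u e p v
    using that
  proof (induction p arbitrary: u e)
    case (Cons e2 p)
    then have e2: "\<forall>e'\<in>set p. c e' = c e2" and e: "e \<in> parcs A" "e2 \<in> parcs A" "fst e2 = snd e"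
      by (auto simp: A.awalk_Cons_iff)
    then have "snd e \<in> S - {r}" "snd e2 \<in> S - {r}" "fst e = par (snd e)" "snd e = par (snd e2)"
      using pe[OF e(1)] pe[OF e(2)] e(3) by auto
    moreover from this have "c (snd e, snd e2) = c (fst e, snd e)" using col[of "snd e2"] by simp
    ultimately have "c e2 = c e" using e(3) by (metis prod.collapse)
    with e2 show ?case by simp
  qed simp
  have mono: "path_monochromatic c A"
    unfolding path_monochromatic_def
  proof (intro allI impI ballI)
    fix u p v e e' assume "A.apath u p v" "e \<in> set p" "e' \<in> set p"
    moreover from this obtain e0 p0 where "p = e0 # p0" by (cases p) auto
    ultimately show "c e = c e'" using mono_walk[of u e0 p0 v] by (auto simp: A.apath_def)
  qed
  have "oriented_tree A"
    unfolding oriented_tree_def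
  proof (intro conjI)
    have "(v, u) \<notin> parcs A" if "(u, v) \<in> parcs A" for u v
      using less[of u v] less[of v u] that by auto
    then show "oriented_graph A" by (auto simp: oriented_graph_def A.pair_digraph_axioms)
    have M: "wf_digraph (with_proj (mk_symmetric (with_proj A)))"
      using A.wellformed_mk_symmetric by (simp add: wf_digraph_wp_iff)
    have "u \<rightarrow>\<^sup>*\<^bsub>with_proj (mk_symmetric (with_proj A))\<^esub> v" if "u \<in> S" "v \<in> S" for u v
    proof -
      have r: "r \<rightarrow>\<^sup>*\<^bsub>with_proj (mk_symmetric (with_proj A))\<^esub> x" if "x \<in> S" for x
        using A.reachable_mk_symmetricI[OF reach[OF that]] .
      have "u \<rightarrow>\<^sup>*\<^bsub>with_proj (mk_symmetric (with_proj A))\<^esub> r"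
        by (rule symmetric_reachable[OF symmetric_mk_symmetric r[OF that(1)]])
      then show ?thesis by (rule wf_digraph.reachable_trans[OF M _ r[OF that(2)]])
    qed
    then show "Digraph_Component.connected (with_proj A)"
      unfolding connected_def strongly_connected_def using S(2) by (auto simp: pv)
    show "\<nexists>p. pre_digraph.cycle (with_proj (mk_symmetric (with_proj A))) p \<and> 3 \<le> length p"
      using no_long_cycle_if_parent[of A par h, OF less] by (meson not_less)
  qed
  then have "arborescence A r" unfolding arborescence_def using S(2) reach by (simp add: pv)
  with sub mono depth pv show ?thesis by blast
qed

definition pm_arborescence ::
    "'a pair_pre_digraph \<Rightarrow> ('a \<times> 'a \<Rightarrow> nat) \<Rightarrow> 'a pair_pre_digraph \<Rightarrow> 'a \<Rightarrow> bool" where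
  "pm_arborescence T c A r \<longleftrightarrow>
     subgraph (with_proj A) (with_proj T) \<and> arborescence A r \<and> path_monochromatic c A"

text \<open>Disjointness of the sets \<open>I i\<close> of admissible interior vertices keeps the breadth-first
  trees of different colours from competing for an inner vertex.\<close>

lemma exists_pm_arborescence:
  assumes T: "tournament T" and r: "r \<in> pverts T"
    and dj: "\<And>i j. i \<noteq> j \<Longrightarrow> I i \<inter> I j = {}"
  shows "\<exists>A. pm_arborescence T c A r \<and> arb_depth A \<le> l \<and>
    pverts A = {x. \<exists>i. \<exists>j\<le>l. (r, x) \<in> (colour_class T c i \<inter> insert r (I i) \<times> UNIV) ^^ j}"
proof -
  interpret T: pair_digraph T using T by (simp add: tournament_def oriented_graph_def)
  define E where "E i = colour_class T c i \<inter> insert r (I i) \<times> UNIV" for i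
  define R where "R i x \<longleftrightarrow> (\<exists>j\<le>l. (r, x) \<in> E i ^^ j)" for i x
  define X where "X = {x. \<exists>i. R i x}"
  define d where "d i x = (LEAST j. (r, x) \<in> E i ^^ j)" for i x
  \<comment> \<open>Each reached vertex is assigned one colour. If it is reached in the colour for
    which it may be an inner vertex, that colour takes precedence, so that its children can hang on
    it.\<close>
  define \<kappa> where "\<kappa> x = (if \<exists>i. x \<in> I i \<and> R i x then SOME i. x \<in> I i \<and> R i x else SOME i. R i x)" for x
  define h where "h x = (if x = r then 0 else d (\<kappa> x) x)" for x
  have d: "d i x \<le> l" "(r, x) \<in> E i ^^ d i x" if "R i x" for i x
  proof -
    obtain j where j: "j \<le> l" "(r, x) \<in> E i ^^ j" using \<open>R i x\<close> by (auto simp: R_def)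
    show "(r, x) \<in> E i ^^ d i x" unfolding d_def using j(2) by (rule LeastI)
    have "d i x \<le> j" unfolding d_def using j(2) by (rule Least_le)
    then show "d i x \<le> l" using j(1) by simp
  qed
  have \<kappa>: "R (\<kappa> x) x" if "x \<in> X" for x
  proof (cases "\<exists>i. x \<in> I i \<and> R i x")
    case True
    then show ?thesis unfolding \<kappa>_def using someI_ex[OF True] by auto
  next
    case False
    then show ?thesis unfolding \<kappa>_def using that someI_ex[of "\<lambda>i. R i x"] by (auto simp: X_def)
  qed
  have \<kappa>_eq: "\<kappa> x = i" if "x \<in> I i" "R i x" for x i
  proof -
    have ex: "\<exists>i. x \<in> I i \<and> R i x" using that by blast
    then have "x \<in> I (\<kappa> x)" unfolding \<kappa>_def using someI_ex[OF ex] by auto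
    then show ?thesis using dj[of "\<kappa> x" i] that by blast
  qed
  \<comment> \<open>The last vertex \<open>y\<close> before \<open>x\<close> on a shortest walk in
    colour \<open>\<kappa> x\<close> is \<open>r\<close> or lies in \<open>I (\<kappa> x)\<close>;
    in the second case the precedence rule gives it the same colour.\<close>
  have "\<exists>y. y \<in> X \<and> h y < h x \<and> h x \<le> l \<and> (y, x) \<in> E (\<kappa> x) \<and> (y \<noteq> r \<longrightarrow> \<kappa> y = \<kappa> x)"
    if x: "x \<in> X - {r}" for x
  proof -
    let ?i = "\<kappa> x"
    have R: "R ?i x" using \<kappa> x by blast
    note dx = d[OF R]
    obtain m where m: "d ?i x = Suc m"
    proof (cases "d ?i x")
      case 0
      with dx(2) have "r = x" by (metis relpow_0_E)
      with x show ?thesis by simp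
    qed
    with dx(2) obtain y where y: "(r, y) \<in> E ?i ^^ m" "(y, x) \<in> E ?i" by auto
    have Ry: "R ?i y" using y(1) m dx(1) unfolding R_def by (intro exI[of _ m]) auto
    have hx: "h x = Suc m" using x m by (simp add: h_def)
    have "\<kappa> y = ?i" if "y \<noteq> r" using y(2) that \<kappa>_eq[OF _ Ry] by (auto simp: E_def)
    moreover have "d ?i y \<le> m" unfolding d_def using y(1) by (rule Least_le)
    ultimately have "h y < h x" "y \<noteq> r \<longrightarrow> \<kappa> y = ?i" using hx by (auto simp: h_def)
    moreover have "y \<in> X" using Ry by (auto simp: X_def)
    ultimately show ?thesis using y(2) hx m dx(1) by (intro exI[of _ y]) auto
  qed
  then obtain par where par: "\<And>x. x \<in> X - {r} \<Longrightarrow> par x \<in> X \<and> h (par x) < h x \<and> h x \<le> l \<and>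
      (par x, x) \<in> E (\<kappa> x) \<and> (par x \<noteq> r \<longrightarrow> \<kappa> (par x) = \<kappa> x)" by metis
  have E: "(u, v) \<in> parcs T \<and> c (u, v) = i" if "(u, v) \<in> E i" for u v i
    using that by (auto simp: E_def colour_class_def)
  have "(r, r) \<in> E 0 ^^ 0" by simp
  then have "R 0 r" unfolding R_def by blast
  then have rX: "r \<in> X" by (auto simp: X_def)
  have "X \<subseteq> pverts T"
  proof
    fix x assume x: "x \<in> X"
    show "x \<in> pverts T"
    proof (cases "x = r")
      case False
      then have "(par x, x) \<in> parcs T" using par[of x] E x by blast
      then show ?thesis by (rule T.in_arcsD2)
    qed (use r in simp)
  qed
  moreover have "c (par x, x) = c (par (par x), par x)" if "x \<in> X - {r}" "par x \<noteq> r" for x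
  proof -
    have "par x \<in> X - {r}" using par[OF that(1)] that(2) by blast
    then have "c (par (par x), par x) = \<kappa> (par x)" using par E by blast
    then show ?thesis using par[OF that(1)] that(2) E by metis
  qed
  moreover have "par x \<in> X \<and> h (par x) < h x \<and> h x \<le> l \<and> (par x, x) \<in> parcs T" if "x \<in> X - {r}" for x
    using par[OF that] E by blast
  ultimately obtain A where "pm_arborescence T c A r" "arb_depth A \<le> l" "pverts A = X"
    using arborescence_of_parent[OF T _ rX, of par h l c] unfolding pm_arborescence_def by blast
  then show ?thesis unfolding X_def R_def E_def by blast
qed

lemma awalk_with_proj_relpow:
  assumes "pre_digraph.awalk (with_proj A) u p v" "set p \<subseteq> E"
  shows "(u, v) \<in> E ^^ length p"
proof -
  have "pcas u p v" using assms(1) by (simp add: pre_digraph.awalk_def cas_with_proj_eq)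
  then show ?thesis using assms(2)
  proof (induction p arbitrary: u)
    case (Cons e p)
    then have "(snd e, v) \<in> E ^^ length p" "(u, snd e) \<in> E" by auto
    then show ?case by (metis length_Cons relpow_Suc_I2)
  qed simp
qed

text \<open>Upper bounds may therefore count reachable vertices and ignore that colours compete for
  inner vertices.\<close>

lemma pm_arborescence_reach:
  assumes A: "pm_arborescence T c A r" and x: "x \<in> pverts A"
  shows "\<exists>i. \<exists>j\<le>arb_depth A. (r, x) \<in> colour_class T c i ^^ j"
proof -
  have "oriented_graph A" using A by (simp add: pm_arborescence_def arborescence_def oriented_tree_def)
  then interpret A: pair_digraph A by (simp add: oriented_graph_def)
  have "r \<rightarrow>\<^sup>*\<^bsub>with_proj A\<^esub> x" using A x by (simp add: pm_arborescence_def arborescence_def)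
  then obtain p where p: "A.apath r p x" using A.reachable_apath by blast
  have "finite {length p | u p v. A.apath u p v}"
  proof (rule finite_subset)
    show "{length p | u p v. A.apath u p v} \<subseteq> {..card (pverts A)}"
      using A.length_apath by fastforce
  qed simp
  then have len: "length p \<le> arb_depth A" unfolding arb_depth_def using p by (intro Max_ge) auto
  have same: "\<forall>e\<in>set p. \<forall>e'\<in>set p. c e = c e'"
    using A p by (auto simp: pm_arborescence_def path_monochromatic_def)
  have walk: "A.awalk r p x" using p by (simp add: A.apath_def)
  have "set p \<subseteq> parcs A" using walk by (simp add: A.awalk_def)
  also have "parcs A \<subseteq> parcs T" using A by (auto simp: pm_arborescence_def subgraph_def)
  finally have "set p \<subseteq> colour_class T c (c (hd p))"
    using same by (cases p) (auto simp: colour_class_def)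
  from awalk_with_proj_relpow[OF walk this] len show ?thesis by blast
qed

lemma finite_reach:
  assumes "tournament T" "r \<in> pverts T"
  shows "finite {x. \<exists>i j. (r, x) \<in> colour_class T c i ^^ j}"
proof -
  interpret T: pair_digraph T using assms(1) by (simp add: tournament_def oriented_graph_def)
  have "x \<in> pverts T" if "(r, x) \<in> colour_class T c i ^^ j" for x i j
    using that assms(2) by (cases j) (auto simp: colour_class_def dest: T.in_arcsD2)
  then have "{x. \<exists>i j. (r, x) \<in> colour_class T c i ^^ j} \<subseteq> pverts T" by blast
  then show ?thesis using T.pair_finite_verts finite_subset by blast
qed

lemma pm_arborescence_card_le:
  assumes "tournament T" "pm_arborescence T c A r"
  shows "card (pverts A) \<le> card (pverts T)"
proof (rule card_mono)
  show "finite (pverts T)" using assms(1)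
    by (simp add: tournament_def oriented_graph_def pair_digraph_def pair_fin_digraph.pair_finite_verts)
  show "pverts A \<subseteq> pverts T" using assms(2) by (auto simp: pm_arborescence_def subgraph_def)
qed

section \<open>The extremal functions as minimax values\<close>

text \<open>\<open>GREATEST\<close> is informative only for a nonempty bounded set of numbers: some
  \<open>A\<close> for every colouring puts 0 into it, and a single colouring with sizes up to
  \<open>b\<close> bounds it. The conclusions supply a worst colouring, the guarantee for all
  colourings, and the criterion for lower bounds.\<close>

lemma Greatest_minimax:
  fixes size :: "'b \<Rightarrow> nat"
  assumes P: "\<And>c. C c \<Longrightarrow> \<exists>A r. Q c A r" and C: "C c\<^sub>0" and b: "\<And>c A r. Q c A r \<Longrightarrow> size A \<le> b"
  defines "g \<equiv> GREATEST m. \<forall>c. C c \<longrightarrow> (\<exists>A r. Q c A r \<and> m \<le> size A)"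
  shows "\<exists>c. C c \<and> (\<forall>A r. Q c A r \<longrightarrow> size A \<le> g)"
    "\<And>c. C c \<Longrightarrow> \<exists>A r. Q c A r \<and> g \<le> size A"
    "(\<And>c. C c \<Longrightarrow> \<exists>A r. Q c A r \<and> m \<le> size A) \<Longrightarrow> m \<le> g"
proof -
  let ?P = "\<lambda>m. \<forall>c. C c \<longrightarrow> (\<exists>A r. Q c A r \<and> m \<le> size A)"
  have bound: "m \<le> b" if "?P m" for m using that C b le_trans by blast
  have "?P 0" using P by simp
  then have g: "?P g" unfolding g_def using bound by (rule GreatestI_nat)
  then show "\<And>c. C c \<Longrightarrow> \<exists>A r. Q c A r \<and> g \<le> size A" by blast
  show "m \<le> g" if "\<And>c. C c \<Longrightarrow> \<exists>A r. Q c A r \<and> m \<le> size A"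
    unfolding g_def using that bound by (intro Greatest_le_nat) blast+
  have "\<not> ?P (Suc g)" using Greatest_le_nat[of ?P "Suc g" b] bound unfolding g_def by fastforce
  then show "\<exists>c. C c \<and> (\<forall>A r. Q c A r \<longrightarrow> size A \<le> g)" by (meson not_less_eq_eq)
qed

lemma exists_small_pm_arborescence:
  assumes "tournament T" "pverts T \<noteq> {}"
  shows "\<exists>A r. pm_arborescence T c A r \<and> arb_depth A \<le> l"
  using assms exists_pm_arborescence[of T _ "\<lambda>_. {}" c l] by blast

lemma edge_coloring_0: "1 \<le> k \<Longrightarrow> edge_coloring k T (\<lambda>_. 0)"
  by (auto simp: edge_coloring_def)

context
  fixes T :: "'a pair_pre_digraph" and k :: nat
  assumes T: "tournament T" "pverts T \<noteq> {}" and k: "1 \<le> k"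
begin

lemma f_tour_depth_eq: "f_tour_depth T k l = (GREATEST m. \<forall>c. edge_coloring k T c \<longrightarrow>
    (\<exists>A r. (pm_arborescence T c A r \<and> arb_depth A \<le> l) \<and> m \<le> card (pverts A)))"
  by (simp add: f_tour_depth_def pm_arborescence_def conj_assoc)

lemma f_tour_eq: "f_tour T k = (GREATEST m. \<forall>c. edge_coloring k T c \<longrightarrow>
    (\<exists>A r. pm_arborescence T c A r \<and> m \<le> card (pverts A)))"
  by (simp add: f_tour_def pm_arborescence_def conj_assoc)

lemma f_tour_depth_minimax:
  "\<exists>c. edge_coloring k T c \<and>
     (\<forall>A r. pm_arborescence T c A r \<and> arb_depth A \<le> l \<longrightarrow> card (pverts A) \<le> f_tour_depth T k l)"
  "edge_coloring k T c \<Longrightarrow>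
     \<exists>A r. (pm_arborescence T c A r \<and> arb_depth A \<le> l) \<and> f_tour_depth T k l \<le> card (pverts A)"
  "(\<And>c. edge_coloring k T c \<Longrightarrow> \<exists>A r. (pm_arborescence T c A r \<and> arb_depth A \<le> l) \<and> m \<le> card (pverts A))
     \<Longrightarrow> m \<le> f_tour_depth T k l"
proof -
  have le: "card (pverts A) \<le> card (pverts T)" if "pm_arborescence T c A r \<and> arb_depth A \<le> l" for c A r
    using pm_arborescence_card_le[OF T(1)] that by blast
  note g = Greatest_minimax[where C = "edge_coloring k T" and size = "\<lambda>A. card (pverts A)"
      and Q = "\<lambda>c A r. pm_arborescence T c A r \<and> arb_depth A \<le> l",
      OF exists_small_pm_arborescence[OF T] edge_coloring_0[OF k] le, folded f_tour_depth_eq]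
  show "\<exists>c. edge_coloring k T c \<and>
     (\<forall>A r. pm_arborescence T c A r \<and> arb_depth A \<le> l \<longrightarrow> card (pverts A) \<le> f_tour_depth T k l)"
    by (rule g(1))
  show "edge_coloring k T c \<Longrightarrow>
     \<exists>A r. (pm_arborescence T c A r \<and> arb_depth A \<le> l) \<and> f_tour_depth T k l \<le> card (pverts A)"
    by (rule g(2))
  show "(\<And>c. edge_coloring k T c \<Longrightarrow> \<exists>A r. (pm_arborescence T c A r \<and> arb_depth A \<le> l) \<and> m \<le> card (pverts A))
     \<Longrightarrow> m \<le> f_tour_depth T k l"
    by (rule g(3))
qed

lemma f_tour_minimax:
  "edge_coloring k T c \<Longrightarrow> \<exists>A r. pm_arborescence T c A r \<and> f_tour T k \<le> card (pverts A)"
  "(\<And>c. edge_coloring k T c \<Longrightarrow> \<exists>A r. pm_arborescence T c A r \<and> m \<le> card (pverts A))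
     \<Longrightarrow> m \<le> f_tour T k"
proof -
  have ex: "\<exists>A r. pm_arborescence T c A r" for c
    using exists_small_pm_arborescence[OF T] by blast
  note g = Greatest_minimax[where C = "edge_coloring k T" and size = "\<lambda>A. card (pverts A)"
      and Q = "pm_arborescence T", OF ex edge_coloring_0[OF k] pm_arborescence_card_le[OF T(1)],
      folded f_tour_eq]
  show "edge_coloring k T c \<Longrightarrow> \<exists>A r. pm_arborescence T c A r \<and> f_tour T k \<le> card (pverts A)"
    by (rule g(2))
  show "(\<And>c. edge_coloring k T c \<Longrightarrow> \<exists>A r. pm_arborescence T c A r \<and> m \<le> card (pverts A))
     \<Longrightarrow> m \<le> f_tour T k"
    by (rule g(3))
qed

end

lemma exists_tournament: "\<exists>T :: nat pair_pre_digraph. tournament T \<and> card (pverts T) = n"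
proof -
  let ?T = "\<lparr>pverts = {..<n}, parcs = {(i, j). i < j \<and> j < n}\<rparr>"
  have "finite {(i, j). i < j \<and> j < n}" by (rule finite_subset[of _ "{..<n} \<times> {..<n}"]) auto
  then have "pair_digraph ?T" by unfold_locales auto
  then have "tournament ?T" by (auto simp: tournament_def oriented_graph_def)
  moreover have "card (pverts ?T) = n" by simp
  ultimately show ?thesis by blast
qed

context
  fixes n k :: nat
  assumes n: "1 \<le> n" and k: "1 \<le> k"
begin

lemma nonempty_if_card: "card (pverts T) = n \<Longrightarrow> pverts T \<noteq> {}"
  using n by auto

lemma finite_f_tour_depth: "finite {f_tour_depth T k l | T :: nat pair_pre_digraph. tournament T \<and> card (pverts T) = n}"
proof (rule finite_subset)
  have "f_tour_depth T k l \<le> n" if "tournament T" "card (pverts T) = n" for T :: "nat pair_pre_digraph"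
    using f_tour_depth_minimax(2)[OF that(1) nonempty_if_card[OF that(2)] k edge_coloring_0[OF k], of l]
      pm_arborescence_card_le[OF that(1)] that(2) le_trans by blast
  then show "{f_tour_depth T k l | T :: nat pair_pre_digraph. tournament T \<and> card (pverts T) = n} \<subseteq> {..n}" by blast
qed simp

lemma finite_f_tour: "finite {f_tour T k | T :: nat pair_pre_digraph. tournament T \<and> card (pverts T) = n}"
proof (rule finite_subset)
  have "f_tour T k \<le> n" if "tournament T" "card (pverts T) = n" for T :: "nat pair_pre_digraph"
    using f_tour_minimax(1)[OF that(1) nonempty_if_card[OF that(2)] k edge_coloring_0[OF k]]
      pm_arborescence_card_le[OF that(1)] that(2) le_trans by blast
  then show "{f_tour T k | T :: nat pair_pre_digraph. tournament T \<and> card (pverts T) = n} \<subseteq> {..n}" by blast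
qed simp

lemma f_depth_geI:
  assumes "\<And>(T :: nat pair_pre_digraph) c. tournament T \<Longrightarrow> card (pverts T) = n \<Longrightarrow> edge_coloring k T c \<Longrightarrow>
    \<exists>A r. (pm_arborescence T c A r \<and> arb_depth A \<le> l) \<and> m \<le> card (pverts A)"
  shows "m \<le> f_depth k l n"
  unfolding f_depth_def
  using exists_tournament[of n] finite_f_tour_depth f_tour_depth_minimax(3)[OF _ nonempty_if_card k] assms
  by (subst Min_ge_iff) blast+

lemma f_all_geI:
  assumes "\<And>(T :: nat pair_pre_digraph) c. tournament T \<Longrightarrow> card (pverts T) = n \<Longrightarrow> edge_coloring k T c \<Longrightarrow>
    \<exists>A r. pm_arborescence T c A r \<and> m \<le> card (pverts A)"
  shows "m \<le> f_all k n"
  unfolding f_all_def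
  using exists_tournament[of n] finite_f_tour f_tour_minimax(2)[OF _ nonempty_if_card k] assms
  by (subst Min_ge_iff) blast+

lemma f_depth_leI:
  fixes T :: "nat pair_pre_digraph"
  assumes T: "tournament T" "card (pverts T) = n" and c: "edge_coloring k T c"
    and reach: "\<And>r. r \<in> pverts T \<Longrightarrow> card {x. \<exists>i. \<exists>j\<le>l. (r, x) \<in> colour_class T c i ^^ j} \<le> m"
  shows "f_depth k l n \<le> m"
proof -
  obtain A r where A: "pm_arborescence T c A r" "arb_depth A \<le> l" "f_tour_depth T k l \<le> card (pverts A)"
    using f_tour_depth_minimax(2)[OF T(1) nonempty_if_card[OF T(2)] k c] by blast
  have r: "r \<in> pverts T" using A(1) by (auto simp: pm_arborescence_def arborescence_def subgraph_def)
  have "f_depth k l n \<le> f_tour_depth T k l"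
    unfolding f_depth_def using finite_f_tour_depth T by (intro Min_le) auto
  also have "\<dots> \<le> card (pverts A)" by (fact A(3))
  also have "\<dots> \<le> card {x. \<exists>i. \<exists>j\<le>l. (r, x) \<in> colour_class T c i ^^ j}"
  proof (rule card_mono)
    show "finite {x. \<exists>i. \<exists>j\<le>l. (r, x) \<in> colour_class T c i ^^ j}"
      using finite_reach[OF T(1) r, of c] by (rule finite_subset[rotated]) blast
    show "pverts A \<subseteq> {x. \<exists>i. \<exists>j\<le>l. (r, x) \<in> colour_class T c i ^^ j}"
      using pm_arborescence_reach[OF A(1)] A(2) le_trans by blast
  qed
  also have "\<dots> \<le> m" using reach[OF r] .
  finally show ?thesis .
qed

lemma f_all_leI:
  fixes T :: "nat pair_pre_digraph"
  assumes T: "tournament T" "card (pverts T) = n" and c: "edge_coloring k T c"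
    and reach: "\<And>r. r \<in> pverts T \<Longrightarrow> card {x. \<exists>i j. (r, x) \<in> colour_class T c i ^^ j} \<le> m"
  shows "f_all k n \<le> m"
proof -
  obtain A r where A: "pm_arborescence T c A r" "f_tour T k \<le> card (pverts A)"
    using f_tour_minimax(1)[OF T(1) nonempty_if_card[OF T(2)] k c] by blast
  have r: "r \<in> pverts T" using A(1) by (auto simp: pm_arborescence_def arborescence_def subgraph_def)
  have "f_all k n \<le> f_tour T k"
    unfolding f_all_def using finite_f_tour T by (intro Min_le) auto
  also have "\<dots> \<le> card (pverts A)" by (fact A(2))
  also have "\<dots> \<le> card {x. \<exists>i j. (r, x) \<in> colour_class T c i ^^ j}"
    using finite_reach[OF T(1) r] pm_arborescence_reach[OF A(1)] by (intro card_mono) blast+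
  also have "\<dots> \<le> m" using reach[OF r] .
  finally show ?thesis .
qed

end

section \<open>Blow-ups and lexicographic powers\<close>

text \<open>Arcs inside a fibre of \<open>g\<close> collapse, so the image walk may be
  shorter.\<close>

lemma relpow_image_mono:
  assumes "\<And>x y. (x, y) \<in> E \<Longrightarrow> g x = g y \<or> (g x, g y) \<in> F" "(x, y) \<in> E ^^ j"
  shows "\<exists>j'\<le>j. (g x, g y) \<in> F ^^ j'"
  using assms(2)
proof (induction j arbitrary: y)
  case 0
  then show ?case by auto
next
  case (Suc j)
  then obtain z where z: "(x, z) \<in> E ^^ j" "(z, y) \<in> E" by auto
  then obtain j' where j': "j' \<le> j" "(g x, g z) \<in> F ^^ j'" using Suc.IH by blast
  from assms(1)[OF z(2)] show ?case
  proof
    assume "g z = g y"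
    then show ?thesis using j' by (intro exI[of _ j']) auto
  next
    assume "(g z, g y) \<in> F"
    then have "(g x, g y) \<in> F ^^ Suc j'" using j' by auto
    then show ?thesis using j' by (intro exI[of _ "Suc j'"]) simp
  qed
qed

lemma f_depth_attained:
  assumes "1 \<le> n" "1 \<le> k"
  shows "\<exists>(T :: nat pair_pre_digraph) c. tournament T \<and> card (pverts T) = n \<and> edge_coloring k T c \<and>
    (\<forall>A r. pm_arborescence T c A r \<and> arb_depth A \<le> l \<longrightarrow> card (pverts A) \<le> f_depth k l n)"
proof -
  have "f_depth k l n \<in> {f_tour_depth T k l | T :: nat pair_pre_digraph. tournament T \<and> card (pverts T) = n}"
    unfolding f_depth_def using finite_f_tour_depth[OF assms] exists_tournament[of n] by (intro Min_in) auto
  then obtain T :: "nat pair_pre_digraph" where T: "tournament T" "card (pverts T) = n" "f_depth k l n = f_tour_depth T k l"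
    by auto
  moreover have "pverts T \<noteq> {}" using T assms by auto
  ultimately show ?thesis using f_tour_depth_minimax(1)[of T k l] assms(2) by metis
qed

lemma exists_pm_arborescence_depth2:
  fixes T :: "'a pair_pre_digraph"
  assumes T: "tournament T" and r: "r \<in> pverts T"
  shows "\<exists>A. pm_arborescence T c A r \<and> arb_depth A \<le> 2 \<and>
    pverts A = {x. \<exists>i. \<exists>j\<le>2. (r, x) \<in> colour_class T c i ^^ j}"
proof -
  define I where "I i = {u. (r, u) \<in> colour_class T c i}" for i
  have dj: "I i \<inter> I j = {}" if "i \<noteq> j" for i j using that by (auto simp: I_def colour_class_def)
  have "\<exists>A. pm_arborescence T c A r \<and> arb_depth A \<le> 2 \<and>
      pverts A = {x. \<exists>i. \<exists>j\<le>2. (r, x) \<in> (colour_class T c i \<inter> insert r (I i) \<times> UNIV) ^^ j}"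
    using T r dj by (rule exists_pm_arborescence)
  then obtain A where A: "pm_arborescence T c A r \<and> arb_depth A \<le> 2 \<and>
      pverts A = {x. \<exists>i. \<exists>j\<le>2. (r, x) \<in> (colour_class T c i \<inter> insert r (I i) \<times> UNIV) ^^ j}"
    by (elim exE)
  have "(r, x) \<in> (E \<inter> insert r {u. (r, u) \<in> E} \<times> UNIV) ^^ j \<longleftrightarrow> (r, x) \<in> E ^^ j" if "j \<le> 2" for x j and E :: "('a \<times> 'a) set"
  proof -
    consider "j = 0" | "j = 1" | "j = Suc (Suc 0)" using \<open>j \<le> 2\<close> by linarith
    then show ?thesis
    proof cases
      case 3
      show ?thesis unfolding 3 relpow.simps(2) relpow.simps(1) by blast
    qed auto
  qed
  then have "pverts A = {x. \<exists>i. \<exists>j\<le>2. (r, x) \<in> colour_class T c i ^^ j}"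
    using A unfolding I_def by (simp cong: conj_cong)
  with A show ?thesis by (intro exI[of _ A] conjI) simp_all
qed

lemma tournamentI:
  assumes "finite V" "P \<subseteq> V \<times> V" "\<And>u v. (u, v) \<in> P \<Longrightarrow> (v, u) \<notin> P"
    "\<And>u v. u \<in> V \<Longrightarrow> v \<in> V \<Longrightarrow> u \<noteq> v \<Longrightarrow> (u, v) \<in> P \<or> (v, u) \<in> P"
  shows "tournament \<lparr>pverts = V, parcs = P\<rparr>"
proof -
  have "finite P" using assms(1,2) by (meson finite_SigmaI finite_subset)
  then have "pair_digraph \<lparr>pverts = V, parcs = P\<rparr>"
    using assms by unfold_locales (auto, blast)
  with assms show ?thesis by (auto simp: tournament_def oriented_graph_def)
qed

text \<open>Each vertex of an optimal tournament on \<open>n\<close> vertices becomes a residue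
  class modulo \<open>n\<close>, of at most \<open>N div n + 1\<close> elements. Walks project to
  walks that are no longer, and at depth 2 the set reached in the small tournament is spanned by an
  arborescence, hence has at most \<open>f_depth k 2 n\<close> elements.\<close>

lemma f_depth_2_blow_up:
  assumes n: "1 \<le> n" and N: "1 \<le> N" and k: "1 \<le> k"
  shows "f_depth k 2 N \<le> (N div n + 1) * f_depth k 2 n"
proof -
  obtain T :: "nat pair_pre_digraph" and c where T: "tournament T" "card (pverts T) = n" "edge_coloring k T c"
    and small: "\<And>A r. pm_arborescence T c A r \<Longrightarrow> arb_depth A \<le> 2 \<Longrightarrow> card (pverts A) \<le> f_depth k 2 n"
    using f_depth_attained[OF n k, of 2] by blast
  interpret T: pair_digraph T using T(1) by (simp add: tournament_def oriented_graph_def)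
  obtain b where b: "bij_betw b {0..<n} (pverts T)"
    using ex_bij_betw_nat_finite[OF T.pair_finite_verts] T(2) by blast
  define g where "g x = b (x mod n)" for x
  have g: "g x \<in> pverts T" for x using b n by (auto simp: g_def bij_betw_def)
  have g_eq: "g x = g y \<longleftrightarrow> x mod n = y mod n" for x y
    using b n unfolding g_def bij_betw_def by (subst inj_on_eq_iff[of b "{0..<n}"]) auto
  define P where "P = {(x, y). x < N \<and> y < N \<and> ((g x, g y) \<in> parcs T \<or> g x = g y \<and> x < y)}"
  define B where "B = \<lparr>pverts = {..<N}, parcs = P\<rparr>"
  \<comment> \<open>The projection collapses arcs inside a class, so any colour below
    \<open>k\<close> would do for them.\<close>
  define c' where "c' = (\<lambda>(x, y). if g x = g y then 0 else c (g x, g y))"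
  have T_asym: "(v, u) \<notin> parcs T" if "(u, v) \<in> parcs T" for u v
    using T(1) that by (auto simp: tournament_def oriented_graph_def)
  have T_tot: "(u, v) \<in> parcs T \<or> (v, u) \<in> parcs T" if "u \<in> pverts T" "v \<in> pverts T" "u \<noteq> v" for u v
    using T(1) that by (auto simp: tournament_def)
  have B: "tournament B" unfolding B_def
  proof (rule tournamentI)
    have P: "(u, v) \<in> P \<longleftrightarrow> u < N \<and> v < N \<and> ((g u, g v) \<in> parcs T \<or> g u = g v \<and> u < v)" for u v
      by (simp add: P_def)
    show "(v, u) \<notin> P" if "(u, v) \<in> P" for u v
      using that T_asym[of "g u" "g v"] T_asym[of "g u" "g u"] unfolding P by (metis less_asym)
    show "(u, v) \<in> P \<or> (v, u) \<in> P" if "u \<in> {..<N}" "v \<in> {..<N}" "u \<noteq> v" for u v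
      using that T_tot[OF g g, of u v] unfolding P lessThan_iff by (metis linorder_neqE_nat)
  qed (auto simp: P_def)
  have "edge_coloring k B c'"
    unfolding edge_coloring_def
  proof clarify
    fix x y assume "(x, y) \<in> parcs B"
    then have "g x = g y \<or> (g x, g y) \<in> parcs T" by (auto simp: B_def P_def)
    then show "c' (x, y) < k" using T(3) k by (auto simp: c'_def edge_coloring_def)
  qed
  moreover have "card {y. \<exists>i. \<exists>j\<le>2. (x, y) \<in> colour_class B c' i ^^ j} \<le> (N div n + 1) * f_depth k 2 n"
    if x: "x \<in> pverts B" for x
  proof -
    define R where "R = {u. \<exists>i. \<exists>j\<le>2. (g x, u) \<in> colour_class T c i ^^ j}"
    obtain A where A: "pm_arborescence T c A (g x)" "arb_depth A \<le> 2" "pverts A = R"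
      using exists_pm_arborescence_depth2[OF T(1) g] unfolding R_def by blast
    have finR: "finite R"
      using finite_reach[OF T(1) g, of x c] unfolding R_def by (rule finite_subset[rotated]) blast
    have cR: "card R \<le> f_depth k 2 n" using small[OF A(1,2)] A(3) by simp
    let ?Y = "{y. \<exists>i. \<exists>j\<le>2. (x, y) \<in> colour_class B c' i ^^ j}"
    have Y: "y < N \<and> g y \<in> R" if y: "y \<in> ?Y" for y
    proof -
      obtain i j where ij: "j \<le> 2" "(x, y) \<in> colour_class B c' i ^^ j" using y by blast
      have "y < N" using ij(2) x by (cases j) (auto simp: colour_class_def B_def P_def)
      have "\<exists>j'\<le>j. (g x, g y) \<in> colour_class T c i ^^ j'"
        using ij(2) by (rule relpow_image_mono[rotated]) (auto simp: colour_class_def B_def P_def c'_def)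
      then obtain j' where "j' \<le> j" "(g x, g y) \<in> colour_class T c i ^^ j'" by blast
      then have "g y \<in> R" using ij(1) unfolding R_def by (intro CollectI exI[of _ i] exI[of _ j']) simp
      with \<open>y < N\<close> show ?thesis by blast
    qed
    have "card ?Y \<le> card (R \<times> {..N div n})"
    proof (rule card_inj_on_le)
      show "inj_on (\<lambda>y. (g y, y div n)) ?Y"
        by (rule inj_onI) (metis g_eq Pair_inject div_mod_decomp)
      show "(\<lambda>y. (g y, y div n)) ` ?Y \<subseteq> R \<times> {..N div n}" using Y by (auto intro: div_le_mono less_imp_le)
      show "finite (R \<times> {..N div n})" using finR by simp
    qed
    also have "\<dots> = card R * (N div n + 1)" by (simp add: card_cartesian_product)
    also have "\<dots> \<le> (N div n + 1) * f_depth k 2 n" using cR by (subst mult.commute) (rule mult_le_mono2)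
    finally show ?thesis .
  qed
  moreover have "card (pverts B) = N" by (simp add: B_def)
  ultimately show ?thesis using f_depth_leI[OF N k B] by blast
qed

section \<open>Comparison at the lowest differing digit\<close>

text \<open>Letting the lowest digit decide makes the parts on every level residue classes, so an
  initial segment \<open>{..<n}\<close> is almost balanced for every \<open>n\<close>, not only for
  powers of \<open>m\<close>. The pair \<open>(0, 0)\<close> is a default for \<open>x = y\<close>
  and for \<open>m\<close> that is no base.\<close>

function digit_pair :: "nat \<Rightarrow> nat \<Rightarrow> nat \<Rightarrow> nat \<times> nat" where
  "digit_pair m x y = (if x = y \<or> m < 2 then (0, 0)
    else if x mod m \<noteq> y mod m then (x mod m, y mod m) else digit_pair m (x div m) (y div m))"
  by auto
termination
proof (relation "measure (\<lambda>(m, x, y). x + y)")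
  fix m x y :: nat assume a: "\<not> (x = y \<or> m < 2)"
  then consider "0 < x" | "0 < y" by linarith
  then show "((m, x div m, y div m), m, x, y) \<in> measure (\<lambda>(m, x, y). x + y)"
  proof cases
    case 1
    then have "x div m < x" "y div m \<le> y" using a by auto
    then show ?thesis by (simp add: add_less_le_mono)
  next
    case 2
    then have "y div m < y" "x div m \<le> x" using a by auto
    then show ?thesis by (simp add: add_le_less_mono)
  qed
qed simp

declare digit_pair.simps [simp del]

lemma digit_pair_mod: "2 \<le> m \<Longrightarrow> x mod m \<noteq> y mod m \<Longrightarrow> digit_pair m x y = (x mod m, y mod m)"
  by (subst digit_pair.simps) auto

lemma digit_pair_div: "2 \<le> m \<Longrightarrow> x \<noteq> y \<Longrightarrow> x mod m = y mod m \<Longrightarrow> digit_pair m x y = digit_pair m (x div m) (y div m)"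
  by (subst digit_pair.simps) auto

lemma div_neq_if_mod_eq: "x \<noteq> y \<Longrightarrow> x mod m = y mod m \<Longrightarrow> x div m \<noteq> y div (m :: nat)"
  by (metis div_mod_decomp)

lemma digit_pair_distinct_digits:
  assumes "2 \<le> m" "x \<noteq> y"
  shows "\<exists>a b. digit_pair m x y = (a, b) \<and> digit_pair m y x = (b, a) \<and> a \<noteq> b \<and> a < m \<and> b < m"
  using assms
proof (induction m x y rule: digit_pair.induct)
  case (1 m x y)
  show ?case
  proof (cases "x mod m = y mod m")
    case True
    then show ?thesis using 1 div_neq_if_mod_eq[of x y m] digit_pair_div[of m x y] digit_pair_div[of m y x] by auto
  next
    case False
    then show ?thesis using 1 digit_pair_mod[of m x y] digit_pair_mod[of m y x] by auto
  qed
qed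

definition digit_rel :: "nat \<Rightarrow> (nat \<times> nat) set \<Rightarrow> (nat \<times> nat) set" where
  "digit_rel m C = {(x, y). x \<noteq> y \<and> digit_pair m x y \<in> C}"

text \<open>Either all steps keep the last digit, and the walk lives on the quotients, or the steps
  that change it trace a nonempty walk on digits.\<close>

lemma digit_rel_relpow:
  assumes m: "2 \<le> m" and "(v, u) \<in> digit_rel m C ^^ j"
  shows "(\<exists>j'. 1 \<le> j' \<and> j' \<le> j \<and> (v mod m, u mod m) \<in> C ^^ j') \<or>
    (v mod m = u mod m \<and> (v div m, u div m) \<in> digit_rel m C ^^ j)"
  using assms(2)
proof (induction j arbitrary: u)
  case (Suc j)
  then obtain z where z: "(v, z) \<in> digit_rel m C ^^ j" "z \<noteq> u" "digit_pair m z u \<in> C" by (auto simp: digit_rel_def)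
  show ?case
  proof (cases "z mod m = u mod m")
    case True
    then have "(z div m, u div m) \<in> digit_rel m C"
      using z digit_pair_div[OF m z(2) True] div_neq_if_mod_eq[OF z(2) True] by (simp add: digit_rel_def)
    with Suc.IH[OF z(1)] True show ?thesis by (metis le_SucI relpow_Suc_I)
  next
    case False
    then have st: "(z mod m, u mod m) \<in> C" using digit_pair_mod[OF m False] z by simp
    from Suc.IH[OF z(1)] show ?thesis
    proof
      assume "\<exists>j'. 1 \<le> j' \<and> j' \<le> j \<and> (v mod m, z mod m) \<in> C ^^ j'"
      then obtain j' where "1 \<le> j'" "j' \<le> j" "(v mod m, z mod m) \<in> C ^^ j'" by blast
      with st have "(v mod m, u mod m) \<in> C ^^ Suc j'" by auto
      with \<open>j' \<le> j\<close> show ?thesis by (intro disjI1 exI[of _ "Suc j'"]) auto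
    next
      assume "v mod m = z mod m \<and> (v div m, z div m) \<in> digit_rel m C ^^ j"
      with st have "(v mod m, u mod m) \<in> C ^^ 1" by simp
      then show ?thesis by (intro disjI1 exI[of _ 1]) simp
    qed
  qed
qed simp

text \<open>A walk that leaves a residue class cannot return, as \<open>C\<close> has no short
  closed walks; so equal last digits can be stripped. At the differing digit the walk would project
  to a short one from \<open>a + 1\<close> to \<open>a\<close>.\<close>

lemma digit_rel_unreachable:
  assumes m: "2 \<le> m"
    and closed: "\<And>a j'. 1 \<le> j' \<Longrightarrow> j' \<le> j \<Longrightarrow> (a, a) \<notin> C ^^ j'"
    and cyc: "\<And>a j'. 1 \<le> j' \<Longrightarrow> j' \<le> j \<Longrightarrow> a < m \<Longrightarrow> (Suc a mod m, a) \<notin> C ^^ j'"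
    and "v \<noteq> u" "a < m" "digit_pair m v u = (Suc a mod m, a)"
  shows "(v, u) \<notin> digit_rel m C ^^ j"
  using assms(4-6)
proof (induction "v + u" arbitrary: v u rule: less_induct)
  case less
  show ?case
  proof
    assume walk: "(v, u) \<in> digit_rel m C ^^ j"
    show False
    proof (cases "v mod m = u mod m")
      case False
      then have "v mod m = Suc a mod m" "u mod m = a" using digit_pair_mod[OF m False] less.prems by auto
      then show False using digit_rel_relpow[OF m walk] cyc less.prems(2) False by auto
    next
      case True
      then have "(v div m, u div m) \<in> digit_rel m C ^^ j"
        using digit_rel_relpow[OF m walk] closed by auto
      moreover have "digit_pair m (v div m) (u div m) = (Suc a mod m, a)"
        using digit_pair_div[OF m less.prems(1) True] less.prems(3) by simp
      moreover have "v div m + u div m < v + u"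
      proof (cases "v = 0")
        case True
        then have "u div m < u" using less.prems(1) m by simp
        then show ?thesis using div_le_dividend[of v m] by linarith
      next
        case False
        then have "v div m < v" using m by simp
        then show ?thesis using div_le_dividend[of u m] by linarith
      qed
      ultimately show False
        using less.hyps div_neq_if_mod_eq[OF less.prems(1) True] less.prems(2) by blast
    qed
  qed
qed

text \<open>In the extremal examples these are vertices that no monochromatic walk of the allowed
  length reaches from \<open>v\<close>.\<close>

definition blocked :: "nat \<Rightarrow> nat \<Rightarrow> nat \<Rightarrow> nat set" where
  "blocked m n v = {u. u < n \<and> u \<noteq> v \<and> (\<exists>a<m. digit_pair m v u = (Suc a mod m, a))}"

text \<open>The recursion for the missed fraction: the class of the preceding digit is blocked
  entirely, and the class of \<open>v\<close> carries a copy of the problem on quotients. Only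
  quotients below \<open>n div m\<close> are counted, because these occur with every last
  digit.\<close>

lemma card_blocked_div:
  assumes m: "2 \<le> m"
  shows "n div m + card (blocked m (n div m) (v div m)) \<le> card (blocked m n v)"
proof -
  define w where "w = v mod m"
  \<comment> \<open>The cyclic predecessor of \<open>w\<close>; adding \<open>m\<close> first avoids
    truncated subtraction at \<open>w = 0\<close>.\<close>
  define a where "a = (w + m - 1) mod m"
  have w: "w < m" and a: "a < m" using m by (auto simp: w_def a_def)
  have Suc_a: "Suc a mod m = w"
    unfolding a_def mod_Suc_eq using m w by simp
  have aw: "a \<noteq> w" using Suc_a a m by (auto simp: mod_Suc split: if_splits)
  have less: "m * q + d < n" if "q < n div m" "d < m" for q d
  proof -
    have "m * q + d < m * Suc q" using that by simp
    also have "\<dots> \<le> m * (n div m)" using that by (intro mult_le_mono) auto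
    finally show ?thesis using mult_div_mod_eq[of m n] by linarith
  qed
  let ?S = "(\<lambda>q. m * q + a) ` {..<n div m}" and ?S' = "(\<lambda>q. m * q + w) ` blocked m (n div m) (v div m)"
  have "?S \<subseteq> blocked m n v"
  proof (clarsimp simp: blocked_def)
    fix q assume q: "q < n div m"
    have "(m * q + a) mod m = a" using a by simp
    then have "digit_pair m v (m * q + a) = (Suc a mod m, a)" "m * q + a \<noteq> v"
      using digit_pair_mod[OF m, of v "m * q + a"] aw Suc_a by (auto simp: w_def)
    then show "m * q + a < n \<and> m * q + a \<noteq> v \<and> (\<exists>b<m. digit_pair m v (m * q + a) = (Suc b mod m, b))"
      using less[OF q a] a by blast
  qed
  moreover have "?S' \<subseteq> blocked m n v"
  proof
    fix u assume "u \<in> ?S'"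
    then obtain q b where q: "u = m * q + w" "q < n div m" "q \<noteq> v div m" "b < m"
      "digit_pair m (v div m) q = (Suc b mod m, b)" by (auto simp: blocked_def)
    have u: "u mod m = v mod m" "u div m = q" using q(1) w by (auto simp: w_def)
    then have "u \<noteq> v" using q(3) by auto
    then have "digit_pair m v u = (Suc b mod m, b)" using digit_pair_div[OF m, of v u] u q(5) by simp
    then show "u \<in> blocked m n v" using less[OF q(2) w] q(1,4) \<open>u \<noteq> v\<close> by (auto simp: blocked_def)
  qed
  moreover have "?S \<inter> ?S' = {}"
  proof -
    have "m * q + a \<noteq> m * q' + w" for q q'
    proof
      assume "m * q + a = m * q' + w"
      then have "(m * q + a) mod m = (m * q' + w) mod m" by simp
      then show False using a w aw by simp
    qed
    then show ?thesis by blast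
  qed
  moreover have fin: "finite (blocked m n v)" for n v by (simp add: blocked_def)
  ultimately have "card ?S + card ?S' \<le> card (blocked m n v)"
    by (subst card_Un_disjoint[symmetric]) (auto intro!: card_mono)
  moreover have "card ?S = n div m" "card ?S' = card (blocked m (n div m) (v div m))"
    using m by (auto simp: card_image inj_on_def)
  ultimately show ?thesis by simp
qed

text \<open>Unfolding the recursion \<open>P\<close> times adds up the powers of
  \<open>1 / m\<close> from the first to the \<open>P\<close>-th, which is
  \<open>(1 - 1 / m ^ P) / (m - 1)\<close>. Rounding costs at most \<open>m\<close> per level in the
  scaled inequality.\<close>

lemma card_blocked_ge:
  assumes m: "2 \<le> m"
  shows "real n * (1 - 1 / real m ^ P) - real m * real P \<le> (real m - 1) * real (card (blocked m n v))"
proof (induction P arbitrary: n v)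
  case 0
  then show ?case using m by simp
next
  case (Suc P)
  define n' where "n' = n div m"
  define q where "q = 1 / real m ^ P"
  have q: "0 \<le> q" "q \<le> 1" using m by (auto simp: q_def)
  have "n = m * n' + n mod m" by (simp add: n'_def)
  moreover have "n mod m \<le> m - 1" using m by (metis One_nat_def Suc_pred less_Suc_eq_le mod_less_divisor zero_less_numeral order_less_le_trans)
  ultimately have "n \<le> m * n' + (m - 1)" by linarith
  then have "real n \<le> real (m * n' + (m - 1))" by (simp only: of_nat_le_iff)
  then have "real n \<le> real m * real n' + (real m - 1)" using m by (simp add: of_nat_diff)
  then have "real n * (1 - q / real m) \<le> (real m * real n' + (real m - 1)) * (1 - q / real m)"
    using q m by (intro mult_right_mono) (auto simp: field_simps)
  also have "\<dots> = real n' * (real m - q) + (real m - 1) * (1 - q / real m)" using m by (simp add: field_simps)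
  also have "(real m - 1) * (1 - q / real m) \<le> (real m - 1) * 1" using q m by (intro mult_left_mono) auto
  finally have 1: "real n * (1 - q / real m) \<le> real n' * (real m - q) + real m" by simp
  have "real n' + real (card (blocked m n' (v div m))) \<le> real (card (blocked m n v))"
    using card_blocked_div[OF m, of n v] unfolding n'_def by (metis of_nat_add of_nat_le_iff)
  then have "(real m - 1) * (real n' + real (card (blocked m n' (v div m)))) \<le> (real m - 1) * real (card (blocked m n v))"
    using m by (intro mult_left_mono) auto
  moreover have "real n' * (1 - q) - real m * real P \<le> (real m - 1) * real (card (blocked m n' (v div m)))"
    using Suc.IH[of n' "v div m"] by (simp add: q_def)
  ultimately have "real n' * (real m - q) - real m * real P \<le> (real m - 1) * real (card (blocked m n v))"
    by (simp add: algebra_simps)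
  moreover have "1 / real m ^ Suc P = q / real m" by (simp add: q_def field_simps)
  ultimately show ?case using 1 by (simp add: algebra_simps)
qed

section \<open>Extremal tournaments and upper bounds\<close>

definition digit_tournament :: "nat \<Rightarrow> nat \<Rightarrow> (nat \<times> nat) set \<Rightarrow> nat pair_pre_digraph" where
  "digit_tournament m n B =
     \<lparr>pverts = {..<n}, parcs = {(x, y). x < n \<and> y < n \<and> x \<noteq> y \<and> digit_pair m x y \<in> B}\<rparr>"

lemma digit_tournament:
  assumes "2 \<le> m" "\<And>a b. a < m \<Longrightarrow> b < m \<Longrightarrow> a \<noteq> b \<Longrightarrow> (a, b) \<in> B \<longleftrightarrow> (b, a) \<notin> B"
  shows "tournament (digit_tournament m n B)"
  unfolding digit_tournament_def
proof (rule tournamentI)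
  let ?P = "{(x, y). x < n \<and> y < n \<and> x \<noteq> y \<and> digit_pair m x y \<in> B}"
  have iff: "digit_pair m u v \<in> B \<longleftrightarrow> digit_pair m v u \<notin> B" if uv: "u \<noteq> v" for u v
  proof -
    obtain a b where "digit_pair m u v = (a, b)" "digit_pair m v u = (b, a)" "a \<noteq> b" "a < m" "b < m"
      using digit_pair_distinct_digits[OF assms(1) uv] by blast
    then show ?thesis using assms(2)[of a b] by simp
  qed
  show "(v, u) \<notin> ?P" if "(u, v) \<in> ?P" for u v using iff[of u v] that by simp
  show "(u, v) \<in> ?P \<or> (v, u) \<in> ?P" if "u \<in> {..<n}" "v \<in> {..<n}" "u \<noteq> v" for u v
    using iff[of u v] that by simp
qed auto

text \<open>The downward closed predicate \<open>J\<close> on lengths lets the same count serve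
  walks of length at most \<open>l\<close> and walks of any length.\<close>

lemma card_digit_tournament_reach:
  assumes m: "2 \<le> m" and J: "\<And>i j. J j \<Longrightarrow> i \<le> j \<Longrightarrow> J i"
    and closed: "\<And>i a j. 1 \<le> j \<Longrightarrow> J j \<Longrightarrow> (a, a) \<notin> {e \<in> B. c e = i} ^^ j"
    and cyc: "\<And>i a j. 1 \<le> j \<Longrightarrow> J j \<Longrightarrow> a < m \<Longrightarrow> (Suc a mod m, a) \<notin> {e \<in> B. c e = i} ^^ j"
    and r: "r < n"
  shows "real (card {x. \<exists>i j. J j \<and>
      (r, x) \<in> colour_class (digit_tournament m n B) (\<lambda>(x, y). c (digit_pair m x y)) i ^^ j})
    \<le> real n - (real n * (1 - 1 / real m ^ P) - real m * real P) / (real m - 1)"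
proof -
  let ?E = "\<lambda>i. colour_class (digit_tournament m n B) (\<lambda>(x, y). c (digit_pair m x y)) i"
  have sub: "?E i \<subseteq> digit_rel m {e \<in> B. c e = i}" "?E i \<subseteq> UNIV \<times> {..<n}" for i
    by (auto simp: colour_class_def digit_tournament_def digit_rel_def)
  have "x < n \<and> x \<notin> blocked m n r" if J': "J j" and x: "(r, x) \<in> ?E i ^^ j" for x i j
  proof
    show "x < n" using x r sub(2)[of i] by (cases j) auto
    have walk: "(r, x) \<in> digit_rel m {e \<in> B. c e = i} ^^ j"
      using x relpow_subset_mono[OF sub(1)] by blast
    show "x \<notin> blocked m n r"
    proof
      assume "x \<in> blocked m n r"
      then obtain a where a: "r \<noteq> x" "a < m" "digit_pair m r x = (Suc a mod m, a)"
        by (auto simp: blocked_def)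
      have "(r, x) \<notin> digit_rel m {e \<in> B. c e = i} ^^ j"
        using J[OF J'] closed cyc a by (intro digit_rel_unreachable[OF m]) blast+
      with walk show False by blast
    qed
  qed
  then have sub2: "{x. \<exists>i j. J j \<and> (r, x) \<in> ?E i ^^ j} \<subseteq> {..<n} - blocked m n r" by blast
  have cb: "card (blocked m n r) \<le> n"
    using card_mono[of "{..<n}" "blocked m n r"] by (auto simp: blocked_def)
  have "card {x. \<exists>i j. J j \<and> (r, x) \<in> ?E i ^^ j} \<le> card ({..<n} - blocked m n r)"
    using sub2 by (intro card_mono) auto
  also have "\<dots> = n - card (blocked m n r)" by (subst card_Diff_subset) (auto simp: blocked_def)
  finally have "card {x. \<exists>i j. J j \<and> (r, x) \<in> ?E i ^^ j} + card (blocked m n r) \<le> n"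
    using cb by linarith
  then have "real (card {x. \<exists>i j. J j \<and> (r, x) \<in> ?E i ^^ j}) + real (card (blocked m n r)) \<le> real n"
    by (simp only: of_nat_le_iff flip: of_nat_add)
  moreover have "(real n * (1 - 1 / real m ^ P) - real m * real P) / (real m - 1) \<le> real (card (blocked m n r))"
    using card_blocked_ge[OF m, of n P r] m by (simp add: pos_divide_le_eq mult.commute)
  ultimately show ?thesis by linarith
qed

lemma add_mod_neq_self: "a < m \<Longrightarrow> 0 < t \<Longrightarrow> t < m \<Longrightarrow> (a + t) mod m \<noteq> (a :: nat)"
  by (cases "a + t < m") (auto simp: mod_if le_mod_geq not_less)

lemma relpow_Suc_mod:
  fixes a b m :: nat
  assumes "(a, b) \<in> {(a, b). b = Suc a mod m} ^^ j" "1 \<le> j"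
  shows "b = (a + j) mod m"
  using assms
proof (induction j arbitrary: b)
  case (Suc j)
  then obtain z where z: "(a, z) \<in> {(a, b). b = Suc a mod m} ^^ j" "b = Suc z mod m" by auto
  show ?case
  proof (cases "j = 0")
    case False
    then show ?thesis using Suc.IH[OF z(1)] z(2) by (simp add: mod_Suc_eq)
  qed (use z in auto)
qed simp

lemma relpow_drop:
  fixes a b :: nat
  assumes "(a, b) \<in> {(a, b). b + 2 \<le> a} ^^ j" "1 \<le> j"
  shows "b + 2 \<le> a"
  using assms
proof (induction j arbitrary: b)
  case (Suc j)
  then obtain z where z: "(a, z) \<in> {(a, b). b + 2 \<le> a} ^^ j" "b + 2 \<le> z" by auto
  show ?case
  proof (cases "j = 0")
    case False
    then show ?thesis using Suc.IH[OF z(1)] z(2) by simp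
  qed (use z in auto)
qed simp

lemma f_depth_2_le:
  assumes l: "1 \<le> l" and n: "1 \<le> n"
  shows "real (f_depth 2 l n)
    \<le> real n - (real n * (1 - 1 / real (l + 2) ^ P) - real (l + 2) * real P) / (real (l + 2) - 1)"
    (is "_ \<le> ?b")
proof -
  define m where "m = l + 2"
  \<comment> \<open>Cyclic arcs together with descending chords. The pair of \<open>m - 1\<close>
    and 0 is set apart among the chords, since it already is the closing arc of the cycle.\<close>
  define B where "B = {(a, b). a < m \<and> b < m \<and> (b = Suc a mod m \<or> (b + 2 \<le> a \<and> \<not> (a = m - 1 \<and> b = 0)))}"
  define c :: "nat \<times> nat \<Rightarrow> nat" where "c = (\<lambda>(a, b). if b = Suc a mod m then 0 else 1)"
  have m: "2 \<le> m" using l by (simp add: m_def)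
  have B: "(a, b) \<in> B \<longleftrightarrow> (b, a) \<notin> B" if "a < m" "b < m" "a \<noteq> b" for a b
    using that l unfolding B_def m_def by (auto simp: mod_Suc)
  have sub: "{e \<in> B. c e = i} \<subseteq> (if i = 0 then {(a, b). b = Suc a mod m} else {(a, b). b + 2 \<le> a})" for i
    by (auto simp: B_def c_def split: if_splits)
  have walk: "b = (a + j) mod m \<or> b + 2 \<le> a" if "(a, b) \<in> {e \<in> B. c e = i} ^^ j" "1 \<le> j" for a b i j
  proof (cases "i = 0")
    case True
    then have "{e \<in> B. c e = i} ^^ j \<subseteq> {(a, b). b = Suc a mod m} ^^ j"
      using relpow_subset_mono[OF sub[of i], of j] by simp
    with that(1) have "(a, b) \<in> {(a, b). b = Suc a mod m} ^^ j" by blast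
    from relpow_Suc_mod[OF this that(2)] show ?thesis by simp
  next
    case False
    then have "{e \<in> B. c e = i} ^^ j \<subseteq> {(a, b). b + 2 \<le> a} ^^ j"
      using relpow_subset_mono[OF sub[of i], of j] by simp
    with that(1) have "(a, b) \<in> {(a, b). b + 2 \<le> a} ^^ j" by blast
    from relpow_drop[OF this that(2)] show ?thesis by simp
  qed
  have closed: "(a, a) \<notin> {e \<in> B. c e = i} ^^ j" if "1 \<le> j" "j \<le> l" for a i j
  proof
    assume "(a, a) \<in> {e \<in> B. c e = i} ^^ j"
    from walk[OF this that(1)] have a: "a = (a + j) mod m" by simp
    moreover from a m have "a < m" by (metis less_le_trans mod_less_divisor zero_less_numeral)
    ultimately show False using add_mod_neq_self[of a m j] that by (simp add: m_def)
  qed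
  \<comment> \<open>In red the way from \<open>a + 1\<close> round to \<open>a\<close> takes
    \<open>m - 1 = l + 1\<close> steps, one too many. In blue every walk descends by at least 2,
    whereas \<open>a\<close> lies at most 1 below its cyclic successor.\<close>
  have cyc: "(Suc a mod m, a) \<notin> {e \<in> B. c e = i} ^^ j" if "1 \<le> j" "j \<le> l" "a < m" for a i j
  proof
    assume "(Suc a mod m, a) \<in> {e \<in> B. c e = i} ^^ j"
    from walk[OF this that(1)] show False
    proof
      assume "a = (Suc a mod m + j) mod m"
      also have "\<dots> = (a + Suc j) mod m" by (simp add: mod_simps)
      finally show False using add_mod_neq_self[of a m "Suc j"] that by (simp add: m_def)
    next
      assume "a + 2 \<le> Suc a mod m"
      then show False using mod_less_eq_dividend[of "Suc a" m] by linarith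
    qed
  qed
  have "real (card {x. \<exists>i j. j \<le> l \<and> (r, x) \<in> colour_class (digit_tournament m n B) (\<lambda>(x, y). c (digit_pair m x y)) i ^^ j})
      \<le> ?b" if "r < n" for r
    using card_digit_tournament_reach[where J = "\<lambda>j. j \<le> l", OF m _ closed cyc that, of P] by (simp add: m_def)
  then have "card {x. \<exists>i. \<exists>j\<le>l. (r, x) \<in> colour_class (digit_tournament m n B) (\<lambda>(x, y). c (digit_pair m x y)) i ^^ j}
      \<le> nat \<lfloor>?b\<rfloor>" if "r < n" for r
    using that by (simp add: le_nat_floor)
  moreover have "edge_coloring 2 (digit_tournament m n B) (\<lambda>(x, y). c (digit_pair m x y))"
    by (auto simp: edge_coloring_def c_def split: prod.splits)
  ultimately have "f_depth 2 l n \<le> nat \<lfloor>?b\<rfloor>"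
    using n digit_tournament[OF m B, of n]
    by (intro f_depth_leI[of n 2 "digit_tournament m n B" "\<lambda>(x, y). c (digit_pair m x y)"])
      (auto simp: digit_tournament_def)
  \<comment> \<open>\<open>nat\<close> truncates at 0, so the floor bound can be read back in the
    reals only for nonnegative \<open>?b\<close>; the count of vertices reached from 0 shows
    that.\<close>
  moreover have "0 \<le> ?b"
    using \<open>\<And>r. r < n \<Longrightarrow> real _ \<le> ?b\<close>[of 0] n of_nat_0_le_iff by (meson less_le_trans order_trans zero_less_one)
  ultimately show ?thesis by (meson le_nat_floor of_nat_floor of_nat_le_iff order_trans)
qed

lemma f_all_le:
  assumes k: "3 \<le> k" and n: "1 \<le> n"
  shows "real (f_all k n) \<le> real n - (real n * (1 - 1 / real 3 ^ P) - real 3 * real P) / (real 3 - 1)"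
    (is "_ \<le> ?b")
proof -
  define B :: "(nat \<times> nat) set" where "B = {(a, b). a < 3 \<and> b = Suc a mod 3}"
  have B: "(a, b) \<in> B \<longleftrightarrow> (b, a) \<notin> B" if "a < 3" "b < 3" "a \<noteq> b" for a b
    using that unfolding B_def by (auto simp: mod_Suc)
  \<comment> \<open>The tail serves as the colour, so each colour is a single arc of the triangle. A
    nonempty monochromatic walk on digits can only be that arc, which is why no length bound is
    called for.\<close>
  have walk: "i < 3 \<and> a = i \<and> b = Suc i mod 3"
    if w: "(a, b) \<in> {e \<in> B. fst e = i} ^^ j" "1 \<le> j" for a b i j
  proof -
    obtain j' where j: "j = Suc j'" using \<open>1 \<le> j\<close> by (cases j) auto
    have "i < 3 \<and> b = Suc i mod 3" using w unfolding j by (auto simp: B_def)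
    moreover obtain y where "(a, y) \<in> {e \<in> B. fst e = i}"
      using relpow_Suc_D2[OF w(1)[unfolded j]] by blast
    ultimately show ?thesis by simp
  qed
  have closed: "(a, a) \<notin> {e \<in> B. fst e = i} ^^ j" if "1 \<le> j" for a i j
  proof
    assume "(a, a) \<in> {e \<in> B. fst e = i} ^^ j"
    from walk[OF this that(1)] show False by (auto simp: mod_Suc split: if_splits)
  qed
  have cyc: "(Suc a mod 3, a) \<notin> {e \<in> B. fst e = i} ^^ j" if "1 \<le> j" "a < 3" for a i j
  proof
    assume "(Suc a mod 3, a) \<in> {e \<in> B. fst e = i} ^^ j"
    from walk[OF this that(1)] show False using that(2) by (auto simp: mod_Suc split: if_splits)
  qed
  have reach: "real (card {x. \<exists>i j. (r, x) \<in> colour_class (digit_tournament 3 n B) (\<lambda>(x, y). fst (digit_pair 3 x y)) i ^^ j})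
      \<le> ?b" if "r < n" for r
    using card_digit_tournament_reach[where J = "\<lambda>_. True" and c = fst, OF _ _ closed cyc that, of P] by simp
  have col: "edge_coloring k (digit_tournament 3 n B) (\<lambda>(x, y). fst (digit_pair 3 x y))"
    unfolding edge_coloring_def
  proof (rule image_subsetI)
    fix e assume e: "e \<in> parcs (digit_tournament 3 n B)"
    obtain x y where xy: "e = (x, y)" by (cases e)
    with e have "digit_pair 3 x y \<in> B" by (simp add: digit_tournament_def)
    then have "fst (digit_pair 3 x y) < 3" by (auto simp: B_def)
    then show "(\<lambda>(x, y). fst (digit_pair 3 x y)) e \<in> {..<k}" using k xy by simp
  qed
  have T: "tournament (digit_tournament 3 n B)" by (rule digit_tournament[OF _ B]) simp_all
  have "f_all k n \<le> nat \<lfloor>?b\<rfloor>"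
  proof (rule f_all_leI[OF n _ T _ col])
    show "1 \<le> k" using k by simp
    show "card (pverts (digit_tournament 3 n B)) = n" by (simp add: digit_tournament_def)
    show "card {x. \<exists>i j. (r, x) \<in> colour_class (digit_tournament 3 n B) (\<lambda>(x, y). fst (digit_pair 3 x y)) i ^^ j}
        \<le> nat \<lfloor>?b\<rfloor>" if "r \<in> pverts (digit_tournament 3 n B)" for r
    proof (rule le_nat_floor[OF reach])
      show "r < n" using that by (simp add: digit_tournament_def)
    qed
  qed
  moreover have "0 \<le> ?b"
  proof (rule order_trans[OF of_nat_0_le_iff])
    show "real (card {x. \<exists>i j. (0, x) \<in> colour_class (digit_tournament 3 n B) (\<lambda>(x, y). fst (digit_pair 3 x y)) i ^^ j})
        \<le> ?b" by (rule reach) (use n in simp)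
  qed
  ultimately show ?thesis by (meson of_nat_floor of_nat_le_iff order_trans)
qed

section \<open>Limits of the ratios\<close>

text \<open>\<open>P\<close> is fixed first to make the geometric remainder small; then
  \<open>n\<close> grows until the rounding loss \<open>m * P\<close> is negligible.\<close>

lemma eventually_ratio_le:
  fixes x :: "nat \<Rightarrow> nat" and m :: nat
  assumes m: "2 \<le> m" and \<delta>: "0 < (\<delta> :: real)"
    and x: "\<And>n P. 1 \<le> n \<Longrightarrow> real (x n) \<le> real n - (real n * (1 - 1 / real m ^ P) - real m * real P) / (real m - 1)"
  shows "\<forall>\<^sub>F n in sequentially. real (x n) / real n \<le> 1 - 1 / (real m - 1) + \<delta>"
proof -
  have "(\<lambda>P. (1 / real m) ^ P) \<longlonglongrightarrow> 0" using m by (intro LIMSEQ_realpow_zero) auto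
  then have "\<forall>\<^sub>F P in sequentially. (1 / real m) ^ P < \<delta> / 2" using \<delta> by (intro order_tendstoD(2)) auto
  then obtain P where P: "(1 / real m) ^ P < \<delta> / 2" using eventually_happens' sequentially_bot by blast
  have "(\<lambda>n. real m * real P / real n) \<longlonglongrightarrow> 0" by (intro lim_const_over_n)
  then have "\<forall>\<^sub>F n in sequentially. real m * real P / real n < \<delta> / 2" using \<delta> by (intro order_tendstoD(2)) auto
  then show ?thesis using eventually_ge_at_top[of 1]
  proof eventually_elim
    case (elim n)
    have m1: "1 \<le> real m - 1" using m by simp
    have "real (x n) / real n \<le> (real n - (real n * (1 - 1 / real m ^ P) - real m * real P) / (real m - 1)) / real n"
      using x[of n P] elim by (intro divide_right_mono) auto
    also have "\<dots> = 1 - 1 / (real m - 1) + ((1 / real m) ^ P + real m * real P / real n) / (real m - 1)"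
    proof -
      have "(x - (x * (1 - q) - k) / d) / x = 1 - 1 / d + (q + k / x) / d" if "d \<noteq> 0" "x \<noteq> 0" for x q k d :: real
        using that by (simp add: field_simps)
      then show ?thesis using elim m1 by (simp add: power_one_over)
    qed
    also have "((1 / real m) ^ P + real m * real P / real n) / (real m - 1) \<le> ((1 / real m) ^ P + real m * real P / real n) / 1"
      using m1 by (intro divide_left_mono) auto
    also have "\<dots> \<le> \<delta>" using P elim(1) by (simp only: div_by_1)
    finally show ?case by simp
  qed
qed

lemma tendsto_if_eventually_bounds:
  fixes x :: "nat \<Rightarrow> real"
  assumes "\<And>\<delta>. 0 < \<delta> \<Longrightarrow> \<forall>\<^sub>F n in sequentially. L - \<delta> \<le> x n"
    "\<And>\<delta>. 0 < \<delta> \<Longrightarrow> \<forall>\<^sub>F n in sequentially. x n \<le> L + \<delta>"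
  shows "x \<longlonglongrightarrow> L"
proof (rule tendstoI)
  fix e :: real assume e: "0 < e"
  have "\<forall>\<^sub>F n in sequentially. L - e / 2 \<le> x n" "\<forall>\<^sub>F n in sequentially. x n \<le> L + e / 2"
    using assms[of "e / 2"] e by auto
  then show "\<forall>\<^sub>F n in sequentially. dist (x n) L < e"
    by eventually_elim (use e in \<open>auto simp: dist_real_def\<close>)
qed

text \<open>Averaging: the out-degrees add up to at least \<open>n * (n - 1) / 2\<close>.\<close>

lemma exists_large_out_degree:
  assumes T: "tournament T" and n: "card (pverts T) = n" "1 \<le> n"
  shows "\<exists>r\<in>pverts T. n \<le> 2 * card {u. (r, u) \<in> parcs T} + 1"
proof (rule ccontr)
  interpret T: pair_digraph T using T by (simp add: tournament_def oriented_graph_def)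
  assume neg: "\<not> ?thesis"
  then have small: "2 * card {u. (r, u) \<in> parcs T} \<le> n - 2" if "r \<in> pverts T" for r using that by fastforce
  have fin: "finite (pverts T)" "finite (parcs T)" using T.pair_finite_verts T.pair_finite_arcs by auto
  have "pverts T \<times> pverts T \<subseteq> parcs T \<union> (parcs T)\<inverse> \<union> Id_on (pverts T)"
    using T by (auto simp: tournament_def)
  then have "card (pverts T \<times> pverts T) \<le> card (parcs T \<union> (parcs T)\<inverse> \<union> Id_on (pverts T))"
    using fin by (intro card_mono) (auto simp: Id_on_def)
  also have "\<dots> \<le> card (parcs T) + card ((parcs T)\<inverse>) + card (Id_on (pverts T))"
    using card_Un_le[of "parcs T \<union> (parcs T)\<inverse>"] card_Un_le[of "parcs T" "(parcs T)\<inverse>"] by (meson add_mono le_refl le_trans)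
  also have "card (Id_on (pverts T)) = n"
  proof -
    have "Id_on (pverts T) = (\<lambda>x. (x, x)) ` pverts T" by (auto simp: Id_on_def)
    then show ?thesis using n by (simp add: card_image inj_on_def)
  qed
  finally have 1: "n * n \<le> 2 * card (parcs T) + n" using n by (simp add: card_cartesian_product)
  have "parcs T = (SIGMA r:pverts T. {u. (r, u) \<in> parcs T})" by (auto dest: T.in_arcsD1)
  moreover have "finite {u. (r, u) \<in> parcs T}" for r
    using fin(1) by (rule finite_subset[rotated]) (auto dest: T.in_arcsD2)
  ultimately have "card (parcs T) = (\<Sum>r\<in>pverts T. card {u. (r, u) \<in> parcs T})"
    using fin by (metis (no_types, lifting) card_SigmaI sum.cong)
  then have "2 * card (parcs T) = (\<Sum>r\<in>pverts T. 2 * card {u. (r, u) \<in> parcs T})" by (simp add: sum_distrib_left)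
  also have "\<dots> \<le> (\<Sum>r\<in>pverts T. n - 2)" using small by (intro sum_mono)
  also have "\<dots> = n * (n - 2)" using n by simp
  finally have "n * n \<le> n * (n - 2) + n" using 1 by linarith
  also have "\<dots> = n * (n - 2 + 1)" by (simp only: distrib_left mult_1_right)
  finally have "n * n \<le> n * (n - 2 + 1)" .
  then have "n \<le> n - 2 + 1" using n(2) by (simp only: mult_le_cancel1)
  \<comment> \<open>The subtraction \<open>n - 2\<close> above is truncated; the negated claim
    itself excludes smaller \<open>n\<close>.\<close>
  moreover have "2 \<le> n"
  proof -
    obtain r where "r \<in> pverts T" using n by fastforce
    then have "2 * card {u. (r, u) \<in> parcs T} + 1 < n" using neg by fastforce
    then show ?thesis by simp
  qed
  ultimately show False by simp
qed

text \<open>The star of a vertex and its out-neighbours is path-monochromatic whatever the colours,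
  because its directed paths have at most one arc.\<close>

lemma f_all_ge:
  assumes "1 \<le> k" "1 \<le> n"
  shows "real n / 2 \<le> real (f_all k n)"
proof -
  have "(n + 1) div 2 \<le> f_all k n"
  proof (rule f_all_geI[OF assms(2,1)])
    fix T :: "nat pair_pre_digraph" and c
    assume T: "tournament T" "card (pverts T) = n"
    interpret T: pair_digraph T using T by (simp add: tournament_def oriented_graph_def)
    obtain r where r: "r \<in> pverts T" "n \<le> 2 * card {u. (r, u) \<in> parcs T} + 1"
      using exists_large_out_degree[OF T assms(2)] by blast
    obtain A where A: "pm_arborescence T c A r \<and> arb_depth A \<le> 1 \<and>
      pverts A = {x. \<exists>i. \<exists>j\<le>1. (r, x) \<in> (colour_class T c i \<inter> insert r {} \<times> UNIV) ^^ j}"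
      using exists_pm_arborescence[OF T(1) r(1), where I = "\<lambda>_. {}" and c = c and l = 1] by blast
    have "insert r {u. (r, u) \<in> parcs T} \<subseteq> pverts A"
    proof
      fix x assume "x \<in> insert r {u. (r, u) \<in> parcs T}"
      then consider "x = r" | "(r, x) \<in> parcs T" by auto
      then show "x \<in> pverts A"
      proof cases
        case 1
        then have "(r, x) \<in> (colour_class T c 0 \<inter> insert r {} \<times> UNIV) ^^ 0" by simp
        then show ?thesis using A by blast
      next
        case 2
        then have "(r, x) \<in> (colour_class T c (c (r, x)) \<inter> insert r {} \<times> UNIV) ^^ 1"
          by (simp add: colour_class_def)
        then show ?thesis using A by blast
      qed
    qed
    moreover have "finite (pverts A)"
    proof (rule finite_subset)
      have "pm_arborescence T c A r" using A by blast
      then show "pverts A \<subseteq> pverts T" by (simp add: pm_arborescence_def subgraph_def)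
    qed (rule T.pair_finite_verts)
    ultimately have "card (insert r {u. (r, u) \<in> parcs T}) \<le> card (pverts A)" by (rule card_mono[rotated])
    moreover have "card (insert r {u. (r, u) \<in> parcs T}) = Suc (card {u. (r, u) \<in> parcs T})"
      using T.pair_no_loops[of "(r, r)"] T.pair_finite_verts
      by (subst card_insert_disjoint) (auto intro: finite_subset dest: T.in_arcsD2)
    ultimately have "(n + 1) div 2 \<le> card (pverts A)" using r(2) by linarith
    then show "\<exists>A r. pm_arborescence T c A r \<and> (n + 1) div 2 \<le> card (pverts A)" using A by blast
  qed
  then show ?thesis by linarith
qed

lemma f_all_limit:
  assumes "3 \<le> k"
  shows "(\<lambda>n. real (f_all k n) / real n) \<longlonglongrightarrow> 1 / 2"
proof (rule tendsto_if_eventually_bounds)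
  fix \<delta> :: real assume \<delta>: "0 < \<delta>"
  show "\<forall>\<^sub>F n in sequentially. 1 / 2 - \<delta> \<le> real (f_all k n) / real n"
    using eventually_ge_at_top[of 1]
  proof eventually_elim
    case (elim n)
    then have "1 / 2 \<le> real (f_all k n) / real n" using f_all_ge[of k n] assms by (simp add: pos_le_divide_eq)
    then show ?case using \<delta> by linarith
  qed
  show "\<forall>\<^sub>F n in sequentially. real (f_all k n) / real n \<le> 1 / 2 + \<delta>"
    using eventually_ratio_le[of 3 \<delta> "f_all k"] f_all_le[OF assms] \<delta> by simp
qed

section \<open>Depth two: lower bound and existence of the limit\<close>

text \<open>If each vertex missed at least the fraction \<open>3 - sqrt 7\<close>, Shen's theorem
  would give a directed triangle of missed pairs; \<open>sqrt 7 - 2\<close> is the complementary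
  fraction.\<close>

lemma f_depth_2_2_ge:
  assumes n: "1 \<le> n"
  shows "(sqrt 7 - 2) * real n \<le> real (f_depth 2 2 n)"
proof -
  have "nat \<lceil>(sqrt 7 - 2) * real n\<rceil> \<le> f_depth 2 2 n"
  proof (rule f_depth_geI[OF n], simp)
    fix T :: "nat pair_pre_digraph" and c
    assume T: "tournament T" "card (pverts T) = n" and c: "edge_coloring 2 T c"
    interpret T: pair_digraph T using T by (simp add: tournament_def oriented_graph_def)
    have asym: "(v, u) \<notin> parcs T" if "(u, v) \<in> parcs T" for u v
      using T(1) that by (auto simp: tournament_def oriented_graph_def)
    have tot: "(u, v) \<in> parcs T \<or> (v, u) \<in> parcs T" if "u \<in> pverts T" "v \<in> pverts T" "u \<noteq> v" for u v
      using T(1) that by (auto simp: tournament_def)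
    define R where "R r = {x. \<exists>i. \<exists>j\<le>2. (r, x) \<in> colour_class T c i ^^ j}" for r
    have R2: "x \<in> R r" if "(r, y) \<in> parcs T" "(y, x) \<in> parcs T" "c (r, y) = c (y, x)" for r x y
    proof -
      have "(r, x) \<in> colour_class T c (c (r, y)) ^^ Suc (Suc 0)" using that by (auto simp: colour_class_def)
      then show ?thesis unfolding R_def by (intro CollectI exI[of _ "c (r, y)"] exI[of _ "Suc (Suc 0)"]) simp
    qed
    have R1: "x \<in> R r" if "(r, x) \<in> parcs T" for r x
    proof -
      have "(r, x) \<in> colour_class T c (c (r, x)) ^^ 1" using that by (auto simp: colour_class_def)
      then show ?thesis unfolding R_def by (intro CollectI exI[of _ "c (r, x)"] exI[of _ 1]) simp
    qed
    have R0: "r \<in> R r" for r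
      unfolding R_def by (intro CollectI exI[of _ 0]) simp
    show "\<exists>A r. (pm_arborescence T c A r \<and> arb_depth A \<le> 2) \<and> nat \<lceil>(sqrt 7 - 2) * real n\<rceil> \<le> card (pverts A)"
    proof (rule ccontr)
      assume no: "\<not> ?thesis"
      have small: "real (card (R r)) \<le> (sqrt 7 - 2) * real n" if r: "r \<in> pverts T" for r
      proof -
        obtain A where "pm_arborescence T c A r" "arb_depth A \<le> 2" "pverts A = R r"
          using exists_pm_arborescence_depth2[OF T(1) r, of c] unfolding R_def by blast
        with no have "card (R r) < nat \<lceil>(sqrt 7 - 2) * real n\<rceil>" by (metis not_less)
        then show ?thesis by (simp add: zless_nat_eq_int_zless less_ceiling_iff)
      qed
      define E where "E = {(u, v). u \<in> pverts T \<and> v \<in> pverts T \<and> v \<notin> R u}"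
      have rev: "(v, u) \<in> parcs T" if "(u, v) \<in> E" for u v
        using that R0 R1 tot unfolding E_def by blast
      have "\<exists>u v w. (u, v) \<in> E \<and> (v, w) \<in> E \<and> (w, u) \<in> E"
      proof (rule shen_directed_triangle)
        show "(v, u) \<notin> E" if "(u, v) \<in> E" for u v using rev asym that by blast
        show "(3 - sqrt 7) * real (card (pverts T)) \<le> real (card (E `` {u}))" if u: "u \<in> pverts T" for u
        proof -
          have "E `` {u} = pverts T - R u" using u by (auto simp: E_def)
          moreover have "card (pverts T) - card (R u) \<le> card (pverts T - R u)"
          proof (rule diff_card_le_card_Diff)
            show "finite (R u)"
              using finite_reach[OF T(1) u, of c] unfolding R_def by (rule finite_subset[rotated]) blast
          qed
          ultimately have "n \<le> card (E `` {u}) + card (R u)" using T(2) by simp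
          then have "real n \<le> real (card (E `` {u}) + card (R u))" by (simp only: of_nat_le_iff)
          then show ?thesis using small[OF u] T(2) by (simp add: algebra_simps)
        qed
      qed (use T.pair_finite_verts T(2) n in \<open>auto simp: E_def\<close>)
      then obtain u v w where E: "(u, v) \<in> E" "(v, w) \<in> E" "(w, u) \<in> E" by blast
      then have arcs: "(v, u) \<in> parcs T" "(w, v) \<in> parcs T" "(u, w) \<in> parcs T" using rev by blast+
      then have "c (v, u) < 2" "c (w, v) < 2" "c (u, w) < 2" using c by (auto simp: edge_coloring_def)
      \<comment> \<open>Two of the three arcs share a colour. They are consecutive on the reversed
        triangle, so they join a missed pair by a walk of length 2.\<close>
      then consider "c (u, w) = c (w, v)" | "c (w, v) = c (v, u)" | "c (v, u) = c (u, w)" by linarith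
      then show False
        using R2 arcs E unfolding E_def by cases blast+
    qed
  qed
  then have "real (nat \<lceil>(sqrt 7 - 2) * real n\<rceil>) \<le> real (f_depth 2 2 n)" by simp
  then show ?thesis using real_nat_ceiling_ge[of "(sqrt 7 - 2) * real n"] by linarith
qed

text \<open>As in Fekete's lemma the limit is the infimum: \<open>g N / N\<close> exceeds
  \<open>g n / n\<close> by at most \<open>g n / N\<close>, which vanishes as \<open>N\<close>
  grows.\<close>

lemma convergent_ratio_if_blow_up:
  fixes g :: "nat \<Rightarrow> nat"
  assumes g: "\<And>n N. 1 \<le> n \<Longrightarrow> 1 \<le> N \<Longrightarrow> g N \<le> (N div n + 1) * g n"
  shows "\<exists>L. (\<lambda>n. real (g n) / real n) \<longlonglongrightarrow> L"
proof -
  define L where "L = (INF n\<in>{1..}. real (g n) / real n)"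
  have bdd: "bdd_below ((\<lambda>n. real (g n) / real n) ` {1..})" by (rule bdd_belowI[of _ 0]) auto
  have "(\<lambda>n. real (g n) / real n) \<longlonglongrightarrow> L"
  proof (rule tendsto_if_eventually_bounds)
    fix \<delta> :: real assume \<delta>: "0 < \<delta>"
    have lower: "L \<le> real (g n) / real n" if "1 \<le> n" for n
      unfolding L_def using bdd that by (intro cINF_lower) auto
    show "\<forall>\<^sub>F n in sequentially. L - \<delta> \<le> real (g n) / real n"
      using eventually_ge_at_top[of 1]
    proof eventually_elim
      case (elim n)
      show ?case using lower[OF elim] \<delta> by linarith
    qed
    have "L < L + \<delta> / 2" using \<delta> by simp
    then obtain n where n: "1 \<le> n" "real (g n) / real n < L + \<delta> / 2"
      unfolding L_def using bdd by (subst (asm) cINF_less_iff) auto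
    have "(\<lambda>N. real (g n) / real N) \<longlonglongrightarrow> 0" by (intro lim_const_over_n)
    then have "\<forall>\<^sub>F N in sequentially. real (g n) / real N < \<delta> / 2" using \<delta> by (intro order_tendstoD(2)) auto
    then show "\<forall>\<^sub>F N in sequentially. real (g N) / real N \<le> L + \<delta>"
      using eventually_ge_at_top[of 1]
    proof eventually_elim
      case (elim N)
      have "real (g N) \<le> (real (N div n) + 1) * real (g n)"
        using g[OF n(1) elim(2)] by (metis of_nat_1 of_nat_add of_nat_le_iff of_nat_mult)
      also have "\<dots> \<le> (real N / real n + 1) * real (g n)"
        by (intro mult_right_mono add_right_mono of_nat_div_le_of_nat) auto
      finally have "real (g N) / real N \<le> (real N / real n + 1) * real (g n) / real N"
        by (intro divide_right_mono) auto
      also have "\<dots> = real (g n) / real n + real (g n) / real N" using elim n by (simp add: field_simps)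
      finally show ?case using n(2) elim(1) by linarith
    qed
  qed
  then show ?thesis by blast
qed

lemma f_depth_2_2_limit: "\<exists>L \<in> {sqrt 7 - 2 .. 2 / 3}. (\<lambda>n. real (f_depth 2 2 n) / real n) \<longlonglongrightarrow> L"
proof -
  obtain L where L: "(\<lambda>n. real (f_depth 2 2 n) / real n) \<longlonglongrightarrow> L"
    using convergent_ratio_if_blow_up[of "f_depth 2 2"] f_depth_2_blow_up[of _ _ 2] by auto
  have "\<forall>\<^sub>F n in sequentially. sqrt 7 - 2 \<le> real (f_depth 2 2 n) / real n"
    using eventually_ge_at_top[of 1]
  proof eventually_elim
    case (elim n)
    then show ?case using f_depth_2_2_ge[of n] by (simp add: pos_le_divide_eq)
  qed
  then have "sqrt 7 - 2 \<le> L" using L by (intro tendsto_lowerbound[OF L]) auto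
  moreover have "L \<le> 2 / 3"
  proof (rule field_le_epsilon)
    fix \<delta> :: real assume "0 < \<delta>"
    then have "\<forall>\<^sub>F n in sequentially. real (f_depth 2 2 n) / real n \<le> 2 / 3 + \<delta>"
      using eventually_ratio_le[of 4 \<delta> "f_depth 2 2"] f_depth_2_le[of 2] by simp
    then show "L \<le> 2 / 3 + \<delta>" by (intro tendsto_upperbound[OF L]) auto
  qed
  ultimately show ?thesis using L by auto
qed

section \<open>Lower bounds from strongly linked pairs\<close>

text \<open>Stop the walk at its first visit to \<open>x\<close>.\<close>

lemma rtrancl_avoid_target_source:
  assumes "(v, x) \<in> (E \<inter> S \<times> UNIV)\<^sup>*"
  shows "(v, x) \<in> (E \<inter> (S - {x}) \<times> UNIV)\<^sup>*"
  using assms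
proof (induction rule: converse_rtrancl_induct)
  case (step y z)
  show ?case
  proof (cases "y = x")
    case False
    with step have "(y, z) \<in> E \<inter> (S - {x}) \<times> UNIV" by auto
    then show ?thesis using step.IH by (rule converse_rtrancl_into_rtrancl)
  qed simp
qed simp

text \<open>A link is recorded not as a path but as a set \<open>P\<close> containing its inner
  vertices. Tails are confined to \<open>v\<close> and \<open>P\<close>, so fewer than
  \<open>l\<close> elements in \<open>P\<close> guarantee a walk of at most \<open>l\<close>
  arcs.\<close>

definition links ::
    "'a pair_pre_digraph \<Rightarrow> ('a \<times> 'a \<Rightarrow> nat) \<Rightarrow> nat \<Rightarrow> nat \<Rightarrow> 'a \<Rightarrow> 'a \<Rightarrow> 'a set set" where
  "links T c l i v x = {P. P \<subseteq> pverts T - {v, x} \<and> card P < l \<and>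
     (v, x) \<in> (colour_class T c i \<inter> insert v P \<times> UNIV)\<^sup>*}"

text \<open>Out-neighbours of \<open>v\<close> are set aside: the arc itself reaches them, and a
  link without inner vertices could not be hit.\<close>

definition weakly_linked ::
    "'a pair_pre_digraph \<Rightarrow> ('a \<times> 'a \<Rightarrow> nat) \<Rightarrow> nat \<Rightarrow> nat \<Rightarrow> 'a \<Rightarrow> 'a set" where
  "weakly_linked T c l M v = {x \<in> pverts T. x \<noteq> v \<and> (v, x) \<notin> parcs T \<and>
     (\<forall>i<2. \<nexists>F. F \<subseteq> links T c l i v x \<and> disjoint F \<and> card F = M)}"

lemma weakly_linked_hitting_set:
  assumes T: "tournament T" and x: "x \<in> weakly_linked T c l M v"
  shows "\<exists>H. H \<subseteq> pverts T \<and> card H \<le> 2 * (M * l) \<and> (\<forall>i<2. \<forall>P\<in>links T c l i v x. P \<inter> H \<noteq> {})"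
proof -
  interpret T: pair_digraph T using T by (simp add: tournament_def oriented_graph_def)
  have "\<exists>H. finite H \<and> card H \<le> M * l \<and> H \<subseteq> pverts T \<and> (\<forall>P\<in>links T c l i v x. P \<inter> H \<noteq> {})" if i: "i < 2" for i
  proof -
    have "links T c l i v x \<subseteq> Pow (pverts T)" by (auto simp: links_def)
    then have fin: "finite (links T c l i v x)" using T.pair_finite_verts finite_subset by blast
    have P: "finite P \<and> P \<noteq> {} \<and> card P \<le> l" if P: "P \<in> links T c l i v x" for P
    proof (intro conjI)
      have "P \<subseteq> pverts T" using P by (auto simp: links_def)
      then show "finite P" using T.pair_finite_verts finite_subset by blast
      show "card P \<le> l" using P by (simp add: links_def)
      \<comment> \<open>An empty link would amount to an arc from \<open>v\<close> to
        \<open>x\<close>, and \<open>x\<close> is no out-neighbour of \<open>v\<close>.\<close>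
      show "P \<noteq> {}"
      proof
        assume "P = {}"
        let ?E = "colour_class T c i \<inter> {v} \<times> UNIV"
        have "(v, x) \<in> ?E\<^sup>*" "v \<noteq> x" using P x \<open>P = {}\<close> by (auto simp: links_def weakly_linked_def)
        then obtain y where y: "(v, y) \<in> ?E" "(y, x) \<in> (?E - {v} \<times> UNIV)\<^sup>*"
          using rtrancl_leave_source by metis
        have "?E - {v} \<times> UNIV = {}" by auto
        with y(2) have "y = x" by simp
        with y(1) x show False by (auto simp: colour_class_def weakly_linked_def)
      qed
    qed
    have "\<nexists>F. F \<subseteq> links T c l i v x \<and> disjoint F \<and> card F = M"
      using x i by (simp add: weakly_linked_def)
    then obtain H where H: "finite H" "card H \<le> M * l" "H \<subseteq> \<Union>(links T c l i v x)"
      "\<forall>P\<in>links T c l i v x. P \<inter> H \<noteq> {}"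
      using disjoint_subfamily_or_hitting_set[OF fin P, of M] by blast
    have "\<Union>(links T c l i v x) \<subseteq> pverts T" by (auto simp: links_def)
    with H show ?thesis by blast
  qed
  from this[of 0] this[of 1] obtain H0 H1 where
    H0: "card H0 \<le> M * l" "H0 \<subseteq> pverts T" "\<forall>P\<in>links T c l 0 v x. P \<inter> H0 \<noteq> {}" and
    H1: "card H1 \<le> M * l" "H1 \<subseteq> pverts T" "\<forall>P\<in>links T c l 1 v x. P \<inter> H1 \<noteq> {}" by auto
  have "card (H0 \<union> H1) \<le> 2 * (M * l)" using card_Un_le[of H0 H1] H0(1) H1(1) by linarith
  moreover have "\<forall>i<2. \<forall>P\<in>links T c l i v x. P \<inter> (H0 \<union> H1) \<noteq> {}"
  proof (intro allI impI ballI)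
    fix i :: nat and P assume i: "i < 2" and P: "P \<in> links T c l i v x"
    from i have "i = 0 \<or> i = 1" by linarith
    then show "P \<inter> (H0 \<union> H1) \<noteq> {}"
    proof
      assume "i = 0"
      with P H0(3) have "P \<inter> H0 \<noteq> {}" by simp
      then show ?thesis by blast
    next
      assume "i = 1"
      with P H1(3) have "P \<inter> H1 \<noteq> {}" by simp
      then show ?thesis by blast
    qed
  qed
  ultimately show ?thesis using H0(2) H1(2) by (intro exI[of _ "H0 \<union> H1"]) simp
qed

text \<open>A random set of vertices, reserved for the inner vertices of the first colour, keeps some
  link to most of the vertices having many disjoint links.\<close>

lemma pm_arborescence_covers_strongly_linked:
  assumes T: "tournament T" and v: "v \<in> pverts T" and l: "1 \<le> l"
  shows "\<exists>A. pm_arborescence T c A v \<and> arb_depth A \<le> l \<and>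
    real (card (pverts T - weakly_linked T c l M v))
      \<le> real (card (pverts A)) + real (card (pverts T)) * (1 - 1 / 2 ^ l) ^ M"
proof -
  interpret T: pair_digraph T using T by (simp add: tournament_def oriented_graph_def)
  note fin = T.pair_finite_verts
  define X where "X = {x \<in> pverts T - weakly_linked T c l M v. x \<noteq> v \<and> (v, x) \<notin> parcs T}"
  have "\<exists>i F. i < 2 \<and> F \<subseteq> links T c l i v x \<and> disjoint F \<and> card F = M" if "x \<in> X" for x
    using that unfolding X_def weakly_linked_def by auto
  then obtain i F where iF: "\<And>x. x \<in> X \<Longrightarrow> i x < (2 :: nat) \<and> F x \<subseteq> links T c l (i x) v x \<and> disjoint (F x) \<and> card (F x) = M"
    by metis
  have FX: "disjoint (F x) \<and> card (F x) = M \<and> (\<forall>P\<in>F x. P \<subseteq> pverts T \<and> card P \<le> l)" if "x \<in> X" for x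
    using iF[OF that] by (fastforce simp: links_def)
  have finX: "finite X" using fin by (simp add: X_def)
  have "\<exists>S\<subseteq>pverts T. real (card {x \<in> X. \<forall>P\<in>F x. \<not> P \<subseteq> (if i x = 0 then S else pverts T - S)})
      \<le> real (card X) * (1 - 1 / 2 ^ l) ^ M"
    using fin finX FX by (rule exists_splitting_set)
  then obtain S where S: "S \<subseteq> pverts T"
    "real (card {x \<in> X. \<forall>P\<in>F x. \<not> P \<subseteq> (if i x = 0 then S else pverts T - S)})
      \<le> real (card X) * (1 - 1 / 2 ^ l) ^ M"
    by (elim exE conjE)
  define bad where "bad = {x \<in> X. \<forall>P\<in>F x. \<not> P \<subseteq> (if i x = 0 then S else pverts T - S)}"
  define I where "I j = (if j = 0 then S else if j = 1 then pverts T - S else {})" for j :: nat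
  have dj: "I j \<inter> I j' = {}" if "j \<noteq> j'" for j j' using that by (auto simp: I_def)
  have "\<exists>A. pm_arborescence T c A v \<and> arb_depth A \<le> l \<and>
      pverts A = {x. \<exists>i. \<exists>j\<le>l. (v, x) \<in> (colour_class T c i \<inter> insert v (I i) \<times> UNIV) ^^ j}"
    using T v dj by (rule exists_pm_arborescence)
  then obtain A where A: "pm_arborescence T c A v" "arb_depth A \<le> l"
    and pA: "pverts A = {x. \<exists>i. \<exists>j\<le>l. (v, x) \<in> (colour_class T c i \<inter> insert v (I i) \<times> UNIV) ^^ j}"
    by (elim exE conjE)
  have sub: "pverts T - weakly_linked T c l M v \<subseteq> pverts A \<union> bad"
  proof
    fix x assume x: "x \<in> pverts T - weakly_linked T c l M v"
    consider "x = v" | "(v, x) \<in> parcs T" | "x \<in> bad" | "x \<in> X" "x \<notin> bad" using x by (auto simp: X_def)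
    then show "x \<in> pverts A \<union> bad"
    proof cases
      case 1
      then show ?thesis unfolding pA by (intro UnI1 CollectI exI[of _ 0]) simp
    next
      case 2
      then have "(v, x) \<in> (colour_class T c (c (v, x)) \<inter> insert v (I (c (v, x))) \<times> UNIV) ^^ 1"
        by (simp add: colour_class_def)
      then show ?thesis unfolding pA using l by blast
    next
      case 4
      then obtain P where P: "P \<in> F x" "P \<subseteq> (if i x = 0 then S else pverts T - S)" by (auto simp: bad_def)
      have "i x < 2" and link: "P \<in> links T c l (i x) v x" using iF[OF 4(1)] P(1) by auto
      then have PI: "P \<subseteq> I (i x)" using P(2) by (auto simp: I_def split: if_splits)
      have finP: "finite P" using link fin by (auto simp: links_def intro: finite_subset)
      have "(v, x) \<in> (colour_class T c (i x) \<inter> insert v P \<times> UNIV)\<^sup>*" using link by (simp add: links_def)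
      then obtain j where j: "j \<le> card (insert v P)" "(v, x) \<in> (colour_class T c (i x) \<inter> insert v P \<times> UNIV) ^^ j"
        using rtrancl_imp_relpow_card_sources[of "insert v P"] finP by blast
      \<comment> \<open>The tails on the walk are \<open>v\<close> and the at most
        \<open>l - 1\<close> elements of \<open>P\<close>.\<close>
      have "j \<le> l" using j(1) link finP card_insert_le_m1[of "Suc l" P v]
        by (auto simp: links_def card_insert_if split: if_splits)
      moreover have "(v, x) \<in> (colour_class T c (i x) \<inter> insert v (I (i x)) \<times> UNIV) ^^ j"
        using relpow_subset_mono[of "colour_class T c (i x) \<inter> insert v P \<times> UNIV"
            "colour_class T c (i x) \<inter> insert v (I (i x)) \<times> UNIV" j] PI j(2) by blast
      ultimately show ?thesis unfolding pA by blast
    qed simp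
  qed
  have finA: "finite (pverts A)"
  proof (rule finite_subset)
    show "pverts A \<subseteq> pverts T" using A(1) by (simp add: pm_arborescence_def subgraph_def)
  qed (rule fin)
  have "card (pverts T - weakly_linked T c l M v) \<le> card (pverts A \<union> bad)"
    using sub finA finX by (intro card_mono) (auto simp: bad_def)
  also have "\<dots> \<le> card (pverts A) + card bad" by (rule card_Un_le)
  finally have "real (card (pverts T - weakly_linked T c l M v)) \<le> real (card (pverts A)) + real (card bad)"
    by linarith
  moreover have "real (card X) * (1 - 1 / 2 ^ l) ^ M \<le> real (card (pverts T)) * (1 - 1 / 2 ^ l) ^ M"
    using fin by (intro mult_right_mono) (auto simp: X_def intro!: card_mono)
  moreover have "real (card bad) \<le> real (card X) * (1 - 1 / 2 ^ l) ^ M" using S(2) by (simp add: bad_def)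
  ultimately have "real (card (pverts T - weakly_linked T c l M v))
      \<le> real (card (pverts A)) + real (card (pverts T)) * (1 - 1 / 2 ^ l) ^ M" by linarith
  with A show ?thesis by blast
qed

text \<open>A short cycle of weakly linked pairs missing all the hitting sets contradicts the theorem of
  Sands, Sauer and Woodrow on the vertices of the cycle.\<close>

lemma no_short_cycle_of_weak_links:
  fixes \<phi> :: "nat \<Rightarrow> 'a"
  assumes T: "tournament T" and c: "edge_coloring 2 T c"
    and cyc: "pre_digraph.cycle (with_proj G) p" "length p \<le> l + 1"
    and G: "\<And>i j. (i, j) \<in> parcs G \<Longrightarrow> i < s \<and> j < s \<and> i \<noteq> j \<and> \<phi> j \<in> weakly_linked T c l M (\<phi> i)"
    and \<phi>: "\<And>i. i < s \<Longrightarrow> \<phi> i \<in> pverts T"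
    and H: "\<And>v x. x \<in> weakly_linked T c l M v \<Longrightarrow> \<forall>i<2. \<forall>P\<in>links T c l i v x. P \<inter> H v x \<noteq> {}"
      "\<And>v x. v \<in> pverts T \<Longrightarrow> v \<in> H v x"
    and free: "\<And>i j k. i < s \<Longrightarrow> j < s \<Longrightarrow> k < s \<Longrightarrow> i \<noteq> j \<Longrightarrow> k \<noteq> i \<Longrightarrow> k \<noteq> j \<Longrightarrow> \<phi> k \<notin> H (\<phi> i) (\<phi> j)"
  shows False
proof -
  note p = cycle_with_proj_nth[OF cyc(1)]
  define Z where "Z = set (map snd p)"
  have cZ: "card Z = length p" unfolding Z_def using distinct_card[OF p(2)] by simp
  have succ: "\<exists>y\<in>Z. (x, y) \<in> parcs G" if xZ: "x \<in> Z" for x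
  proof -
    obtain e where e: "e \<in> set p" "x = snd e" using xZ unfolding Z_def by auto
    from e(1) obtain i where "i < length p" "p ! i = e" unfolding in_set_conv_nth by blast
    with e(2) have i: "i < length p" "x = snd (p ! i)" by auto
    let ?j = "Suc i mod length p"
    have j: "?j < length p" using p(1) by simp
    then have "p ! ?j \<in> set p" by simp
    moreover have "p ! ?j = (x, snd (p ! ?j))" using p(4)[OF i(1)] i(2) by (simp add: prod_eq_iff)
    ultimately show ?thesis using p(3) unfolding Z_def by (metis in_set_zipE list.set_map rev_image_eqI subsetD snd_conv)
  qed
  have Zs: "x < s" if "x \<in> Z" for x using succ[OF that] G by blast
  \<comment> \<open>This is what \<open>v \<in> H v x\<close> is for: a repetition of
    \<open>\<phi> x\<close> at another index \<open>k\<close> lies in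
    \<open>H (\<phi> x) (\<phi> y)\<close>, which the sample avoids; and if \<open>k\<close> is the
    successor \<open>y\<close> itself, \<open>\<phi> y\<close> would be weakly linked to
    itself.\<close>
  have inj: "inj_on \<phi> Z"
  proof (rule inj_onI, rule ccontr)
    fix x k assume xk: "x \<in> Z" "k \<in> Z" "\<phi> x = \<phi> k" "x \<noteq> k"
    obtain y where y: "y \<in> Z" "(x, y) \<in> parcs G" using succ[OF xk(1)] by blast
    show False
    proof (cases "y = k")
      case True
      then show ?thesis using G[OF y(2)] xk(3) by (simp add: weakly_linked_def)
    next
      case False
      then have "\<phi> k \<notin> H (\<phi> x) (\<phi> y)" using free[of x y k] Zs xk y G[OF y(2)] by blast
      then show False using H(2)[OF \<phi>[OF Zs[OF xk(1)]]] xk(3) by metis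
    qed
  qed
  have SV: "\<phi> ` Z \<subseteq> pverts T" using \<phi> Zs by blast
  have col: "parcs T \<subseteq> colour_class T c 0 \<union> colour_class T c 1"
  proof
    fix e assume e: "e \<in> parcs T"
    then have "c e < 2" using c by (auto simp: edge_coloring_def)
    then have "c e = 0 \<or> c e = 1" by linarith
    then show "e \<in> colour_class T c 0 \<union> colour_class T c 1" using e by (auto simp: colour_class_def)
  qed
  have "\<exists>v\<in>\<phi> ` Z. \<forall>x\<in>\<phi> ` Z. (v, x) \<in> (colour_class T c 0 \<inter> (\<phi> ` Z) \<times> (\<phi> ` Z))\<^sup>* \<or>
      (v, x) \<in> (colour_class T c 1 \<inter> (\<phi> ` Z) \<times> (\<phi> ` Z))\<^sup>*"
  proof (rule sands_sauer_woodrow)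
    show "finite (\<phi> ` Z)" "\<phi> ` Z \<noteq> {}" using p(1) by (auto simp: Z_def)
    show "(x, y) \<in> colour_class T c 0 \<union> colour_class T c 1 \<or> (y, x) \<in> colour_class T c 0 \<union> colour_class T c 1"
      if "x \<in> \<phi> ` Z" "y \<in> \<phi> ` Z" "x \<noteq> y" for x y
      using that SV col T unfolding tournament_def by blast
  qed
  then obtain x where x: "x \<in> Z" and root: "\<And>y. y \<in> Z \<Longrightarrow>
      (\<phi> x, \<phi> y) \<in> (colour_class T c 0 \<inter> (\<phi> ` Z) \<times> (\<phi> ` Z))\<^sup>* \<or>
      (\<phi> x, \<phi> y) \<in> (colour_class T c 1 \<inter> (\<phi> ` Z) \<times> (\<phi> ` Z))\<^sup>*" by blast
  obtain y where y: "y \<in> Z" "(x, y) \<in> parcs G" using succ[OF x] by blast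
  note xy = G[OF y(2)]
  obtain i where i: "i < (2 :: nat)" "(\<phi> x, \<phi> y) \<in> (colour_class T c i \<inter> (\<phi> ` Z) \<times> (\<phi> ` Z))\<^sup>*"
    using root[OF y(1)] by (metis one_less_numeral_iff pos2 semiring_norm(76))
  \<comment> \<open>The remaining vertices of the cycle serve as a link. There are at most
    \<open>(l + 1) - 2\<close> of them, which is below \<open>l\<close> as \<open>links\<close>
    demands.\<close>
  define P where "P = \<phi> ` Z - {\<phi> x, \<phi> y}"
  have ne: "\<phi> x \<noteq> \<phi> y" using inj x y xy by (auto dest: inj_onD)
  have "P \<in> links T c l i (\<phi> x) (\<phi> y)"
    unfolding links_def
  proof (intro CollectI conjI)
    show "P \<subseteq> pverts T - {\<phi> x, \<phi> y}" using SV by (auto simp: P_def)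
    have "card P = card (\<phi> ` Z) - card {\<phi> x, \<phi> y}"
      unfolding P_def using x y by (intro card_Diff_subset) auto
    moreover have "card (\<phi> ` Z) = length p" using inj cZ by (simp add: card_image)
    moreover have "card {\<phi> x, \<phi> y} \<le> card (\<phi> ` Z)" using x y by (intro card_mono) (auto simp: Z_def)
    ultimately show "card P < l" using ne cyc(2) by simp
    have "(colour_class T c i \<inter> (\<phi> ` Z) \<times> (\<phi> ` Z))\<^sup>* \<subseteq> (colour_class T c i \<inter> (\<phi> ` Z) \<times> UNIV)\<^sup>*"
      by (intro rtrancl_mono) auto
    with i(2) have "(\<phi> x, \<phi> y) \<in> (colour_class T c i \<inter> (\<phi> ` Z) \<times> UNIV)\<^sup>*" by blast
    then have "(\<phi> x, \<phi> y) \<in> (colour_class T c i \<inter> (\<phi> ` Z - {\<phi> y}) \<times> UNIV)\<^sup>*"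
      by (rule rtrancl_avoid_target_source)
    moreover have "\<phi> ` Z - {\<phi> y} = insert (\<phi> x) P" using x ne by (auto simp: P_def)
    ultimately show "(\<phi> x, \<phi> y) \<in> (colour_class T c i \<inter> insert (\<phi> x) P \<times> UNIV)\<^sup>*" by simp
  qed
  then have "P \<inter> H (\<phi> x) (\<phi> y) \<noteq> {}" using H(1)[of "\<phi> y" "\<phi> x"] xy i(1) by blast
  then obtain k where k: "k \<in> Z" "\<phi> k \<in> H (\<phi> x) (\<phi> y)" "\<phi> k \<noteq> \<phi> x" "\<phi> k \<noteq> \<phi> y" by (auto simp: P_def)
  then show False using free[of x y k] Zs x y xy by blast
qed

section \<open>Lower bounds from the Caccetta-Haggkvist conjecture\<close>

lemma exists_large_pm_arborescence:
  fixes \<delta> :: real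
  assumes CH: caccetta_haggkvist_conjecture and l: "1 \<le> l" and \<delta>: "0 < \<delta>"
  shows "\<exists>n\<^sub>0. \<forall>(T :: 'a pair_pre_digraph) c. tournament T \<longrightarrow> n\<^sub>0 \<le> card (pverts T) \<longrightarrow> edge_coloring 2 T c \<longrightarrow>
    (\<exists>A r. pm_arborescence T c A r \<and> arb_depth A \<le> l \<and>
      (real l / (real l + 1) - \<delta>) * real (card (pverts T)) \<le> real (card (pverts A)))"
proof -
  \<comment> \<open>The cap \<open>1 / 4\<close> keeps \<open>b\<close> below 1. If all
    arborescences fall short by \<open>d\<close>, and the splitting loses at most
    \<open>d / 2\<close>, each vertex has at least the fraction \<open>b\<close> of the others
    weakly linked to it. Sampling may lower this to \<open>a\<close>, which still exceeds
    \<open>1 / (l + 1)\<close>.\<close>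
  define d where "d = min \<delta> (1 / 4)"
  define b where "b = 1 / (real l + 1) + d / 2"
  define a where "a = 1 / (real l + 1) + d / 4"
  have d: "0 < d" "d \<le> \<delta>" "d \<le> 1 / 4" using \<delta> by (auto simp: d_def)
  have l2: "1 / (real l + 1) \<le> 1 / 2" using l by simp
  have "0 < 1 / (real l + 1)" by simp
  with d l2 have ab: "0 < a" "a < b" "b < 1" unfolding a_def b_def by linarith+
  have "(\<lambda>M. (1 - 1 / 2 ^ l) ^ M :: real) \<longlonglongrightarrow> 0" by (intro LIMSEQ_realpow_zero) auto
  then have "\<forall>\<^sub>F M in sequentially. (1 - 1 / 2 ^ l :: real) ^ M < d / 2" using d by (intro order_tendstoD(2)) auto
  then obtain M where M: "(1 - 1 / 2 ^ l :: real) ^ M < d / 2" using eventually_happens' sequentially_bot by blast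
  obtain s n\<^sub>0 where s: "0 < s" and "\<forall>(V :: 'a set) U H. finite V \<longrightarrow> n\<^sub>0 \<le> card V \<longrightarrow>
    (\<forall>v\<in>V. U v \<subseteq> V \<and> b * real (card V) \<le> real (card (U v))) \<longrightarrow>
    (\<forall>u\<in>V. \<forall>v\<in>V. H u v \<subseteq> V \<and> card (H u v) \<le> 2 * (M * l) + 1) \<longrightarrow>
    (\<exists>\<phi>. (\<forall>i<s. \<phi> i \<in> V \<and> a * real s \<le> real (card {j \<in> {..<s} - {i}. \<phi> j \<in> U (\<phi> i)})) \<and>
      (\<forall>i<s. \<forall>j<s. \<forall>k<s. i \<noteq> j \<longrightarrow> k \<noteq> i \<longrightarrow> k \<noteq> j \<longrightarrow> \<phi> k \<notin> H (\<phi> i) (\<phi> j)))"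
    using exists_sample[OF ab, of "2 * (M * l) + 1", where 'a = 'a] by (elim exE conjE)
  note sample = this(2)[rule_format]
  show ?thesis
  proof (rule exI[of _ n\<^sub>0], intro allI impI, rule ccontr)
    fix T :: "'a pair_pre_digraph" and c
    assume T: "tournament T" and n: "n\<^sub>0 \<le> card (pverts T)" and c: "edge_coloring 2 T c"
    assume no: "\<not> (\<exists>A r. pm_arborescence T c A r \<and> arb_depth A \<le> l \<and>
      (real l / (real l + 1) - \<delta>) * real (card (pverts T)) \<le> real (card (pverts A)))"
    interpret T: pair_digraph T using T by (simp add: tournament_def oriented_graph_def)
    note fin = T.pair_finite_verts
    define N where "N = real (card (pverts T))"
    define U where "U = weakly_linked T c l M"
    have UV: "U v \<subseteq> pverts T" for v by (auto simp: U_def weakly_linked_def)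
    have Ub: "b * N \<le> real (card (U v))" if v: "v \<in> pverts T" for v
    proof -
      obtain A where A: "pm_arborescence T c A v" "arb_depth A \<le> l"
        "real (card (pverts T - U v)) \<le> real (card (pverts A)) + N * (1 - 1 / 2 ^ l) ^ M"
        using pm_arborescence_covers_strongly_linked[OF T v l] unfolding U_def N_def by blast
      have "real (card (pverts A)) < (real l / (real l + 1) - \<delta>) * N"
        using no A(1,2) unfolding N_def by (meson not_less)
      also have "\<dots> \<le> (real l / (real l + 1) - d) * N" using d by (intro mult_right_mono) (auto simp: N_def)
      finally have "real (card (pverts A)) < (real l / (real l + 1) - d) * N" .
      moreover have "N * (1 - 1 / 2 ^ l) ^ M \<le> N * (d / 2)" using M by (intro mult_left_mono) (auto simp: N_def)
      moreover have "real (card (pverts T - U v)) = N - real (card (U v))"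
        using UV[of v] fin card_mono[of "pverts T" "U v"]
        by (simp add: N_def card_Diff_subset finite_subset of_nat_diff)
      moreover have "b * N = N - (real l / (real l + 1) - d) * N - N * (d / 2)"
      proof -
        have "1 / (real l + 1) = 1 - real l / (real l + 1)" by (simp add: field_simps)
        then have "b = 1 - real l / (real l + 1) + d / 2" by (simp add: b_def)
        moreover have "(1 - y + d / 2) * N = N - (y - d) * N - N * (d / 2)" for y :: real
          by (simp add: algebra_simps)
        ultimately show ?thesis by simp
      qed
      ultimately show ?thesis using A(3) by linarith
    qed
    define Q where "Q v x h \<longleftrightarrow> h \<subseteq> pverts T \<and> card h \<le> 2 * (M * l) \<and>
        (\<forall>i<2. \<forall>P\<in>links T c l i v x. P \<inter> h \<noteq> {})" for v x h
    define H0 where "H0 v x = (SOME h. Q v x h)" for v x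
    have H0: "Q v x (H0 v x)" if "x \<in> U v" for v x
    proof -
      have "\<exists>h. Q v x h" using weakly_linked_hitting_set[OF T that[unfolded U_def]] unfolding Q_def .
      then show ?thesis unfolding H0_def by (rule someI_ex)
    qed
    \<comment> \<open>Inserting \<open>v\<close> explains the \<open>+ 1\<close> in the size bound.
      Off \<open>U\<close>, where no hitting set is chosen, \<open>{v}\<close> keeps both the size
      bound and \<open>v \<in> H v x\<close>.\<close>
    define H where "H v x = (if x \<in> U v then insert v (H0 v x) else {v})" for v x
    have HV: "H v x \<subseteq> pverts T \<and> card (H v x) \<le> 2 * (M * l) + 1" if "v \<in> pverts T" for v x
    proof (cases "x \<in> U v")
      case True
      from H0[OF True] have "H0 v x \<subseteq> pverts T" "card (H0 v x) \<le> 2 * (M * l)" unfolding Q_def by blast+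
      moreover from this have "card (insert v (H0 v x)) \<le> 2 * (M * l) + 1"
        by (intro card_insert_le_m1) auto
      ultimately show ?thesis using that True by (simp add: H_def)
    qed (use that in \<open>simp add: H_def\<close>)
    have "\<exists>\<phi>. (\<forall>i<s. \<phi> i \<in> pverts T \<and> a * real s \<le> real (card {j \<in> {..<s} - {i}. \<phi> j \<in> U (\<phi> i)})) \<and>
      (\<forall>i<s. \<forall>j<s. \<forall>k<s. i \<noteq> j \<longrightarrow> k \<noteq> i \<longrightarrow> k \<noteq> j \<longrightarrow> \<phi> k \<notin> H (\<phi> i) (\<phi> j))"
    proof (rule sample[OF fin n])
      show "U v \<subseteq> pverts T \<and> b * real (card (pverts T)) \<le> real (card (U v))" if "v \<in> pverts T" for v
        using UV Ub[OF that] unfolding N_def by blast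
    qed (rule HV)
    then obtain \<phi> where \<phi>: "\<forall>i<s. \<phi> i \<in> pverts T \<and> a * real s \<le> real (card {j \<in> {..<s} - {i}. \<phi> j \<in> U (\<phi> i)})"
      and free: "\<forall>i<s. \<forall>j<s. \<forall>k<s. i \<noteq> j \<longrightarrow> k \<noteq> i \<longrightarrow> k \<noteq> j \<longrightarrow> \<phi> k \<notin> H (\<phi> i) (\<phi> j)"
      by (elim exE conjE)
    \<comment> \<open>The digraph lives on the indices of the sample, which also provides the
      natural numbers on which the conjecture is stated.\<close>
    define G where "G = \<lparr>pverts = {..<s}, parcs = {(i, j). i < s \<and> j < s \<and> i \<noteq> j \<and> \<phi> j \<in> U (\<phi> i)}\<rparr>"
    have "finite {(i, j). i < s \<and> j < s \<and> i \<noteq> j \<and> \<phi> j \<in> U (\<phi> i)}"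
      by (rule finite_subset[of _ "{..<s} \<times> {..<s}"]) auto
    then have G: "pair_digraph G" unfolding G_def by unfold_locales auto
    define q where "q = nat \<lceil>a * real s\<rceil>"
    have as: "0 < a * real s" using ab s by simp
    have q: "a * real s \<le> real q" "1 \<le> q" using as by (auto simp: q_def of_nat_ceiling Suc_le_eq)
    have deg: "q \<le> out_degree (with_proj G) i" if i: "i \<in> pverts G" for i
    proof -
      have i_s: "i < s" using i by (simp add: G_def)
      have "out_arcs (with_proj G) i = Pair i ` {j \<in> {..<s} - {i}. \<phi> j \<in> U (\<phi> i)}"
        using i_s by (auto simp: out_arcs_def G_def)
      then have "out_degree (with_proj G) i = card {j \<in> {..<s} - {i}. \<phi> j \<in> U (\<phi> i)}"
        by (simp add: out_degree_def card_image inj_on_def)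
      then show ?thesis using \<phi>[rule_format, OF i_s] by (simp add: q_def ceiling_le_iff nat_le_iff)
    qed
    have "pverts G \<noteq> {}" using s by (auto simp: G_def)
    then obtain p where p: "pre_digraph.cycle (with_proj G) p" "int (length p) \<le> \<lceil>real (card (pverts G)) / real q\<rceil>"
      using CH G q(2) deg unfolding caccetta_haggkvist_conjecture_def by blast
    \<comment> \<open>Because \<open>a\<close> exceeds \<open>1 / (l + 1)\<close>, the cycle length
      promised by the conjecture is at most \<open>l + 1\<close>.\<close>
    have "real s / real q \<le> real s / (a * real s)" using q as by (intro divide_left_mono) auto
    also have "\<dots> = 1 / a" using s by simp
    also have "1 / a \<le> real l + 1"
    proof -
      have "1 \<le> a * (real l + 1)" using d by (simp add: a_def distrib_right)
      then show ?thesis using ab(1) by (simp add: pos_divide_le_eq mult.commute)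
    qed
    finally have "\<lceil>real s / real q\<rceil> \<le> int (l + 1)" by (simp add: ceiling_le_iff)
    then have "length p \<le> l + 1" using p(2) by (simp add: G_def)
    then show False
    proof (rule no_short_cycle_of_weak_links[OF T c p(1)])
      show "i < s \<and> j < s \<and> i \<noteq> j \<and> \<phi> j \<in> weakly_linked T c l M (\<phi> i)" if "(i, j) \<in> parcs G" for i j
        using that by (auto simp: G_def U_def)
      show "\<phi> i \<in> pverts T" if "i < s" for i using \<phi> that by blast
      show "\<forall>i<2. \<forall>P\<in>links T c l i v x. P \<inter> H v x \<noteq> {}" if "x \<in> weakly_linked T c l M v" for v x
      proof -
        have x: "x \<in> U v" using that by (simp add: U_def)
        then have "H v x = insert v (H0 v x)" by (simp add: H_def)
        with H0[OF x] show ?thesis unfolding Q_def by blast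
      qed
      show "v \<in> H v x" for v x by (simp add: H_def)
      show "\<phi> k \<notin> H (\<phi> i) (\<phi> j)" if "i < s" "j < s" "k < s" "i \<noteq> j" "k \<noteq> i" "k \<noteq> j" for i j k
        using free that by blast
    qed
  qed
qed

lemma f_depth_2_limit:
  assumes CH: caccetta_haggkvist_conjecture and l: "1 \<le> l"
  shows "(\<lambda>n. real (f_depth 2 l n) / real n) \<longlonglongrightarrow> real l / (real l + 1)"
proof (rule tendsto_if_eventually_bounds)
  fix \<delta> :: real assume \<delta>: "0 < \<delta>"
  obtain n\<^sub>0 where n\<^sub>0: "\<And>(T :: nat pair_pre_digraph) c. tournament T \<Longrightarrow> n\<^sub>0 \<le> card (pverts T) \<Longrightarrow> edge_coloring 2 T c \<Longrightarrow>
    \<exists>A r. pm_arborescence T c A r \<and> arb_depth A \<le> l \<and>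
      (real l / (real l + 1) - \<delta>) * real (card (pverts T)) \<le> real (card (pverts A))"
    using exists_large_pm_arborescence[OF CH l \<delta>] by metis
  show "\<forall>\<^sub>F n in sequentially. real l / (real l + 1) - \<delta> \<le> real (f_depth 2 l n) / real n"
    using eventually_ge_at_top[of "max 1 n\<^sub>0"]
  proof eventually_elim
    case (elim n)
    have "nat \<lceil>(real l / (real l + 1) - \<delta>) * real n\<rceil> \<le> f_depth 2 l n"
    proof (rule f_depth_geI)
      fix T :: "nat pair_pre_digraph" and c
      assume T: "tournament T" "card (pverts T) = n" "edge_coloring 2 T c"
      then obtain A r where A: "pm_arborescence T c A r" "arb_depth A \<le> l"
        "(real l / (real l + 1) - \<delta>) * real n \<le> real (card (pverts A))"
        using n\<^sub>0[OF T(1) _ T(3)] elim by auto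
      then have "nat \<lceil>(real l / (real l + 1) - \<delta>) * real n\<rceil> \<le> card (pverts A)"
        by (simp add: ceiling_le_iff nat_le_iff)
      with A show "\<exists>A r. (pm_arborescence T c A r \<and> arb_depth A \<le> l) \<and>
          nat \<lceil>(real l / (real l + 1) - \<delta>) * real n\<rceil> \<le> card (pverts A)" by blast
    qed (use elim in auto)
    then have "real (nat \<lceil>(real l / (real l + 1) - \<delta>) * real n\<rceil>) \<le> real (f_depth 2 l n)" by simp
    then have "(real l / (real l + 1) - \<delta>) * real n \<le> real (f_depth 2 l n)"
      using real_nat_ceiling_ge order_trans by blast
    then show ?case using elim by (simp add: pos_le_divide_eq)
  qed
  have "1 - 1 / (real (l + 2) - 1) = real l / (real l + 1)" by (simp add: field_simps)
  then show "\<forall>\<^sub>F n in sequentially. real (f_depth 2 l n) / real n \<le> real l / (real l + 1) + \<delta>"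
    using eventually_ratio_le[of "l + 2" \<delta> "f_depth 2 l"] f_depth_2_le[OF l] \<delta> by simp
qed

theorem theorem1:
  shows "(\<exists>L \<in> {sqrt 7 - 2 .. 2 / 3}. (\<lambda>n. real (f_depth 2 2 n) / real n) \<longlonglongrightarrow> L) \<and>
    (caccetta_haggkvist_conjecture \<longrightarrow>
      (\<forall>l\<ge>2. (\<lambda>n. real (f_depth 2 l n) / real n) \<longlonglongrightarrow> real l / (real l + 1))) \<and>
    (\<forall>k\<ge>3. (\<lambda>n. real (f_all k n) / real n) \<longlonglongrightarrow> 1 / 2)"
  using f_depth_2_2_limit f_depth_2_limit f_all_limit by simp

end
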